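(* Let $K$ be an almost real closed field and let $<$ be an order on $K$. Let $A\subseteq K^n$ be an $\mathcal{L}_{\mathrm{or}}$-definable subset. Then $A$ is Borel.
   Context: A field $K$ is almost real closed if it admits a (possibly trivial) henselian valuation whose residue field is real closed. An order on $K$ means a linear order making $K$ an ordered field. $\mathcal{L}_{\mathrm{or}}=\{+,-,\cdot,0,1,<\}$ is the language of ordered rings; $\mathcal{L}_{\mathrm{or}}$-definable means definable in $(K,<)$ with parameters from $K$. Borel means belonging to the $\sigma$-algebra generated by the open subsets of $K^n$, where $K$ carries the order topology (generated by open intervals; on an almost real closed field it does not depend on the chosen order) and $K^n$ the product topology. *)

theory Defs
  imports
    "HOL-Analysis.Analysis"
    "HOL-Computational_Algebra.Polynomial"
    "HOL-Algebra.QuotRing"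
    "HOL-Algebra.Polynomials"
begin

section \<open>Henselian valuations\<close>

text \<open>A Krull valuation into an ordered abelian group, which need not be the exact value group.
  The value at \<open>0\<close>, mathematically infinite, is left unspecified; every notion
  below treats \<open>0\<close> separately.\<close>

definition valuation :: "('a::field \<Rightarrow> 'g::linordered_ab_group_add) \<Rightarrow> bool" where
  "valuation v \<longleftrightarrow>
     (\<forall>x y. x \<noteq> 0 \<longrightarrow> y \<noteq> 0 \<longrightarrow> v (x * y) = v x + v y) \<and>
     (\<forall>x y. x \<noteq> 0 \<longrightarrow> y \<noteq> 0 \<longrightarrow> x + y \<noteq> 0 \<longrightarrow> min (v x) (v y) \<le> v (x + y))"

definition val_integers :: "('a::field \<Rightarrow> 'g::linordered_ab_group_add) \<Rightarrow> 'a set" where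
  "val_integers v = {x. x = 0 \<or> 0 \<le> v x}"

definition val_ideal :: "('a::field \<Rightarrow> 'g::linordered_ab_group_add) \<Rightarrow> 'a set" where
  "val_ideal v = {x. x = 0 \<or> 0 < v x}"

definition val_ring :: "('a::field \<Rightarrow> 'g::linordered_ab_group_add) \<Rightarrow> 'a ring" where
  "val_ring v = \<lparr>carrier = val_integers v, monoid.mult = (*), one = 1, ring.zero = 0, add = (+)\<rparr>"

definition residue_field :: "('a::field \<Rightarrow> 'g::linordered_ab_group_add) \<Rightarrow> 'a set ring" where
  "residue_field v = val_ring v Quot val_ideal v"

text \<open>Henselianity in the form of Hensel's lemma: simple residual roots lift.\<close>

definition henselian :: "('a::field \<Rightarrow> 'g::linordered_ab_group_add) \<Rightarrow> bool" where
  "henselian v \<longleftrightarrow>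
     (\<forall>f a. (\<forall>i. Polynomial.coeff f i \<in> val_integers v) \<longrightarrow> a \<in> val_integers v \<longrightarrow>
        poly f a \<in> val_ideal v \<longrightarrow> poly (pderiv f) a \<notin> val_ideal v \<longrightarrow>
        (\<exists>b \<in> val_integers v. poly f b = 0 \<and> b - a \<in> val_ideal v))"


section \<open>Almost real closed fields\<close>

text \<open>The Artin--Schreier axioms: formally real, every element is a square or the negative of a
  square, and every polynomial of odd degree has a root. In HOL-Algebra, polynomials are
  coefficient lists with nonzero head, so the degree is the length minus one.\<close>

definition real_closed_field :: "('b, 'c) ring_scheme \<Rightarrow> bool" where
  "real_closed_field R \<longleftrightarrow>
     field R \<and>
     (\<forall>(m::nat) f. f \<in> {..<m} \<rightarrow> carrier R \<longrightarrow>
        (\<Oplus>\<^bsub>R\<^esub>i\<in>{..<m}. f i \<otimes>\<^bsub>R\<^esub> f i) \<noteq> \<ominus>\<^bsub>R\<^esub> \<one>\<^bsub>R\<^esub>) \<and>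
     (\<forall>x \<in> carrier R. \<exists>y \<in> carrier R. x = y \<otimes>\<^bsub>R\<^esub> y \<or> x = \<ominus>\<^bsub>R\<^esub> (y \<otimes>\<^bsub>R\<^esub> y)) \<and>
     (\<forall>p. polynomial\<^bsub>R\<^esub> (carrier R) p \<longrightarrow> odd (Polynomials.degree p) \<longrightarrow>
        (\<exists>x \<in> carrier R. ring.eval R p x = \<zero>\<^bsub>R\<^esub>))"

text \<open>HOL cannot quantify existentially over the type of the value group, so that type is a
  parameter. A field is almost real closed iff this holds for some \<open>'g\<close>; a theorem
  assuming it with \<open>'g\<close> a free type variable therefore covers all almost real closed
  fields.\<close>

definition almost_real_closed ::
  "'a::field itself \<Rightarrow> 'g::linordered_ab_group_add itself \<Rightarrow> bool" where
  "almost_real_closed _ _ \<longleftrightarrow>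
     (\<exists>v :: 'a \<Rightarrow> 'g. valuation v \<and> henselian v \<and> real_closed_field (residue_field v))"


section \<open>Definability in the language of ordered rings\<close>

datatype or_term =
    Var nat
  | Zero
  | One
  | Plus or_term or_term
  | Minus or_term or_term
  | Times or_term or_term

datatype or_formula =
    Equal or_term or_term
  | Less or_term or_term
  | Not or_formula
  | And or_formula or_formula
  | Exists nat or_formula

primrec term_val :: "(nat \<Rightarrow> 'a::linordered_field) \<Rightarrow> or_term \<Rightarrow> 'a" where
  "term_val e (Var i) = e i"
| "term_val e Zero = 0"
| "term_val e One = 1"
| "term_val e (Plus s t) = term_val e s + term_val e t"
| "term_val e (Minus s t) = term_val e s - term_val e t"
| "term_val e (Times s t) = term_val e s * term_val e t"

primrec sat :: "(nat \<Rightarrow> 'a::linordered_field) \<Rightarrow> or_formula \<Rightarrow> bool" where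
  "sat e (Equal s t) \<longleftrightarrow> term_val e s = term_val e t"
| "sat e (Less s t) \<longleftrightarrow> term_val e s < term_val e t"
| "sat e (Not p) \<longleftrightarrow> \<not> sat e p"
| "sat e (And p q) \<longleftrightarrow> sat e p \<and> sat e q"
| "sat e (Exists i p) \<longleftrightarrow> (\<exists>a. sat (e(i := a)) p)"

text \<open>The space \<open>K\<^sup>n\<close> for a variable natural number \<open>n\<close>, as extensional functions.\<close>

definition affine_space :: "nat \<Rightarrow> (nat \<Rightarrow> 'a) set" where
  "affine_space n = {..<n} \<rightarrow>\<^sub>E UNIV"

text \<open>The variables below \<open>n\<close> are the coordinates; those from \<open>n\<close> on are assigned parameters
  by \<open>b\<close>, of which a formula uses only finitely many.\<close>

definition or_definable :: "nat \<Rightarrow> (nat \<Rightarrow> 'a::linordered_field) set \<Rightarrow> bool" where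
  "or_definable n A \<longleftrightarrow>
     (\<exists>p b. A = {x \<in> affine_space n. sat (\<lambda>i. if i < n then x i else b i) p})"


section \<open>Borel sets\<close>

text \<open>On \<open>'a\<close> the topology will be the order topology, through the class
  \<open>linorder_topology\<close>.\<close>

definition affine_topology :: "nat \<Rightarrow> (nat \<Rightarrow> 'a::topological_space) topology" where
  "affine_topology n = product_topology (\<lambda>_. euclidean) {..<n}"

definition borel_set :: "nat \<Rightarrow> (nat \<Rightarrow> 'a::topological_space) set \<Rightarrow> bool" where
  "borel_set n A \<longleftrightarrow> A \<in> sigma_sets (affine_space n) {U. openin (affine_topology n) U}"

end

theory Submission
  imports Defs "HOL-Algebra.Algebraic_Closure_Type" "HOL-Computational_Algebra.Polynomial_FPS"
begin

text \<open>
  Let \<open>sim\<close> be an equivalence relation on the field \<open>K\<close> such that related elements have the same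
  sign and the class of every nonzero element is open. Suppose that \<open>sim\<close> has the matching property:
  for finitely many polynomials \<open>p(e, Y)\<close>, whose coefficients are polynomial functions of a tuple
  \<open>e\<close>, there are finitely many polynomial functions \<open>g\<close> such that, whenever \<open>g(e)\<close> and \<open>g(e')\<close> are
  related for all \<open>g\<close>, every \<open>y\<close> has a partner \<open>y'\<close> with \<open>p(e, y)\<close> and \<open>p(e', y')\<close> related for
  all \<open>p\<close>. This is a semantic form of quantifier elimination: by induction on a formula, its truth
  at \<open>e\<close> depends only on the classes of finitely many polynomials evaluated at \<open>e\<close>
  (\<open>sat_determined\<close>). Zero sets of polynomials are closed and, on the set where given polynomials do
  not vanish, prescribing their classes in any way defines an open set. A definable set is therefore a
  finite union of sets, each the intersection of an open set with closed sets and complements of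
  closed sets (\<open>definable_imp_borel\<close>).

  It remains to find such a relation. Let \<open>v\<close> be a henselian valuation with real closed residue field
  and maximal ideal \<open>\<M>\<close>. The residue field has characteristic \<open>0\<close>.

  If \<open>v\<close> is nontrivial, relate \<open>x\<close> and \<open>y\<close> when \<open>y\<close> lies in \<open>x (1 + \<M>)\<close>, that is, when they
  have the same leading term. By Hensel's lemma the elements of \<open>1 + \<M>\<close> are squares, so they are
  positive and \<open>\<M>\<close> is convex; this gives signs and openness. For matching, let \<open>b\<close> be nearest
  to \<open>y\<close> among \<open>0\<close> and the roots of the given polynomials and their derivatives. If the Taylor expansion of \<open>p\<close> at
  \<open>b\<close> had a cancellation among its leading terms at \<open>y\<close>, then Hensel's lemma would give a root of a
  derivative of \<open>p\<close> nearer to \<open>y\<close>. So there is no cancellation, and the leading term of \<open>p(y)\<close> is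
  determined by those of \<open>y - b\<close> and of the derivatives of \<open>p\<close> at \<open>b\<close>. This reduces matching to roots
  \<open>c\<close> of a polynomial \<open>P\<close> of degree \<open>d\<close>. At \<open>c\<close> all other polynomials can be replaced by their
  remainders modulo \<open>P\<close>, which have smaller degree; the same argument, with \<open>b\<close> nearest to
  \<open>c\<close> among \<open>0\<close> and roots of polynomials of degree less than \<open>d\<close>, then finds the partner of \<open>c\<close> by
  induction on \<open>d\<close>, and Hensel's lemma makes it a root of the polynomial that corresponds to \<open>P\<close>
  (\<open>matching_same_leading_term\<close>).

  If \<open>v\<close> is trivial, \<open>K\<close> itself is real closed and two elements are related when they have the same
  sign. The intermediate value property follows from Laplace's proof of the fundamental theorem of
  algebra (\<open>ivt_mult\<close>). Matching follows from the Cohen--Hoermander argument: the order and the signs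
  at all roots of a family of polynomials are determined by those of the family in which one polynomial
  \<open>q\<close> of maximal degree is replaced by its derivative and by its remainders modulo the others, because
  the remainders give the sign of \<open>q\<close> at the critical points, between which \<open>q\<close> is monotone
  (\<open>matching_sgn\<close>).
\<close>

section \<open>Parametrized polynomials\<close>

locale coefficient_ring =
  fixes R :: "('e \<Rightarrow> 'a::field_char_0) set"
  assumes zero_closed: "(\<lambda>e. 0) \<in> R"
    and one_closed: "(\<lambda>e. 1) \<in> R"
    and add_closed: "f \<in> R \<Longrightarrow> g \<in> R \<Longrightarrow> (\<lambda>e. f e + g e) \<in> R"
    and diff_closed: "f \<in> R \<Longrightarrow> g \<in> R \<Longrightarrow> (\<lambda>e. f e - g e) \<in> R"
    and mult_closed: "f \<in> R \<Longrightarrow> g \<in> R \<Longrightarrow> (\<lambda>e. f e * g e) \<in> R"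
begin

lemma of_nat_closed: "(\<lambda>e. of_nat n) \<in> R"
  by (induction n) (auto intro: zero_closed one_closed add_closed)

lemma power_closed: "f \<in> R \<Longrightarrow> (\<lambda>e. f e ^ n) \<in> R"
  by (induction n) (auto intro: one_closed mult_closed)

text \<open>A polynomial whose coefficients are functions from \<open>R\<close> of a parameter \<open>e\<close>. The bound \<open>m\<close> is formal:
  at particular parameters the degree may drop, so case distinctions on the actual degree use the
  truncations \<open>poly_cutoff n (p e)\<close>.\<close>

definition family :: "nat \<Rightarrow> ('e \<Rightarrow> 'a poly) \<Rightarrow> bool" where
  "family m p \<longleftrightarrow> (\<forall>i. (\<lambda>e. Polynomial.coeff (p e) i) \<in> R) \<and>
     (\<forall>e. \<forall>i\<ge>m. Polynomial.coeff (p e) i = 0)"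

lemma family_coeff: "family m p \<Longrightarrow> (\<lambda>e. Polynomial.coeff (p e) i) \<in> R"
  by (simp add: family_def)

lemma family_mono: "family m p \<Longrightarrow> m \<le> n \<Longrightarrow> family n p"
  by (auto simp: family_def)

lemma family_zero: "family m (\<lambda>e. 0)"
  by (simp add: family_def zero_closed)

lemma family_degree: "family m p \<Longrightarrow> p e \<noteq> 0 \<Longrightarrow> Polynomial.degree (p e) < m"
  by (metis family_def leading_coeff_0_iff not_le)

lemma family_pderiv: "family (Suc m) p \<Longrightarrow> family m (\<lambda>e. pderiv (p e))"
  using mult_closed[OF of_nat_closed family_coeff[of "Suc m" p]]
  by (auto simp: family_def coeff_pderiv simp del: of_nat_Suc)

lemma family_higher_pderiv: "family m p \<Longrightarrow> family m (\<lambda>e. (pderiv ^^ k) (p e))"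
  using mult_closed[OF of_nat_closed family_coeff[of m p]]
  by (auto simp: family_def coeff_higher_pderiv pochhammer_of_nat simp del: of_nat_Suc)

lemma family_higher_pderiv_nonzero: "family m p \<Longrightarrow> (pderiv ^^ k) (p e) \<noteq> 0 \<Longrightarrow> k < m"
  by (auto simp: family_def coeff_higher_pderiv poly_eq_iff not_le intro: ccontr)

lemma family_cutoff: "family m p \<Longrightarrow> family n (\<lambda>e. poly_cutoff n (p e))"
proof -
  assume p: "family m p"
  have "(\<lambda>e. if i < n then Polynomial.coeff (p e) i else 0) \<in> R" for i
    by (cases "i < n") (simp_all add: zero_closed family_coeff[OF p])
  then show ?thesis
    by (simp add: family_def coeff_poly_cutoff)
qed

lemma sum_closed: "(\<And>i. i \<in> I \<Longrightarrow> f i \<in> R) \<Longrightarrow> (\<lambda>e. \<Sum>i\<in>I. f i e) \<in> R"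
  by (induction I rule: infinite_finite_induct) (auto intro: zero_closed add_closed)

lemma family_const: "c \<in> R \<Longrightarrow> family 1 (\<lambda>e. [:c e:])"
proof -
  assume c: "c \<in> R"
  have "(\<lambda>e. Polynomial.coeff [:c e:] i) \<in> R" for i
    using c zero_closed by (cases i) simp_all
  then show ?thesis
    by (simp add: family_def coeff_pCons split: nat.split)
qed

lemma family_add: "family m p \<Longrightarrow> family n q \<Longrightarrow> family (max m n) (\<lambda>e. p e + q e)"
  by (simp add: family_def add_closed)

lemma family_diff: "family m p \<Longrightarrow> family n q \<Longrightarrow> family (max m n) (\<lambda>e. p e - q e)"
  by (simp add: family_def diff_closed)

lemma family_mult:
  assumes "family m p" "family n q"
  shows "family (m + n) (\<lambda>e. p e * q e)"
  unfolding family_def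
proof (intro conjI allI impI)
  show "(\<lambda>e. Polynomial.coeff (p e * q e) i) \<in> R" for i
    unfolding coeff_mult using assms by (intro sum_closed mult_closed family_coeff)
  show "Polynomial.coeff (p e * q e) i = 0" if "m + n \<le> i" for e i
  proof (cases "p e = 0 \<or> q e = 0")
    case False
    then have "Polynomial.degree (p e) < m" "Polynomial.degree (q e) < n"
      using assms family_degree by blast+
    then show ?thesis
      using that degree_mult_le[of "p e" "q e"] by (intro coeff_eq_0) linarith
  qed auto
qed

lemma finite_family_bound:
  assumes "finite F" "\<forall>p\<in>F. \<exists>m. family m p"
  obtains m where "\<forall>p\<in>F. family m p"
proof -
  obtain f where f: "\<forall>p\<in>F. family (f p) p"
    using bchoice[OF assms(2)] by blast
  have "\<forall>p\<in>F. family (Max (f ` F)) p"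
    using f assms(1) by (auto intro: family_mono)
  then show ?thesis
    by (rule that)
qed

text \<open>Pseudo-division, evaluated at the roots of the divisor. The coefficient of degree \<open>k\<close> of \<open>q\<close> may
  vanish for some parameters; multiplying by a power of it instead of dividing keeps all coefficients
  in \<open>R\<close>, and the identity then holds for every parameter. The exponent and the remainder do not
  depend on the parameter.\<close>

lemma reduction_at_roots:
  assumes "family m p" "family (Suc k) q"
  shows "\<exists>N r. family k r \<and> (\<forall>e c. poly (q e) c = 0 \<longrightarrow>
           Polynomial.coeff (q e) k ^ N * poly (p e) c = poly (r e) c)"
  using assms(1)
proof (induction m arbitrary: p)
  case 0
  then have "p e = 0" for e
    by (simp add: family_def poly_eq_iff)
  then show ?case
    by (intro exI[of _ 0] exI[of _ "\<lambda>e. 0"]) (simp add: family_zero)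
next
  case (Suc m)
  let ?l = "\<lambda>e. Polynomial.coeff (q e) k"
  define p1 where "p1 = (\<lambda>e. poly_shift 1 (p e))"
  have p: "p e = pCons (Polynomial.coeff (p e) 0) (p1 e)" for e
    by (simp add: p1_def poly_eq_iff coeff_pCons coeff_poly_shift split: nat.split)
  have "family m p1"
    using Suc.prems by (auto simp: p1_def family_def coeff_poly_shift)
  then obtain N r where r: "family k r"
    "\<And>e c. poly (q e) c = 0 \<Longrightarrow> ?l e ^ N * poly (p1 e) c = poly (r e) c"
    using Suc.IH by blast
  show ?case
  proof (cases k)
    case 0
    have "q e = [:?l e:]" for e
      using assms(2) 0 by (auto simp: family_def poly_eq_iff coeff_pCons split: nat.split)
    then have "poly (q e) c = poly [:?l e:] c" for e c
      by (rule arg_cong)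
    then have "poly (q e) c = ?l e" for e c
      by simp
    \<comment> \<open>A constant has a root only if it is \<open>0\<close>; its first power makes the left-hand side vanish.\<close>
    then show ?thesis
      by (intro exI[of _ 1] exI[of _ "\<lambda>e. 0"]) (simp add: family_zero)
  next
    case (Suc k')
    define s where "s = (\<lambda>e. [:?l e ^ Suc N * Polynomial.coeff (p e) 0:] +
        Polynomial.smult (?l e) (pCons 0 (r e)) - Polynomial.smult (Polynomial.coeff (r e) k') (q e))"
    have l: "?l \<in> R"
      using assms(2) by (rule family_coeff)
    have "family k s"
      unfolding family_def
    proof (intro conjI allI impI)
      fix i
      show "(\<lambda>e. Polynomial.coeff (s e) i) \<in> R"
        using l family_coeff[OF assms(2)] family_coeff[OF r(1)] family_coeff[OF \<open>family (Suc m) p\<close>]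
        by (cases i) (auto simp: s_def intro!: zero_closed diff_closed add_closed mult_closed power_closed)
    next
      fix e i assume "k \<le> i"
      then obtain j where j: "i = Suc j" "k' \<le> j"
        using Suc Suc_le_D by auto
      have "Polynomial.coeff (r e) j = 0" "Polynomial.coeff (q e) i = 0" if "j \<noteq> k'"
        using that j r(1) assms(2) Suc by (auto simp: family_def)
      then show "Polynomial.coeff (s e) i = 0"
        using j Suc by (cases "j = k'") (auto simp: s_def)
    qed
    moreover have "?l e ^ Suc N * poly (p e) c = poly (s e) c" if "poly (q e) c = 0" for e c
    proof -
      have "?l e ^ Suc N * poly (p e) c = ?l e ^ Suc N * (Polynomial.coeff (p e) 0 + c * poly (p1 e) c)"
        by (subst p) simp
      also have "\<dots> = ?l e ^ Suc N * Polynomial.coeff (p e) 0 + ?l e * (c * (?l e ^ N * poly (p1 e) c))"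
        by (simp add: algebra_simps)
      also have "\<dots> = poly (s e) c"
        using r(2)[OF that] that by (simp add: s_def)
      finally show ?thesis .
    qed
    ultimately show ?thesis
      by blast
  qed
qed

text \<open>If the classes modulo \<open>sim\<close> of finitely many coefficient functions agree at two parameters, the same
  tuples of classes are attained by the polynomials at both parameters. This is the step that eliminates
  one existential quantifier.\<close>

definition matching :: "('a \<Rightarrow> 'a \<Rightarrow> bool) \<Rightarrow> bool" where
  "matching sim \<longleftrightarrow> (\<forall>F. finite F \<longrightarrow> (\<forall>p\<in>F. \<exists>m. family m p) \<longrightarrow>
     (\<exists>G\<subseteq>R. finite G \<and> (\<forall>e e'. (\<forall>g\<in>G. sim (g e) (g e')) \<longrightarrow>
        (\<forall>y. \<exists>y'. \<forall>p\<in>F. sim (poly (p e) y) (poly (p e') y')))))"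

end

section \<open>Leading terms in a valued field\<close>

lemma finite_total_preorder_greatest:
  assumes "finite I" "I \<noteq> {}" and total: "\<And>x y. P x y \<or> P y x"
    and trans: "\<And>x y z. P x y \<Longrightarrow> P y z \<Longrightarrow> P x z"
  shows "\<exists>m\<in>I. \<forall>i\<in>I. P i m"
  using assms(1,2)
proof (induction I rule: finite_ne_induct)
  case (singleton x)
  then show ?case
    using total[of x x] by simp
next
  case (insert x F)
  then obtain m where m: "m \<in> F" "\<forall>i\<in>F. P i m"
    by blast
  show ?case
  proof (cases "P x m")
    case True
    with m show ?thesis
      by auto
  next
    case False
    then have "P m x"
      using total by blast
    with m show ?thesis
      using total[of x x] by (intro bexI[of _ x]) (auto intro: trans)
  qed
qed

locale valued_field =
  fixes v :: "'a::field_char_0 \<Rightarrow> 'g::linordered_ab_group_add"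
  assumes valuation: "valuation v"
begin

abbreviation "\<O> \<equiv> val_integers v"
abbreviation "\<M> \<equiv> val_ideal v"

lemma v_mult: "x \<noteq> 0 \<Longrightarrow> y \<noteq> 0 \<Longrightarrow> v (x * y) = v x + v y"
  and v_add: "x \<noteq> 0 \<Longrightarrow> y \<noteq> 0 \<Longrightarrow> x + y \<noteq> 0 \<Longrightarrow> min (v x) (v y) \<le> v (x + y)"
  using valuation by (auto simp: valuation_def)

lemma v_one [simp]: "v 1 = 0"
  using v_mult[of 1 1] by simp

lemma v_uminus [simp]: "v (- x) = v x"
proof (cases "x = 0")
  case False
  have "v (-1) + v (-1) = 0"
    using v_mult[of "-1" "-1"] by simp
  then have "v (-1) = 0"
    by simp
  then show ?thesis
    using v_mult[of "-1" x] False by simp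
qed simp

lemma v_inverse: "x \<noteq> 0 \<Longrightarrow> v (inverse x) = - v x"
  using v_mult[of x "inverse x"] by (simp add: eq_neg_iff_add_eq_0 add.commute)

lemma zero_in_integers [simp]: "0 \<in> \<O>" and zero_in_ideal [simp]: "0 \<in> \<M>"
  and one_in_integers [simp]: "1 \<in> \<O>" and one_notin_ideal [simp]: "1 \<notin> \<M>"
  by (auto simp: val_integers_def val_ideal_def)

lemma ideal_subset_integers: "x \<in> \<M> \<Longrightarrow> x \<in> \<O>"
  by (auto simp: val_integers_def val_ideal_def)

lemma integers_add: "x \<in> \<O> \<Longrightarrow> y \<in> \<O> \<Longrightarrow> x + y \<in> \<O>"
  using v_add[of x y] by (force simp: val_integers_def min_def split: if_splits)

lemma ideal_add: "x \<in> \<M> \<Longrightarrow> y \<in> \<M> \<Longrightarrow> x + y \<in> \<M>"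
  using v_add[of x y] by (force simp: val_ideal_def min_def split: if_splits)

lemma integers_uminus [simp]: "- x \<in> \<O> \<longleftrightarrow> x \<in> \<O>"
  and ideal_uminus [simp]: "- x \<in> \<M> \<longleftrightarrow> x \<in> \<M>"
  by (auto simp: val_integers_def val_ideal_def)

lemma ideal_diff: "x \<in> \<M> \<Longrightarrow> y \<in> \<M> \<Longrightarrow> x - y \<in> \<M>"
  using ideal_add[of x "- y"] by simp

lemma ideal_diff_commute: "x - y \<in> \<M> \<longleftrightarrow> y - x \<in> \<M>"
  using ideal_uminus[of "x - y"] by simp

lemma integers_mult: "x \<in> \<O> \<Longrightarrow> y \<in> \<O> \<Longrightarrow> x * y \<in> \<O>"
  by (cases "x = 0 \<or> y = 0") (auto simp: val_integers_def v_mult)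

lemma ideal_mult: "x \<in> \<O> \<Longrightarrow> y \<in> \<M> \<Longrightarrow> x * y \<in> \<M>"
  by (cases "x = 0 \<or> y = 0")
     (auto simp: val_integers_def val_ideal_def v_mult add_nonneg_pos)

lemma ideal_mult': "x \<in> \<M> \<Longrightarrow> y \<in> \<O> \<Longrightarrow> x * y \<in> \<M>"
  using ideal_mult[of y x] by (simp add: mult.commute)

lemma notin_integers_inverse: "x \<notin> \<O> \<Longrightarrow> inverse x \<in> \<M>"
  by (auto simp: val_integers_def val_ideal_def v_inverse)

lemma notin_ideal_inverse: "x \<notin> \<M> \<Longrightarrow> inverse x \<in> \<O>"
  by (auto simp: val_integers_def val_ideal_def v_inverse)

lemma ideal_prime: "x * y \<in> \<M> \<Longrightarrow> x \<in> \<M> \<or> y \<in> \<M>"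
  using add_nonpos_nonpos[of "v x" "v y"]
  by (cases "x = 0 \<or> y = 0") (auto simp: val_ideal_def v_mult simp flip: not_le)

lemma integers_sum: "(\<And>i. i \<in> I \<Longrightarrow> f i \<in> \<O>) \<Longrightarrow> sum f I \<in> \<O>"
  by (induction I rule: infinite_finite_induct) (auto intro: integers_add)

lemma ideal_sum: "(\<And>i. i \<in> I \<Longrightarrow> f i \<in> \<M>) \<Longrightarrow> sum f I \<in> \<M>"
  by (induction I rule: infinite_finite_induct) (auto intro: ideal_add)

lemma of_nat_in_integers [simp]: "of_nat n \<in> \<O>"
  by (induction n) (auto intro: integers_add)

text \<open>Divisibility by integral elements replaces comparison of values, so that \<open>0\<close> needs no separate
  treatment: for nonzero elements, \<open>dominated x y\<close> means \<open>v y \<le> v x\<close> and \<open>negligible x y\<close> means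
  \<open>v y < v x\<close>.\<close>

definition dominated :: "'a \<Rightarrow> 'a \<Rightarrow> bool" where
  "dominated x y \<longleftrightarrow> (\<exists>u\<in>\<O>. x = u * y)"

definition negligible :: "'a \<Rightarrow> 'a \<Rightarrow> bool" where
  "negligible x y \<longleftrightarrow> (\<exists>u\<in>\<M>. x = u * y)"

text \<open>Equality in the leading term structure \<open>K / (1 + \<M>)\<close>, with \<open>0\<close> as a class of its own.\<close>

definition same_leading_term :: "'a \<Rightarrow> 'a \<Rightarrow> bool" where
  "same_leading_term x y \<longleftrightarrow> negligible (y - x) x"

lemma dominated_trans: "dominated x y \<Longrightarrow> dominated y z \<Longrightarrow> dominated x z"
  unfolding dominated_def by (metis integers_mult mult.assoc)

lemma not_dominated: "\<not> dominated x y \<Longrightarrow> negligible y x"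
proof -
  assume *: "\<not> dominated x y"
  show "negligible y x"
  proof (cases "y = 0")
    case True
    then show ?thesis
      by (auto simp: negligible_def intro!: bexI[of _ 0])
  next
    case False
    with * have "x / y \<notin> \<O>" "x \<noteq> 0"
      by (force simp: dominated_def)+
    then show ?thesis
      using notin_integers_inverse[of "x / y"] 
      by (auto simp: negligible_def intro!: bexI[of _ "y / x"])
  qed
qed

lemma negligible_imp_dominated: "negligible x y \<Longrightarrow> dominated x y"
  by (auto simp: dominated_def negligible_def intro: ideal_subset_integers)

lemma dominated_total: "dominated x y \<or> dominated y x"
  using not_dominated negligible_imp_dominated by blast

lemma negligible_dominated_eq_0:
  assumes "negligible y x" "dominated x y"
  shows "x = 0"
proof (rule ccontr)
  assume "x \<noteq> 0"
  obtain u where "u \<in> \<M>" "y = u * x"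
    using assms by (auto simp: negligible_def)
  moreover obtain w where "w \<in> \<O>" "x = w * y"
    using assms by (auto simp: dominated_def)
  ultimately have uw: "u \<in> \<M>" "y = u * x" "w \<in> \<O>" "x = w * y"
    by auto
  then have "x = (w * u) * x"
    by (simp add: mult.assoc)
  with \<open>x \<noteq> 0\<close> have "w * u = 1"
    by simp
  then show False
    using ideal_mult[OF uw(3,1)] by simp
qed

lemma negligible_dominated_trans: "negligible x y \<Longrightarrow> dominated y z \<Longrightarrow> negligible x z"
  unfolding dominated_def negligible_def by (metis ideal_mult' mult.assoc)

lemma negligible_add: "negligible x z \<Longrightarrow> negligible y z \<Longrightarrow> negligible (x + y) z"
  unfolding negligible_def by (metis ideal_add distrib_right)

lemma negligible_0 [simp]: "negligible 0 z"
  by (auto simp: negligible_def intro!: bexI[of _ 0])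

lemma dominated_0 [simp]: "dominated 0 z"
  by (auto simp: dominated_def intro!: bexI[of _ 0])

lemma negligible_sum: "(\<And>i. i \<in> I \<Longrightarrow> negligible (f i) z) \<Longrightarrow> negligible (sum f I) z"
  by (induction I rule: infinite_finite_induct) (auto intro: negligible_add)

lemma same_leading_term_iff: "same_leading_term x y \<longleftrightarrow> (\<exists>u. u - 1 \<in> \<M> \<and> y = u * x)"
proof
  assume "same_leading_term x y"
  then obtain u where "u \<in> \<M>" "y - x = u * x"
    by (auto simp: same_leading_term_def negligible_def)
  then show "\<exists>u. u - 1 \<in> \<M> \<and> y = u * x"
    by (intro exI[of _ "1 + u"]) (auto simp: algebra_simps)
next
  assume "\<exists>u. u - 1 \<in> \<M> \<and> y = u * x"
  then obtain u where "u - 1 \<in> \<M>" "y = u * x"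
    by auto
  then show "same_leading_term x y"
    by (auto simp: same_leading_term_def negligible_def algebra_simps intro!: bexI[of _ "u - 1"])
qed

lemma one_unit_mult:
  assumes "u - 1 \<in> \<M>" "w - 1 \<in> \<M>"
  shows "u * w - 1 \<in> \<M>"
proof -
  have "u * w - 1 = (u - 1) * (w - 1) + (u - 1) + (w - 1)"
    by (simp add: algebra_simps)
  also have "\<dots> \<in> \<M>"
    using assms by (intro ideal_add ideal_mult ideal_subset_integers)
  finally show ?thesis .
qed

lemma one_unit_nonzero: "u - 1 \<in> \<M> \<Longrightarrow> u \<noteq> 0"
  by auto

lemma one_unit_notin_ideal: "u - 1 \<in> \<M> \<Longrightarrow> u \<notin> \<M>"
  using ideal_diff[of u "u - 1"] by auto

lemma one_unit_inverse:
  assumes "u - 1 \<in> \<M>"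
  shows "inverse u - 1 \<in> \<M>"
proof -
  have "inverse u - 1 = inverse u * (- (u - 1))"
    using one_unit_nonzero[OF assms] by (simp add: algebra_simps)
  then show ?thesis
    using assms one_unit_notin_ideal[OF assms]
    by (metis ideal_mult ideal_uminus notin_ideal_inverse)
qed

lemma one_unit_power: "u - 1 \<in> \<M> \<Longrightarrow> u ^ n - 1 \<in> \<M>"
  by (induction n) (auto intro: one_unit_mult)

lemma same_leading_term_refl [simp]: "same_leading_term x x"
  by (simp add: same_leading_term_def)

lemma same_leading_term_sym: "same_leading_term x y \<Longrightarrow> same_leading_term y x"
  unfolding same_leading_term_iff
  by (metis one_unit_inverse one_unit_nonzero left_inverse mult.assoc mult_1)

lemma same_leading_term_mult:
  "same_leading_term x y \<Longrightarrow> same_leading_term x' y' \<Longrightarrow> same_leading_term (x * x') (y * y')"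
proof -
  assume "same_leading_term x y" "same_leading_term x' y'"
  then obtain u w where "u - 1 \<in> \<M>" "y = u * x" "w - 1 \<in> \<M>" "y' = w * x'"
    by (auto simp: same_leading_term_iff)
  then show ?thesis
    unfolding same_leading_term_iff by (intro exI[of _ "u * w"]) (simp add: one_unit_mult)
qed

lemma same_leading_term_power: "same_leading_term x y \<Longrightarrow> same_leading_term (x ^ n) (y ^ n)"
  by (induction n) (auto intro: same_leading_term_mult)

lemma same_leading_term_mult_cancel:
  assumes "same_leading_term x y" "x \<noteq> 0" "same_leading_term (x * x') (y * y')"
  shows "same_leading_term x' y'"
proof -
  obtain u w where "u - 1 \<in> \<M>" "y = u * x" "w - 1 \<in> \<M>" "y * y' = w * (x * x')"
    using assms by (auto simp: same_leading_term_iff)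
  moreover from this have "y' = (inverse u * w) * x'"
    using assms(2) one_unit_nonzero[of u] by (auto simp: field_simps)
  ultimately show ?thesis
    unfolding same_leading_term_iff by (metis one_unit_mult one_unit_inverse)
qed

text \<open>The valuation of the value at \<open>1\<close> is the least valuation of a coefficient. A polynomial \<open>p\<close> near a
  center \<open>b\<close> is studied at \<open>b + t\<close> through \<open>p(b + t Y)\<close>, so that the point becomes \<open>1\<close>.\<close>

definition no_cancellation :: "'a poly \<Rightarrow> bool" where
  "no_cancellation q \<longleftrightarrow> (\<forall>i. dominated (Polynomial.coeff q i) (poly q 1))"

lemma poly_eq_sum_le:
  fixes p :: "'b::comm_semiring_1 poly"
  assumes "Polynomial.degree p \<le> n"
  shows "poly p x = (\<Sum>i\<le>n. Polynomial.coeff p i * x ^ i)"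
  using assms unfolding poly_altdef
  by (intro sum.mono_neutral_left) (auto simp: coeff_eq_0)

text \<open>Changing every coefficient and the argument within its leading term changes each monomial only by
  something negligible compared with that monomial. Without cancellation this is negligible compared
  with the whole value.\<close>

lemma poly_same_leading_term:
  assumes sim: "\<And>i. same_leading_term (Polynomial.coeff q i) (Polynomial.coeff q' i)"
    and nc: "no_cancellation q" and s: "s - 1 \<in> \<M>"
  shows "same_leading_term (poly q 1) (poly q' s)"
proof -
  define n where "n = max (Polynomial.degree q) (Polynomial.degree q')"
  have "poly q' s - poly q 1 =
      (\<Sum>i\<le>n. Polynomial.coeff q' i * s ^ i - Polynomial.coeff q i * 1 ^ i)"
    unfolding sum_subtractf using poly_eq_sum_le[of q n 1] poly_eq_sum_le[of q' n s]
    by (simp add: n_def)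
  moreover have "negligible \<dots> (poly q 1)"
  proof (rule negligible_sum)
    fix i
    have "same_leading_term 1 (s ^ i)"
      using one_unit_power[OF s, of i] by (auto simp: same_leading_term_iff)
    then have "same_leading_term (Polynomial.coeff q i * 1 ^ i) (Polynomial.coeff q' i * s ^ i)"
      using same_leading_term_mult[OF sim[of i], of 1 "s ^ i"] by simp
    then show "negligible (Polynomial.coeff q' i * s ^ i - Polynomial.coeff q i * 1 ^ i) (poly q 1)"
      using nc unfolding same_leading_term_def no_cancellation_def
      by (auto intro: negligible_dominated_trans)
  qed
  ultimately show ?thesis
    by (simp add: same_leading_term_def)
qed

end

locale henselian_residue_char_0 = valued_field v
  for v :: "'a::field_char_0 \<Rightarrow> 'g::linordered_ab_group_add" +
  assumes henselian: "henselian v"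
    and residue_char_0: "n > 0 \<Longrightarrow> of_nat n \<notin> val_ideal v"
begin

text \<open>Scale \<open>q\<close> to a polynomial \<open>r\<close> with integral coefficients and at least one unit coefficient. A
  cancellation at \<open>1\<close> means that \<open>1\<close> is a root of the residue polynomial. Since this polynomial is
  nonzero and the residue characteristic is \<open>0\<close>, the multiplicity of the root is finite and it is a
  simple root of some derivative; Hensel's lemma lifts it.\<close>

lemma cancellation_imp_root_of_derivative:
  assumes "\<not> no_cancellation q"
  obtains k s where "s - 1 \<in> \<M>" "(pderiv ^^ k) q \<noteq> 0" "poly ((pderiv ^^ k) q) s = 0"
proof -
  define n where "n = Polynomial.degree q"
  obtain m where m: "m \<le> n"
    "\<And>i. i \<le> n \<Longrightarrow> dominated (Polynomial.coeff q i) (Polynomial.coeff q m)"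
  proof -
    have "\<exists>m\<in>{..n}. \<forall>i\<in>{..n}. dominated (Polynomial.coeff q i) (Polynomial.coeff q m)"
      by (rule finite_total_preorder_greatest) (use dominated_total dominated_trans in blast)+
    then show ?thesis
      using that by blast
  qed
  have m': "dominated (Polynomial.coeff q i) (Polynomial.coeff q m)" for i
    using m(2)[of i] by (cases "i \<le> n") (auto simp: n_def coeff_eq_0)
  define \<mu> where "\<mu> = Polynomial.coeff q m"
  obtain i where "\<not> dominated (Polynomial.coeff q i) (poly q 1)"
    using assms by (auto simp: no_cancellation_def)
  then have negl: "negligible (poly q 1) \<mu>"
    unfolding \<mu>_def using not_dominated negligible_dominated_trans m' by blast
  have "\<mu> \<noteq> 0"
    using \<open>\<not> dominated _ (poly q 1)\<close> m'[of i] by (auto simp: \<mu>_def dominated_def)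
  define r where "r = Polynomial.smult (1 / \<mu>) q"
  have q: "q = Polynomial.smult \<mu> r"
    using \<open>\<mu> \<noteq> 0\<close> by (simp add: r_def)
  have r_int: "Polynomial.coeff r i \<in> \<O>" for i
    using m'[of i] \<open>\<mu> \<noteq> 0\<close> by (auto simp: r_def \<mu>_def dominated_def)
  have r1: "poly r 1 \<in> \<M>"
    using negl \<open>\<mu> \<noteq> 0\<close> by (auto simp: r_def negligible_def)
  define J where "J = {i. Polynomial.coeff r i \<notin> \<M>}"
  have "J \<subseteq> {..n}"
    by (auto simp: J_def r_def n_def coeff_eq_0 intro!: leI)
  then have "finite J"
    using finite_subset by blast
  have "m \<in> J"
    using \<open>\<mu> \<noteq> 0\<close> by (simp add: J_def r_def \<mu>_def)
  define j where "j = Max J"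
  have j: "Polynomial.coeff r j \<notin> \<M>"
    using Max_in[of J] \<open>finite J\<close> \<open>m \<in> J\<close> by (auto simp: j_def J_def)
  have j_max: "Polynomial.coeff r i \<in> \<M>" if "i > j" for i
    using Max_ge[OF \<open>finite J\<close>, of i] that by (auto simp: j_def J_def)
  have coeff_int: "Polynomial.coeff ((pderiv ^^ k) r) i \<in> \<O>" for k i
    using r_int by (simp add: coeff_higher_pderiv pochhammer_of_nat integers_mult del: of_nat_Suc)
  \<comment> \<open>Modulo \<open>\<M>\<close> the polynomial \<open>r\<close> has degree \<open>j\<close>, so its derivative of order \<open>j\<close> is the
    constant \<open>j!\<close> times its leading coefficient, a unit.\<close>
  have "poly ((pderiv ^^ j) r) 1 \<notin> \<M>"
  proof
    let ?p = "(pderiv ^^ j) r"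
    assume *: "poly ?p 1 \<in> \<M>"
    have "poly ?p 1 = (\<Sum>i\<le>Polynomial.degree ?p. Polynomial.coeff ?p i)"
      by (simp add: poly_altdef)
    also have "\<dots> = Polynomial.coeff ?p 0 + (\<Sum>i\<in>{..Polynomial.degree ?p} - {0}. Polynomial.coeff ?p i)"
      by (subst sum.remove[of _ 0]) auto
    finally have eq: "Polynomial.coeff ?p 0 =
        poly ?p 1 - (\<Sum>i\<in>{..Polynomial.degree ?p} - {0}. Polynomial.coeff ?p i)"
      by simp
    have "Polynomial.coeff ?p 0 \<in> \<M>"
      unfolding eq using *
      by (intro ideal_diff ideal_sum)
         (auto simp: coeff_higher_pderiv pochhammer_of_nat simp del: of_nat_Suc intro!: ideal_mult j_max)
    moreover have "Polynomial.coeff ?p 0 = of_nat (fact j) * Polynomial.coeff r j"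
      using pochhammer_fact[of j, where ?'a = 'a] by (simp add: coeff_higher_pderiv)
    ultimately show False
      using ideal_prime[of "of_nat (fact j)"] j residue_char_0[of "fact j"] by auto
  qed
  define k0 where "k0 = (LEAST k. poly ((pderiv ^^ k) r) 1 \<notin> \<M>)"
  have k0: "poly ((pderiv ^^ k0) r) 1 \<notin> \<M>"
    unfolding k0_def by (rule LeastI) fact
  have "k0 \<noteq> 0"
    using k0 r1 by (intro notI) simp
  then obtain k where k: "k0 = Suc k"
    using not0_implies_Suc by blast
  have k1: "poly ((pderiv ^^ k) r) 1 \<in> \<M>"
    using not_less_Least[of k "\<lambda>k. poly ((pderiv ^^ k) r) 1 \<notin> \<M>"] by (auto simp: k0_def[symmetric] k)
  have k2: "poly (pderiv ((pderiv ^^ k) r)) 1 \<notin> \<M>"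
    using k0 by (simp add: k)
  obtain s where s: "poly ((pderiv ^^ k) r) s = 0" "s - 1 \<in> \<M>"
    using henselian coeff_int k1 k2 unfolding henselian_def by (metis one_in_integers)
  have "(pderiv ^^ k) r \<noteq> 0"
    using k2 by auto
  then show ?thesis
    using s \<open>\<mu> \<noteq> 0\<close> by (intro that[of s k]) (auto simp: q higher_pderiv_smult)
qed

text \<open>As the derivative has no cancellation at \<open>1\<close>, dividing \<open>q\<close> by its derivative at \<open>1\<close> gives a polynomial
  with integral coefficients and simple residual root \<open>1\<close>. The residue polynomial depends only on
  the leading terms of the coefficients, so Hensel's lemma applies to \<open>q'\<close> as well.\<close>

lemma lift_root:
  assumes sim: "\<And>i. same_leading_term (Polynomial.coeff q i) (Polynomial.coeff q' i)"
    and root: "poly q 1 = 0"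
    and nc: "no_cancellation (pderiv q)" and nonzero: "pderiv q \<noteq> 0"
  obtains s where "s - 1 \<in> \<M>" "poly q' s = 0"
proof -
  define \<mu> where "\<mu> = poly (pderiv q) 1"
  have "\<mu> \<noteq> 0"
    using nc nonzero by (auto simp: no_cancellation_def \<mu>_def dominated_def poly_eq_iff)
  define r where "r = Polynomial.smult (1 / \<mu>) q"
  define r' where "r' = Polynomial.smult (1 / \<mu>) q'"
  have r_Suc: "Polynomial.coeff r (Suc i) \<in> \<O>" for i
  proof -
    obtain u where u: "u \<in> \<O>" "of_nat (Suc i) * Polynomial.coeff q (Suc i) = u * \<mu>"
      using nc unfolding no_cancellation_def \<mu>_def dominated_def by (metis coeff_pderiv)
    have "Polynomial.coeff r (Suc i) = inverse (of_nat (Suc i)) * u"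
      using u(2) \<open>\<mu> \<noteq> 0\<close> unfolding r_def
      by (simp add: field_simps del: of_nat_Suc)
    then show ?thesis
      using u(1) notin_ideal_inverse[OF residue_char_0[of "Suc i"]]
      by (simp add: integers_mult del: of_nat_Suc)
  qed
  have "poly r 1 = (\<Sum>i\<le>Polynomial.degree r. Polynomial.coeff r i)"
    by (simp add: poly_altdef)
  also have "\<dots> = Polynomial.coeff r 0 + (\<Sum>i\<in>{..Polynomial.degree r} - {0}. Polynomial.coeff r i)"
    by (subst sum.remove[of _ 0]) auto
  finally have "Polynomial.coeff r 0 = - (\<Sum>i\<in>{..Polynomial.degree r} - {0}. Polynomial.coeff r i)"
    using root by (simp add: r_def eq_neg_iff_add_eq_0)
  moreover have "(\<Sum>i\<in>{..Polynomial.degree r} - {0}. Polynomial.coeff r i) \<in> \<O>"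
    using r_Suc by (intro integers_sum) (metis DiffE insertI1 not0_implies_Suc)
  ultimately have "Polynomial.coeff r 0 \<in> \<O>"
    by simp
  with r_Suc have r_int: "Polynomial.coeff r i \<in> \<O>" for i
    by (cases i) auto
  have diff: "Polynomial.coeff (r' - r) i \<in> \<M>" for i
  proof -
    obtain u where u: "u \<in> \<M>" "Polynomial.coeff q' i - Polynomial.coeff q i = u * Polynomial.coeff q i"
      using sim[of i] by (auto simp: same_leading_term_def negligible_def)
    have "Polynomial.coeff (r' - r) i = u * Polynomial.coeff r i"
      using u(2) by (simp add: r_def r'_def diff_divide_distrib[symmetric])
    then show ?thesis
      using ideal_mult'[OF u(1) r_int[of i]] by simp
  qed
  have r'_int: "Polynomial.coeff r' i \<in> \<O>" for i
    using integers_add[OF ideal_subset_integers[OF diff[of i]] r_int[of i]] by simp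
  have "poly (r' - r) 1 \<in> \<M>"
    unfolding poly_altdef using diff by (intro ideal_sum) auto
  then have r'1: "poly r' 1 \<in> \<M>"
    using root by (simp add: r_def)
  have "poly (pderiv (r' - r)) 1 \<in> \<M>"
    unfolding poly_altdef using diff
    by (intro ideal_sum) (auto simp: coeff_pderiv simp del: of_nat_Suc intro!: ideal_mult)
  moreover have "poly (pderiv r) 1 = 1"
    using \<open>\<mu> \<noteq> 0\<close> by (simp add: r_def pderiv_smult \<mu>_def)
  ultimately have "poly (pderiv r') 1 \<notin> \<M>"
    by (intro one_unit_notin_ideal) (simp add: pderiv_diff)
  then obtain s where "poly r' s = 0" "s - 1 \<in> \<M>"
    using henselian r'_int r'1 unfolding henselian_def by (metis one_in_integers)
  then show ?thesis
    using \<open>\<mu> \<noteq> 0\<close> by (intro that[of s]) (auto simp: r'_def)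
qed

end

section \<open>Residue fields and the order\<close>

context valued_field
begin

lemma cring_val_ring: "cring (val_ring v)"
proof (intro cringI abelian_groupI comm_monoidI)
  fix x assume "x \<in> carrier (val_ring v)"
  then show "\<exists>y\<in>carrier (val_ring v). y \<oplus>\<^bsub>val_ring v\<^esub> x = \<zero>\<^bsub>val_ring v\<^esub>"
    by (intro bexI[of _ "- x"]) (auto simp: val_ring_def)
qed (auto simp: val_ring_def integers_add integers_mult algebra_simps)

lemma ideal_val_ideal: "ideal \<M> (val_ring v)"
proof (rule idealI)
  show "ring (val_ring v)"
    using cring_val_ring by (rule cring.axioms)
  then interpret ring "val_ring v" .
  show "subgroup \<M> (add_monoid (val_ring v))"
  proof (rule group.subgroupI)
    show "Group.group (add_monoid (val_ring v))"
      by (rule a_group)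
    show "\<M> \<noteq> {}"
      using zero_in_ideal by blast
    fix x assume x: "x \<in> \<M>"
    have "inv\<^bsub>add_monoid (val_ring v)\<^esub> x = - x"
      using x ideal_subset_integers[of x] minus_equality[of "- x" x]
      by (simp add: val_ring_def a_inv_def)
    then show "inv\<^bsub>add_monoid (val_ring v)\<^esub> x \<in> \<M>"
      using x by simp
  qed (auto simp: val_ring_def ideal_subset_integers ideal_add)
qed (auto simp: val_ring_def ideal_mult ideal_mult')

text \<open>The residue map, with values in the quotient of the valuation ring.\<close>

definition res :: "'a \<Rightarrow> 'a set" where
  "res x = \<M> +>\<^bsub>val_ring v\<^esub> x"

lemma res_ring_hom: "ring_hom_ring (val_ring v) (residue_field v) res"
  using ideal.rcos_ring_hom_ring[OF ideal_val_ideal] unfolding residue_field_def res_def .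

lemma res_eq_zero_iff: "x \<in> \<O> \<Longrightarrow> res x = \<zero>\<^bsub>residue_field v\<^esub> \<longleftrightarrow> x \<in> \<M>"
proof -
  assume x: "x \<in> \<O>"
  interpret ideal \<M> "val_ring v"
    by (rule ideal_val_ideal)
  have "x \<in> carrier (val_ring v)"
    using x by (simp add: val_ring_def)
  then show ?thesis
    using a_rcos_const a_rcos_self by (auto simp: residue_field_def FactRing_def res_def)
qed

lemma carrier_residue_field: "carrier (residue_field v) = res ` \<O>"
  by (auto simp: residue_field_def FactRing_def A_RCOSETS_def' val_ring_def res_def)

text \<open>If \<open>m + 1\<close> vanished in the residue field, then \<open>- 1\<close> would be the sum of \<open>m\<close> squares of \<open>1\<close>.\<close>

lemma real_closed_imp_residue_char_0:
  assumes rc: "real_closed_field (residue_field v)" and n: "n > 0"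
  shows "of_nat n \<notin> \<M>"
proof
  assume "of_nat n \<in> \<M>"
  interpret h: ring_hom_ring "val_ring v" "residue_field v" res
    by (rule res_ring_hom)
  let ?Q = "residue_field v"
  obtain m where m: "n = Suc m"
    using n gr0_implies_Suc by blast
  have one: "res 1 = \<one>\<^bsub>?Q\<^esub>"
    using h.hom_one by (simp add: val_ring_def)
  have sum: "(\<Oplus>\<^bsub>?Q\<^esub>i\<in>{..<k}. \<one>\<^bsub>?Q\<^esub> \<otimes>\<^bsub>?Q\<^esub> \<one>\<^bsub>?Q\<^esub>) = res (of_nat k)" for k :: nat
  proof (induction k)
    case 0
    then show ?case
      using h.hom_zero by (simp add: val_ring_def)
  next
    case (Suc k)
    have "(\<Oplus>\<^bsub>?Q\<^esub>i\<in>{..<Suc k}. \<one>\<^bsub>?Q\<^esub> \<otimes>\<^bsub>?Q\<^esub> \<one>\<^bsub>?Q\<^esub>) = \<one>\<^bsub>?Q\<^esub> \<oplus>\<^bsub>?Q\<^esub> res (of_nat k)"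
      by (simp add: lessThan_Suc Suc.IH[symmetric])
    also have "\<dots> = res (1 + of_nat k)"
      using h.hom_add[of 1 "of_nat k"] by (simp add: val_ring_def one)
    finally show ?case
      by simp
  qed
  have "res (of_nat m) \<oplus>\<^bsub>?Q\<^esub> \<one>\<^bsub>?Q\<^esub> = res (of_nat n)"
    using h.hom_add[of "of_nat m" 1] by (simp add: val_ring_def one m add.commute)
  also have "\<dots> = \<zero>\<^bsub>?Q\<^esub>"
    using \<open>of_nat n \<in> \<M>\<close> by (simp add: res_eq_zero_iff)
  finally have "res (of_nat m) = \<ominus>\<^bsub>?Q\<^esub> \<one>\<^bsub>?Q\<^esub>"
    using h.hom_closed[of "of_nat m"] by (intro h.S.minus_equality[symmetric]) (auto simp: val_ring_def)
  moreover have "(\<Oplus>\<^bsub>?Q\<^esub>i\<in>{..<m}. \<one>\<^bsub>?Q\<^esub> \<otimes>\<^bsub>?Q\<^esub> \<one>\<^bsub>?Q\<^esub>) \<noteq> \<ominus>\<^bsub>?Q\<^esub> \<one>\<^bsub>?Q\<^esub>"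
    using rc unfolding real_closed_field_def by (auto elim!: allE[of _ m] allE[of _ "\<lambda>_. \<one>\<^bsub>?Q\<^esub>"])
  ultimately show False
    using sum[of m] by simp
qed

context
  assumes trivial: "\<M> = {0}" and rc: "real_closed_field (residue_field v)"
begin

lemma trivial_integers: "\<O> = UNIV"
proof -
  have "x \<in> \<O>" for x
  proof (rule ccontr)
    assume "x \<notin> \<O>"
    then have "inverse x \<in> {0}"
      using notin_integers_inverse[of x] unfolding trivial by blast
    with \<open>x \<notin> \<O>\<close> show False
      by simp
  qed
  then show ?thesis
    by blast
qed

lemma res_eq_iff: "res x = res y \<longleftrightarrow> x = y"
proof -
  interpret ideal \<M> "val_ring v"
    by (rule ideal_val_ideal)
  have "res z = {z}" for z
    using trivial by (auto simp: res_def a_r_coset_def r_coset_def val_ring_def)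
  then show ?thesis
    by auto
qed

text \<open>For the trivial valuation the residue map is an isomorphism, so both Artin--Schreier axioms pass from
  the residue field to the field itself.\<close>

lemma trivial_square: "\<exists>y::'a. x = y * y \<or> x = - (y * y)"
proof -
  interpret h: ring_hom_ring "val_ring v" "residue_field v" res
    by (rule res_ring_hom)
  let ?Q = "residue_field v"
  have mult: "res y \<otimes>\<^bsub>?Q\<^esub> res z = res (y * z)" for y z
    using h.hom_mult[of y z] by (simp add: val_ring_def trivial_integers)
  have neg: "\<ominus>\<^bsub>?Q\<^esub> res y = res (- y)" for y
  proof -
    have "res (- y) \<oplus>\<^bsub>?Q\<^esub> res y = res (- y + y)"
      using h.hom_add[of "- y" y] by (simp add: val_ring_def trivial_integers)
    then have "res (- y) \<oplus>\<^bsub>?Q\<^esub> res y = \<zero>\<^bsub>?Q\<^esub>"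
      by (simp add: res_eq_zero_iff)
    then show ?thesis
      using h.hom_closed[of y] h.hom_closed[of "- y"]
      by (intro h.S.minus_equality) (auto simp: val_ring_def trivial_integers)
  qed
  have "res x \<in> carrier ?Q"
    by (simp add: carrier_residue_field trivial_integers)
  with rc[unfolded real_closed_field_def, THEN conjunct2, THEN conjunct2, THEN conjunct1]
  obtain Y where "Y \<in> carrier ?Q" "res x = Y \<otimes>\<^bsub>?Q\<^esub> Y \<or> res x = \<ominus>\<^bsub>?Q\<^esub> (Y \<otimes>\<^bsub>?Q\<^esub> Y)"
    by (elim ballE bexE) auto
  then obtain y where "res x = res y \<otimes>\<^bsub>?Q\<^esub> res y \<or> res x = \<ominus>\<^bsub>?Q\<^esub> (res y \<otimes>\<^bsub>?Q\<^esub> res y)"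
    by (auto simp: carrier_residue_field)
  then show ?thesis
    by (auto simp: mult neg res_eq_iff)
qed

lemma trivial_odd_root:
  fixes p :: "'a poly"
  assumes odd: "odd (Polynomial.degree p)"
  shows "\<exists>x. poly p x = 0"
proof -
  interpret h: ring_hom_ring "val_ring v" "residue_field v" res
    by (rule res_ring_hom)
  let ?Q = "residue_field v"
  have mem: "x \<in> carrier (val_ring v)" for x
    by (simp add: val_ring_def trivial_integers)
  have mult: "res y \<otimes>\<^bsub>?Q\<^esub> res z = res (y * z)" for y z
    using h.hom_mult[OF mem mem] by (simp add: val_ring_def)
  have add: "res y \<oplus>\<^bsub>?Q\<^esub> res z = res (y + z)" for y z
    using h.hom_add[OF mem mem] by (simp add: val_ring_def)
  have one: "res 1 = \<one>\<^bsub>?Q\<^esub>"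
    using h.hom_one by (simp add: val_ring_def)
  have power: "res y [^]\<^bsub>?Q\<^esub> (k::nat) = res (y ^ k)" for y k
    by (induction k) (simp_all add: one mult mult.commute)
  have eval: "h.S.eval (map res cs) (res x) = res (poly (Poly (rev cs)) x)" for cs x
  proof (induction cs)
    case Nil
    then show ?case
      using h.hom_zero by (simp add: val_ring_def)
  next
    case (Cons c cs)
    have "h.S.eval (map res (c # cs)) (res x) =
        res c \<otimes>\<^bsub>?Q\<^esub> res x [^]\<^bsub>?Q\<^esub> length cs \<oplus>\<^bsub>?Q\<^esub> h.S.eval (map res cs) (res x)"
      by simp
    also have "\<dots> = res (c * x ^ length cs + poly (Poly (rev cs)) x)"
      by (simp only: Cons.IH power mult add)
    finally show ?case
      by (simp add: Poly_append poly_monom mult.commute add.commute)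
  qed
  define P where "P = map res (rev (coeffs p))"
  have "p \<noteq> 0"
    using odd by auto
  then have "coeffs p \<noteq> []" "last (coeffs p) \<noteq> 0"
    by (simp_all add: last_coeffs_eq_coeff_degree)
  then have "polynomial\<^bsub>?Q\<^esub> (carrier ?Q) P"
    by (auto simp: polynomial_def P_def hd_map hd_rev res_eq_zero_iff trivial trivial_integers
        carrier_residue_field)
  moreover have "Polynomials.degree P = Polynomial.degree p"
    by (simp add: P_def length_coeffs_degree \<open>p \<noteq> 0\<close>)
  ultimately have "\<exists>Y\<in>carrier ?Q. h.S.eval P Y = \<zero>\<^bsub>?Q\<^esub>"
    using odd rc[unfolded real_closed_field_def, THEN conjunct2, THEN conjunct2, THEN conjunct2,
        THEN spec, of P] by simp
  then obtain Y where Y: "Y \<in> carrier ?Q" "h.S.eval P Y = \<zero>\<^bsub>?Q\<^esub>" ..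
  then obtain x where "Y = res x"
    by (auto simp: carrier_residue_field)
  then have "poly p x \<in> \<M>"
    using Y(2) eval[of "rev (coeffs p)" x] by (simp add: P_def res_eq_zero_iff trivial_integers)
  then show ?thesis
    using trivial by auto
qed

end

end

context henselian_residue_char_0
begin

text \<open>Hensel's lemma for \<open>Y\<^sup>2 - u\<close> at \<open>1\<close>: the derivative \<open>2\<close> is a unit in residue characteristic \<open>0\<close>.\<close>

lemma one_unit_is_square:
  assumes "u - 1 \<in> \<M>"
  shows "\<exists>b. u = b * b"
proof -
  let ?f = "[:- u, 0, 1:]"
  have u: "u \<in> \<O>"
    using integers_add[OF ideal_subset_integers[OF assms] one_in_integers] by simp
  have "Polynomial.coeff ?f i \<in> \<O>" for i
    using u by (auto simp: coeff_pCons split: nat.split)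
  moreover have "poly ?f 1 \<in> \<M>"
    using assms ideal_diff_commute[of u 1] by simp
  moreover have "poly (pderiv ?f) 1 \<notin> \<M>"
    using residue_char_0[of 2] by (simp add: pderiv_pCons)
  ultimately obtain b where "poly ?f b = 0"
    using henselian unfolding henselian_def by (metis one_in_integers)
  then show ?thesis
    by (intro exI[of _ b]) simp
qed

end

locale henselian_ordered_field = henselian_residue_char_0 v
  for v :: "'a::{linordered_field, linorder_topology} \<Rightarrow> 'g::linordered_ab_group_add"
begin

lemma one_unit_pos:
  assumes "u - 1 \<in> \<M>"
  shows "u > 0"
  using one_unit_is_square[OF assms] one_unit_nonzero[OF assms]
  by (auto simp: zero_less_mult_iff linorder_neq_iff)

lemma same_leading_term_sgn: "same_leading_term x y \<Longrightarrow> sgn x = sgn y"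
  using one_unit_pos by (auto simp: same_leading_term_iff sgn_mult)

text \<open>Otherwise \<open>c / x\<close> would lie in \<open>\<M>\<close>, and then \<open>1 + c / x\<close> and \<open>1 - c / x\<close> would both be positive,
  that is, \<open>c\<close> would have smaller absolute value than \<open>x\<close>.\<close>

lemma ideal_convex:
  assumes c: "c \<in> \<M>" and x: "\<bar>x\<bar> < \<bar>c\<bar>"
  shows "x \<in> \<M>"
proof (rule ccontr)
  assume "x \<notin> \<M>"
  then have w: "c * inverse x \<in> \<M>"
    using c notin_ideal_inverse by (simp add: ideal_mult')
  have "x \<noteq> 0"
    using \<open>x \<notin> \<M>\<close> by auto
  have "1 + c * inverse x > 0" "1 - c * inverse x > 0"
    using one_unit_pos[of "1 + c * inverse x"] one_unit_pos[of "1 - c * inverse x"] w by simp_all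
  then have "\<bar>c * inverse x\<bar> < 1"
    by (simp add: abs_less_iff)
  then have "\<bar>c\<bar> < \<bar>x\<bar>"
    using \<open>x \<noteq> 0\<close> by (simp add: abs_mult field_simps)
  then show False
    using x by simp
qed

text \<open>The class of \<open>x\<close> is \<open>x (1 + \<M>)\<close>, and by convexity \<open>\<M>\<close> contains the interval between \<open>- c\<close> and
  \<open>c\<close>. This is where the valuation has to be nontrivial.\<close>

lemma open_same_leading_term:
  assumes c: "c \<in> \<M>" "c \<noteq> 0" and x: "x \<noteq> 0"
  shows "open {y. same_leading_term x y}"
proof (subst open_subopen, intro ballI)
  fix y assume "y \<in> {y. same_leading_term x y}"
  then obtain u where u: "u - 1 \<in> \<M>" "y = u * x"
    by (auto simp: same_leading_term_iff)
  let ?d = "\<bar>c * x\<bar>"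
  have "same_leading_term x z" if "z \<in> {y - ?d<..<y + ?d}" for z
  proof -
    have "\<bar>z - y\<bar> < \<bar>c * x\<bar>"
      using that by (auto simp: abs_less_iff)
    then have "\<bar>(z - y) / x\<bar> < \<bar>c\<bar>"
      using x by (simp add: abs_mult divide_simps)
    then have "(z - y) / x \<in> \<M>"
      using ideal_convex c by blast
    then have "(z - y) / x + (u - 1) \<in> \<M>"
      using u(1) by (rule ideal_add)
    then have "z / x - 1 \<in> \<M>"
      using x u(2) by (simp add: diff_divide_distrib)
    then show ?thesis
      unfolding same_leading_term_iff using x by (intro exI[of _ "z / x"]) simp
  qed
  then show "\<exists>T. open T \<and> y \<in> T \<and> T \<subseteq> {y. same_leading_term x y}"
    using c x by (intro exI[of _ "{y - ?d<..<y + ?d}"]) auto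
qed

end

section \<open>Leading terms of polynomials over a henselian field\<close>

lemma higher_pderiv_pcompose_linear:
  fixes p :: "'a::field_char_0 poly"
  shows "(pderiv ^^ k) (pcompose p [:b, t:]) = Polynomial.smult (t ^ k) (pcompose ((pderiv ^^ k) p) [:b, t:])"
proof (induction k)
  case (Suc k)
  have "(pderiv ^^ Suc k) (pcompose p [:b, t:]) =
      Polynomial.smult (t ^ k) (pderiv (pcompose ((pderiv ^^ k) p) [:b, t:]))"
    by (simp add: Suc pderiv_smult)
  also have "pderiv (pcompose ((pderiv ^^ k) p) [:b, t:]) =
      Polynomial.smult t (pcompose ((pderiv ^^ Suc k) p) [:b, t:])"
    by (simp add: pderiv_pcompose pderiv_pCons)
  finally show ?case
    by (simp add: mult.commute)
qed simp

text \<open>Taylor's formula.\<close>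

lemma coeff_pcompose_shift:
  fixes p :: "'a::field_char_0 poly"
  shows "Polynomial.coeff (pcompose p [:b, t:]) k = t ^ k * poly ((pderiv ^^ k) p) b / fact k"
proof -
  have "fact k * Polynomial.coeff (pcompose p [:b, t:]) k =
      Polynomial.coeff ((pderiv ^^ k) (pcompose p [:b, t:])) 0"
    using pochhammer_fact[of k, where ?'a = 'a] by (simp add: coeff_higher_pderiv)
  also have "\<dots> = t ^ k * poly ((pderiv ^^ k) p) b"
    by (simp add: higher_pderiv_pcompose_linear poly_0_coeff_0[symmetric] poly_pcompose)
  finally show ?thesis
    by (simp add: field_simps)
qed

context henselian_residue_char_0
begin

lemma shifted_coeffs_same_leading_term:
  assumes "\<And>k. same_leading_term (poly ((pderiv ^^ k) p) b) (poly ((pderiv ^^ k) p') b')"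
  shows "same_leading_term (Polynomial.coeff (pcompose p [:b, t:]) k)
     (Polynomial.coeff (pcompose p' [:b', t:]) k)"
  using same_leading_term_mult[OF same_leading_term_refl[of "t ^ k / fact k"] assms[of k]]
  by (simp add: coeff_pcompose_shift)

definition nearest :: "'a \<Rightarrow> 'a set \<Rightarrow> 'a \<Rightarrow> bool" where
  "nearest y Z b \<longleftrightarrow> b \<in> Z \<and> (\<forall>c\<in>Z. dominated (y - b) (y - c))"

lemma nearest_exists:
  assumes "finite Z" "Z \<noteq> {}"
  obtains b where "nearest y Z b"
proof -
  have "\<exists>b\<in>Z. \<forall>c\<in>Z. dominated (y - b) (y - c)"
    using assms by (rule finite_total_preorder_greatest) (use dominated_total dominated_trans in blast)+
  then show ?thesis
    using that by (auto simp: nearest_def)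
qed

text \<open>A cancellation would give a root \<open>b + (y - b) s\<close> of a derivative of \<open>p\<close> with \<open>s - 1\<close> in \<open>\<M>\<close>, and this
  root is nearer to \<open>y\<close> than \<open>b\<close>.\<close>

lemma no_cancellation_at_nearest:
  assumes b: "nearest y Z b" "y \<noteq> b"
    and Z: "\<And>k c. (pderiv ^^ k) p \<noteq> 0 \<Longrightarrow> poly ((pderiv ^^ k) p) c = 0 \<Longrightarrow> c \<in> Z"
  shows "no_cancellation (pcompose p [:b, y - b:])"
proof (rule ccontr)
  define t where "t = y - b"
  assume "\<not> ?thesis"
  then obtain k s where s: "s - 1 \<in> \<M>" "(pderiv ^^ k) (pcompose p [:b, t:]) \<noteq> 0"
    "poly ((pderiv ^^ k) (pcompose p [:b, t:])) s = 0"
    unfolding t_def by (rule cancellation_imp_root_of_derivative)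
  have "t \<noteq> 0"
    using b by (simp add: t_def)
  then have "b + s * t \<in> Z"
    using s by (intro Z[of k]) (auto simp: higher_pderiv_pcompose_linear poly_pcompose)
  then have "dominated t (y - (b + s * t))"
    using b by (simp add: nearest_def t_def)
  moreover have "y - (b + s * t) = (1 - s) * t"
    by (simp add: t_def algebra_simps)
  then have "negligible (y - (b + s * t)) t"
    using s(1) ideal_diff_commute unfolding negligible_def by metis
  ultimately show False
    using negligible_dominated_eq_0 \<open>t \<noteq> 0\<close> by blast
qed

end

locale leading_term_elimination = henselian_residue_char_0 v + coefficient_ring R
  for v :: "'a::field_char_0 \<Rightarrow> 'g::linordered_ab_group_add" and R :: "('e \<Rightarrow> 'a) set"
begin

abbreviation agree :: "('e \<Rightarrow> 'a) set \<Rightarrow> 'e \<Rightarrow> 'e \<Rightarrow> bool" where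
  "agree G e e' \<equiv> \<forall>g\<in>G. same_leading_term (g e) (g e')"

text \<open>Matching restricted to roots of polynomials of degree less than \<open>d\<close>. The point \<open>0\<close> is always included, so that there
  is a nearest center even when no polynomial has a root.\<close>

definition roots_matched :: "nat \<Rightarrow> ('e \<Rightarrow> 'a poly) set \<Rightarrow> bool" where
  "roots_matched d F \<longleftrightarrow> (\<exists>G\<subseteq>R. finite G \<and> (\<forall>e e'. agree G e e' \<longrightarrow>
     (\<forall>c. c = 0 \<or> (\<exists>p\<in>F. p e \<noteq> 0 \<and> Polynomial.degree (p e) < d \<and> poly (p e) c = 0) \<longrightarrow>
       (\<exists>c'. \<forall>p\<in>F. same_leading_term (poly (p e) c) (poly (p e') c')))))"

lemma roots_matchedE:
  assumes "roots_matched d F"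
  obtains G where "G \<subseteq> R" "finite G" "\<And>e e' c. agree G e e' \<Longrightarrow>
      c = 0 \<or> (\<exists>p\<in>F. p e \<noteq> 0 \<and> Polynomial.degree (p e) < d \<and> poly (p e) c = 0) \<Longrightarrow>
      \<exists>c'. \<forall>p\<in>F. same_leading_term (poly (p e) c) (poly (p e') c')"
proof -
  from assms obtain G where "G \<subseteq> R \<and> finite G \<and> (\<forall>e e'. agree G e e' \<longrightarrow>
     (\<forall>c. c = 0 \<or> (\<exists>p\<in>F. p e \<noteq> 0 \<and> Polynomial.degree (p e) < d \<and> poly (p e) c = 0) \<longrightarrow>
       (\<exists>c'. \<forall>p\<in>F. same_leading_term (poly (p e) c) (poly (p e') c'))))"
    unfolding roots_matched_def ..
  note G = conjunct1[OF this] conjunct1[OF conjunct2[OF this]] conjunct2[OF conjunct2[OF this]]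
  show thesis
    by (rule that[OF G(1,2) G(3)[THEN spec, THEN spec, THEN mp, THEN spec, THEN mp]])
qed

definition derivatives :: "nat \<Rightarrow> ('e \<Rightarrow> 'a poly) set \<Rightarrow> ('e \<Rightarrow> 'a poly) set" where
  "derivatives m S = (\<lambda>(r, k) e. (pderiv ^^ k) (r e)) ` (S \<times> {..<m})"

text \<open>The derivatives of every order are taken; those of order at least the bound of a family vanish, so
  the set is finite.\<close>

definition centers :: "('e \<Rightarrow> 'a poly) set \<Rightarrow> 'e \<Rightarrow> 'a set" where
  "centers S e = insert 0 {c. \<exists>r\<in>S. \<exists>k. (pderiv ^^ k) (r e) \<noteq> 0 \<and> poly ((pderiv ^^ k) (r e)) c = 0}"

lemma finite_derivatives: "finite S \<Longrightarrow> finite (derivatives m S)"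
  by (simp add: derivatives_def)

lemma family_derivatives: "\<forall>r\<in>S. family m r \<Longrightarrow> p \<in> derivatives n S \<Longrightarrow> family m p"
  by (auto simp: derivatives_def intro: family_higher_pderiv)

lemma in_derivatives: "r \<in> S \<Longrightarrow> k < m \<Longrightarrow> (\<lambda>e. (pderiv ^^ k) (r e)) \<in> derivatives m S"
  by (force simp: derivatives_def)

lemma centers_cases:
  assumes "c \<in> centers S e" "\<forall>r\<in>S. family m r"
  shows "c = 0 \<or> (\<exists>p\<in>derivatives m S. p e \<noteq> 0 \<and> Polynomial.degree (p e) < m \<and> poly (p e) c = 0)"
proof (cases "c = 0")
  case False
  then obtain r k where r: "r \<in> S" "(pderiv ^^ k) (r e) \<noteq> 0" "poly ((pderiv ^^ k) (r e)) c = 0"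
    using assms(1) by (auto simp: centers_def)
  define p where "p = (\<lambda>e. (pderiv ^^ k) (r e))"
  have "family m r"
    using assms(2) r(1) by blast
  then have "p \<in> derivatives m S" "family m p"
    using r family_higher_pderiv_nonzero[of m r k e] unfolding p_def
    by (auto intro: in_derivatives family_higher_pderiv)
  moreover have "p e \<noteq> 0" "poly (p e) c = 0"
    using r by (simp_all add: p_def)
  ultimately show ?thesis
    using family_degree[of m p e] by blast
qed simp

lemma finite_centers:
  assumes "finite S" "\<forall>r\<in>S. family m r"
  shows "finite (centers S e)"
proof -
  have "centers S e \<subseteq> insert 0 (\<Union>p\<in>{p\<in>derivatives m S. p e \<noteq> 0}. {c. poly (p e) c = 0})"
    using centers_cases[OF _ assms(2)] by auto
  then show ?thesis
    by (rule finite_subset) (auto simp: finite_derivatives assms poly_roots_finite)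
qed

lemma derivatives_matched:
  assumes "\<forall>p\<in>derivatives m S. same_leading_term (poly (p e) b) (poly (p e') b')"
    and "r \<in> S" "family m r"
  shows "same_leading_term (poly ((pderiv ^^ k) (r e)) b) (poly ((pderiv ^^ k) (r e')) b')"
proof (cases "k < m")
  case True
  then show ?thesis
    using bspec[OF assms(1) in_derivatives[OF assms(2) True]] by simp
next
  case False
  then have "(pderiv ^^ k) (r e) = 0" for e
    using family_higher_pderiv_nonzero[OF assms(3), of k e] by blast
  then show ?thesis
    by simp
qed

text \<open>The leading term of \<open>r\<close> at \<open>y\<close> is determined by the difference of \<open>y\<close> to its nearest center \<open>b\<close> and by
  the leading terms of the derivatives at \<open>b\<close>. Moving the same difference to a partner \<open>b'\<close> of \<open>b\<close>
  therefore gives a partner of \<open>y\<close>; the factor \<open>s\<close> leaves room for adjusting it to a root.\<close>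

lemma values_matched_near_center:
  assumes "\<forall>p\<in>derivatives m S. same_leading_term (poly (p e) b) (poly (p e') b')"
    and r: "r \<in> S" "family m r"
    and b: "nearest y (centers S e) b" "y \<noteq> b" and s: "s - 1 \<in> \<M>"
  shows "same_leading_term (poly (r e) y) (poly (r e') (b' + (y - b) * s))"
proof -
  have "no_cancellation (pcompose (r e) [:b, y - b:])"
    using b r by (intro no_cancellation_at_nearest[where Z = "centers S e"]) (auto simp: centers_def)
  then have "same_leading_term (poly (pcompose (r e) [:b, y - b:]) 1)
      (poly (pcompose (r e') [:b', y - b:]) s)"
    using s by (intro poly_same_leading_term shifted_coeffs_same_leading_term
        derivatives_matched[OF assms(1) r])
  then show ?thesis
    by (simp add: poly_pcompose mult.commute)
qed

text \<open>Let \<open>c\<close> be a root of \<open>p0\<close>, of degree exactly \<open>d\<close>. Modulo \<open>p0\<close> every polynomial of \<open>F\<close> has a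
  remainder of degree less than \<open>d\<close>; let \<open>S\<close> consist of the remainders and the derivative of \<open>p0\<close>.
  A center \<open>b\<close> of \<open>S\<close> nearest to \<open>c\<close> has a partner \<open>b'\<close> by induction. If \<open>c\<close> differs from \<open>b\<close>, then
  the derivative of \<open>p0\<close> has no cancellation there, so \<open>lift_root\<close> gives a root \<open>c'\<close> near \<open>b'\<close>, and
  the remainders have the same leading terms at \<open>c\<close> and \<open>c'\<close>.\<close>

lemma roots_matched_step:
  assumes IH: "\<And>F. finite F \<Longrightarrow> \<forall>p\<in>F. \<exists>m. family m p \<Longrightarrow> roots_matched d F"
    and F: "finite F" "\<forall>p\<in>F. \<exists>m. family m p" and p0: "p0 \<in> F"
  shows "\<exists>G\<subseteq>R. finite G \<and> (\<forall>e e'. agree G e e' \<longrightarrow>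
     (\<forall>c. p0 e \<noteq> 0 \<and> Polynomial.degree (p0 e) = d \<and> poly (p0 e) c = 0 \<longrightarrow>
       (\<exists>c'. \<forall>p\<in>F. same_leading_term (poly (p e) c) (poly (p e') c'))))"
proof -
  define P where "P = (\<lambda>e. poly_cutoff (Suc d) (p0 e))"
  define l where "l = (\<lambda>e. Polynomial.coeff (P e) d)"
  obtain m where "family m p0"
    using F(2) p0 by blast
  then have P: "family (Suc d) P"
    unfolding P_def by (rule family_cutoff)
  then have l: "l \<in> R"
    unfolding l_def by (rule family_coeff)
  have "\<forall>p\<in>F. \<exists>r. family d r \<and>
      (\<exists>N. \<forall>e c. poly (P e) c = 0 \<longrightarrow> l e ^ N * poly (p e) c = poly (r e) c)"
  proof
    fix p assume "p \<in> F"
    then obtain m where "family m p"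
      using F(2) by blast
    then show "\<exists>r. family d r \<and>
      (\<exists>N. \<forall>e c. poly (P e) c = 0 \<longrightarrow> l e ^ N * poly (p e) c = poly (r e) c)"
      using reduction_at_roots[OF _ P] unfolding l_def by blast
  qed
  from bchoice[OF this] obtain r where r: "\<forall>p\<in>F. family d (r p) \<and>
      (\<exists>N. \<forall>e c. poly (P e) c = 0 \<longrightarrow> l e ^ N * poly (p e) c = poly (r p e) c)" ..
  define S where "S = insert (\<lambda>e. pderiv (P e)) (r ` F)"
  have S: "finite S" "\<forall>p\<in>S. family d p"
    using F(1) r family_pderiv[OF P] by (auto simp: S_def)
  define T where "T = derivatives d S \<union> derivatives (Suc d) {P} \<union> F"
  have "roots_matched d T"
  proof (rule IH)
    show "finite T"
      using F(1) S(1) by (simp add: T_def finite_derivatives)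
    show "\<forall>p\<in>T. \<exists>m. family m p"
    proof
      fix p assume "p \<in> T"
      then consider "p \<in> derivatives d S" | "p \<in> derivatives (Suc d) {P}" | "p \<in> F"
        by (auto simp: T_def)
      then show "\<exists>m. family m p"
      proof cases
        case 1
        then have "family d p"
          by (rule family_derivatives[OF S(2)])
        then show ?thesis ..
      next
        case 2
        then have "family (Suc d) p"
          using P by (intro family_derivatives) auto
        then show ?thesis ..
      qed (use F(2) in simp)
    qed
  qed
  then obtain G where G: "G \<subseteq> R" "finite G" and match: "\<And>e e' c. agree G e e' \<Longrightarrow>
      c = 0 \<or> (\<exists>p\<in>T. p e \<noteq> 0 \<and> Polynomial.degree (p e) < d \<and> poly (p e) c = 0) \<Longrightarrow>
      \<exists>c'. \<forall>p\<in>T. same_leading_term (poly (p e) c) (poly (p e') c')"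
    by (rule roots_matchedE) (rule that)
  have "\<exists>c'. \<forall>p\<in>F. same_leading_term (poly (p e) c) (poly (p e') c')"
    if agree: "agree (insert l G) e e'"
      and c: "p0 e \<noteq> 0" "Polynomial.degree (p0 e) = d" "poly (p0 e) c = 0" for e e' c
  proof -
    have Pe: "P e = p0 e"
      using c(2) by (auto simp: P_def poly_eq_iff coeff_poly_cutoff coeff_eq_0)
    have l_nonzero: "l e \<noteq> 0"
      using c(1,2) by (auto simp: l_def Pe)
    have l_sim: "same_leading_term (l e) (l e')"
      using agree by simp
    have center: "\<exists>b'. \<forall>p\<in>T. same_leading_term (poly (p e) b) (poly (p e') b')"
      if "b \<in> centers S e" for b
    proof (rule match)
      show "b = 0 \<or> (\<exists>p\<in>T. p e \<noteq> 0 \<and> Polynomial.degree (p e) < d \<and> poly (p e) b = 0)"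
        using centers_cases[OF that S(2)] by (auto simp: T_def)
    qed (use agree in simp)
    obtain b where b: "nearest c (centers S e) b"
      using nearest_exists[OF finite_centers[OF S, of e]] by (auto simp: centers_def)
    then have "b \<in> centers S e"
      by (simp add: nearest_def)
    from center[OF this] obtain b'
      where b': "\<forall>p\<in>T. same_leading_term (poly (p e) b) (poly (p e') b')" ..
    show ?thesis
    proof (cases "c = b")
      case True
      then show ?thesis
        using b' by (auto simp: T_def)
    next
      case False
      define t where "t = c - b"
      have "t \<noteq> 0"
        using False by (simp add: t_def)
      let ?q = "pcompose (P e) [:b, t:]" and ?q' = "pcompose (P e') [:b', t:]"
      have pderiv_q: "pderiv ?q = Polynomial.smult t (pcompose (pderiv (P e)) [:b, t:])"
        using higher_pderiv_pcompose_linear[of 1 "P e" b t] by simp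
      have "no_cancellation (pcompose (pderiv (P e)) [:b, t:])"
        unfolding t_def using b False
        by (intro no_cancellation_at_nearest[where Z = "centers S e"]) (auto simp: centers_def S_def)
      then have nc: "no_cancellation (pderiv ?q)"
        unfolding pderiv_q by (auto simp: no_cancellation_def dominated_def)
      have "Polynomial.degree (P e) \<noteq> 0"
      proof
        assume "Polynomial.degree (P e) = 0"
        then obtain a where "P e = [:a:]"
          by (rule degree_eq_zeroE)
        with c(1,3) show False
          by (simp add: Pe)
      qed
      then have "pderiv ?q \<noteq> 0"
        unfolding pderiv_q using \<open>t \<noteq> 0\<close> by (auto simp: pderiv_eq_0_iff pcompose_eq_0_iff)
      moreover have "same_leading_term (Polynomial.coeff ?q i) (Polynomial.coeff ?q' i)" for i
        using b' P by (intro shifted_coeffs_same_leading_term derivatives_matched[of "Suc d" "{P}"])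
          (auto simp: T_def)
      moreover have "poly ?q 1 = 0"
        using c by (simp add: poly_pcompose t_def Pe)
      ultimately obtain s where s: "s - 1 \<in> \<M>" "poly ?q' s = 0"
        using nc lift_root by blast
      define c' where "c' = b' + t * s"
      have root': "poly (P e') c' = 0"
        using s(2) by (simp add: poly_pcompose c'_def mult.commute)
      have "same_leading_term (poly (p e) c) (poly (p e') c')" if "p \<in> F" for p
      proof -
        obtain N where N: "\<And>e c. poly (P e) c = 0 \<Longrightarrow> l e ^ N * poly (p e) c = poly (r p e) c"
          using bspec[OF r \<open>p \<in> F\<close>] by blast
        have "same_leading_term (poly (r p e) c) (poly (r p e') c')"
          unfolding c'_def t_def using b False s(1) b' S(2) that
          by (intro values_matched_near_center[of d S]) (auto simp: T_def S_def)
        then have "same_leading_term (l e ^ N * poly (p e) c) (l e' ^ N * poly (p e') c')"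
          using N[of e c] N[OF root'] c(3) by (simp add: Pe)
        then show ?thesis
          using same_leading_term_mult_cancel[OF same_leading_term_power[OF l_sim]] l_nonzero
          by simp
      qed
      then show ?thesis
        by blast
    qed
  qed
  then show ?thesis
    using G l by (intro exI[of _ "insert l G"]) auto
qed

lemma roots_matched: "finite F \<Longrightarrow> \<forall>p\<in>F. \<exists>m. family m p \<Longrightarrow> roots_matched d F"
proof (induction d arbitrary: F)
  case 0
  have "(\<lambda>e. poly (p e) 0) \<in> R" if "p \<in> F" for p
    using that 0(2) by (auto simp: poly_0_coeff_0 intro: family_coeff)
  then show ?case
    unfolding roots_matched_def using 0(1)
    by (intro exI[of _ "(\<lambda>p e. poly (p e) 0) ` F"]) auto
next
  case (Suc d)
  obtain G0 where G0: "G0 \<subseteq> R" "finite G0" and match0: "\<And>e e' c. agree G0 e e' \<Longrightarrow>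
      c = 0 \<or> (\<exists>p\<in>F. p e \<noteq> 0 \<and> Polynomial.degree (p e) < d \<and> poly (p e) c = 0) \<Longrightarrow>
      \<exists>c'. \<forall>p\<in>F. same_leading_term (poly (p e) c) (poly (p e') c')"
    by (rule roots_matchedE[OF Suc.IH[OF Suc.prems]]) (rule that)
  have "\<forall>p0\<in>F. \<exists>G. G \<subseteq> R \<and> finite G \<and> (\<forall>e e'. agree G e e' \<longrightarrow>
     (\<forall>c. p0 e \<noteq> 0 \<and> Polynomial.degree (p0 e) = d \<and> poly (p0 e) c = 0 \<longrightarrow>
       (\<exists>c'. \<forall>p\<in>F. same_leading_term (poly (p e) c) (poly (p e') c'))))"
    using roots_matched_step[OF Suc.IH Suc.prems] by blast
  then obtain G where G: "\<And>p0. p0 \<in> F \<Longrightarrow> G p0 \<subseteq> R \<and> finite (G p0)"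
    and match: "\<And>p0 e e' c. p0 \<in> F \<Longrightarrow> agree (G p0) e e' \<Longrightarrow>
       p0 e \<noteq> 0 \<and> Polynomial.degree (p0 e) = d \<and> poly (p0 e) c = 0 \<Longrightarrow>
       \<exists>c'. \<forall>p\<in>F. same_leading_term (poly (p e) c) (poly (p e') c')"
    by metis
  show ?case
    unfolding roots_matched_def
  proof (intro exI[of _ "G0 \<union> (\<Union>p\<in>F. G p)"] conjI allI impI)
    fix e e' c
    assume agree: "agree (G0 \<union> (\<Union>p\<in>F. G p)) e e'"
      and c: "c = 0 \<or> (\<exists>p\<in>F. p e \<noteq> 0 \<and> Polynomial.degree (p e) < Suc d \<and> poly (p e) c = 0)"
    show "\<exists>c'. \<forall>p\<in>F. same_leading_term (poly (p e) c) (poly (p e') c')"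
    proof (cases "c = 0 \<or> (\<exists>p\<in>F. p e \<noteq> 0 \<and> Polynomial.degree (p e) < d \<and> poly (p e) c = 0)")
      case True
      then show ?thesis
        using agree by (intro match0) auto
    next
      case False
      then obtain p where p: "p \<in> F" "p e \<noteq> 0 \<and> Polynomial.degree (p e) = d \<and> poly (p e) c = 0"
        using c by (auto simp: less_Suc_eq)
      then show ?thesis
        using agree by (intro match[of p]) auto
    qed
  qed (use G G0 Suc.prems in auto)
qed

text \<open>An arbitrary point is matched through its nearest center, which is matched as a root.\<close>

theorem matching_same_leading_term: "matching same_leading_term"
  unfolding matching_def
proof (intro allI impI)
  fix F assume F: "finite F" "\<forall>p\<in>F. \<exists>m. family m p"
  then obtain m where m: "\<forall>p\<in>F. family m p"
    by (rule finite_family_bound)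
  define T where "T = derivatives m F \<union> F"
  have "finite T"
    using F(1) by (simp add: T_def finite_derivatives)
  moreover have "\<forall>p\<in>T. \<exists>m. family m p"
    using m family_derivatives[OF m] by (auto simp: T_def)
  ultimately have "roots_matched m T"
    by (rule roots_matched)
  then obtain G where G: "G \<subseteq> R" "finite G" and match: "\<And>e e' c. agree G e e' \<Longrightarrow>
      c = 0 \<or> (\<exists>p\<in>T. p e \<noteq> 0 \<and> Polynomial.degree (p e) < m \<and> poly (p e) c = 0) \<Longrightarrow>
      \<exists>c'. \<forall>p\<in>T. same_leading_term (poly (p e) c) (poly (p e') c')"
    by (rule roots_matchedE) (rule that)
  have "\<exists>y'. \<forall>p\<in>F. same_leading_term (poly (p e) y) (poly (p e') y')" if agree: "agree G e e'" for e e' y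
  proof -
    obtain b where b: "nearest y (centers F e) b"
      using nearest_exists[OF finite_centers[OF F(1) m, of e]] by (auto simp: centers_def)
    then have "b \<in> centers F e"
      by (simp add: nearest_def)
    then have "\<exists>b'. \<forall>p\<in>T. same_leading_term (poly (p e) b) (poly (p e') b')"
      using centers_cases[OF _ m] by (intro match agree) (auto simp: T_def)
    then obtain b' where b': "\<forall>p\<in>T. same_leading_term (poly (p e) b) (poly (p e') b')" ..
    show ?thesis
    proof (cases "y = b")
      case True
      then show ?thesis
        using b' by (auto simp: T_def)
    next
      case False
      then show ?thesis
        using b b' m values_matched_near_center[of m F e b e' b' _ y 1]
        by (intro exI[of _ "b' + (y - b)"]) (auto simp: T_def)
    qed
  qed
  then show "\<exists>G\<subseteq>R. finite G \<and> (\<forall>e e'. agree G e e' \<longrightarrow>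
        (\<forall>y. \<exists>y'. \<forall>p\<in>F. same_leading_term (poly (p e) y) (poly (p e') y')))"
    using G by blast
qed

end

section \<open>Signs of polynomials over a field with the intermediate value property\<close>

text \<open>Extend the increasing map beyond its largest node by a linear function, and on the left by
  induction.\<close>

lemma strict_mono_interpolation:
  fixes f :: "'a::linordered_field \<Rightarrow> 'a"
  assumes "finite S" "strict_mono_on S f"
  obtains \<psi> where "strict_mono \<psi>" "surj \<psi>" "\<And>x. x \<in> S \<Longrightarrow> \<psi> x = f x"
proof -
  have "\<exists>\<psi>. strict_mono \<psi> \<and> surj \<psi> \<and> (\<forall>x\<in>S. \<psi> x = f x)"
    using assms
  proof (induction S rule: finite_linorder_max_induct)
    case empty
    show ?case
      by (rule exI[of _ "\<lambda>x. x"]) (simp add: strict_mono_def)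
  next
    case (insert b A)
    show ?case
    proof (cases "A = {}")
      case True
      have "surj (\<lambda>x. x - b + f b)"
        by (rule surjI[of _ "\<lambda>y. y + b - f b"]) simp
      then show ?thesis
        using True by (intro exI[of _ "\<lambda>x. x - b + f b"]) (auto simp: strict_mono_def)
    next
      case False
      have "strict_mono_on A f"
        using insert.prems by (auto simp: strict_mono_on_def)
      then obtain \<psi> where \<psi>: "strict_mono \<psi>" "surj \<psi>" "\<forall>x\<in>A. \<psi> x = f x"
        using insert.IH by blast
      define m where "m = Max A"
      have m: "m \<in> A" "\<And>x. x \<in> A \<Longrightarrow> x \<le> m"
        using insert.hyps False by (auto simp: m_def)
      then have "m < b" and "f m < f b"
        using insert by (auto simp: strict_mono_on_def)
      define k where "k = (f b - f m) / (b - m)"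
      have "k > 0"
        using \<open>m < b\<close> \<open>f m < f b\<close> by (simp add: k_def)
      define g where "g = (\<lambda>x. if x \<le> m then \<psi> x else f m + (x - m) * k)"
      have "\<psi> m = f m"
        using \<psi> m by simp
      have "strict_mono g"
      proof (rule strict_monoI)
        fix x y :: 'a assume "x < y"
        consider "y \<le> m" | "x \<le> m" "m < y" | "m < x"
          by linarith
        then show "g x < g y"
        proof cases
          case 1
          then show ?thesis
            using \<open>x < y\<close> \<psi>(1) by (simp add: g_def strict_mono_less)
        next
          case 2
          then have "\<psi> x \<le> f m" "0 < (y - m) * k"
            using \<psi>(1) \<open>k > 0\<close> \<open>\<psi> m = f m\<close> by (auto simp flip: \<open>\<psi> m = f m\<close> simp: strict_mono_less_eq)
          then show ?thesis
            using 2 by (simp add: g_def)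
        next
          case 3
          then show ?thesis
            using \<open>x < y\<close> \<open>k > 0\<close> by (simp add: g_def)
        qed
      qed
      moreover have "surj g"
        unfolding surj_def
      proof
        fix y
        show "\<exists>x. y = g x"
        proof (cases "y \<le> f m")
          case True
          obtain x where x: "y = \<psi> x"
            using \<psi>(2) by (auto simp: surj_def)
          then have "x \<le> m"
            using True \<psi>(1) \<open>\<psi> m = f m\<close> by (metis strict_mono_less_eq)
          then show ?thesis
            using x by (auto simp: g_def)
        next
          case False
          then have "m + (y - f m) / k > m"
            using \<open>k > 0\<close> by simp
          then show ?thesis
            using \<open>k > 0\<close> by (intro exI[of _ "m + (y - f m) / k"]) (simp add: g_def)
        qed
      qed
      moreover have "g x = f x" if "x \<in> insert b A" for x
        using that m \<psi>(3) \<open>m < b\<close> by (auto simp: g_def k_def)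
      ultimately show ?thesis
        by blast
    qed
  qed
  then show ?thesis
    using that by blast
qed

lemma poly_ge_lead_coeff_eventually:
  fixes p :: "'a::linordered_field poly"
  assumes "Polynomial.lead_coeff p > 0"
  shows "\<exists>M. \<forall>x\<ge>M. Polynomial.lead_coeff p \<le> poly p x"
  using assms
proof (induction p)
  case (pCons a q)
  show ?case
  proof (cases "q = 0")
    case False
    define l where "l = Polynomial.lead_coeff q"
    have "l > 0"
      using pCons.prems False by (simp add: l_def)
    then obtain M where M: "\<And>x. x \<ge> M \<Longrightarrow> l \<le> poly q x"
      using pCons.IH by (auto simp: l_def)
    have "l \<le> poly (pCons a q) x" if x: "x \<ge> max M (1 + \<bar>a\<bar> / l)" for x
    proof -
      have "l + \<bar>a\<bar> = (1 + \<bar>a\<bar> / l) * l"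
        using \<open>l > 0\<close> by (simp add: field_simps)
      also have "\<dots> \<le> x * l"
        using x \<open>l > 0\<close> by (intro mult_right_mono) auto
      also have "\<dots> \<le> x * poly q x"
      proof (rule mult_left_mono)
        have "0 \<le> 1 + \<bar>a\<bar> / l"
          using \<open>l > 0\<close> by simp
        with x show "0 \<le> x"
          by simp
      qed (use x M in simp)
      finally show ?thesis
        by simp
    qed
    then show ?thesis
      unfolding l_def using False by (intro exI[of _ "max M (1 + \<bar>a\<bar> / l)"]) (simp add: l_def)
  qed simp
qed simp

lemma sgn_poly_pderiv_at_top:
  fixes p :: "'a::linordered_field poly"
  assumes "pderiv p \<noteq> 0"
  shows "\<exists>M. \<forall>x\<ge>M. sgn (poly p x) = sgn (poly (pderiv p) x)"
proof -
  have *: "\<exists>M. \<forall>x\<ge>M. poly p x > 0 \<and> poly (pderiv p) x > 0"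
    if nonconst: "pderiv p \<noteq> 0" and lc: "Polynomial.lead_coeff p > 0" for p :: "'a poly"
  proof -
    have "Polynomial.degree p \<noteq> 0"
      using nonconst by (simp add: pderiv_eq_0_iff)
    then have "Polynomial.lead_coeff (pderiv p) > 0"
      using lc by (simp add: degree_pderiv coeff_pderiv)
    then obtain M1 where "\<And>x. x \<ge> M1 \<Longrightarrow> poly (pderiv p) x > 0"
      using poly_ge_lead_coeff_eventually less_le_trans by metis
    moreover obtain M2 where "\<And>x. x \<ge> M2 \<Longrightarrow> poly p x > 0"
      using poly_ge_lead_coeff_eventually lc less_le_trans by metis
    ultimately show ?thesis
      by (intro exI[of _ "max M1 M2"]) auto
  qed
  have "Polynomial.lead_coeff p \<noteq> 0"
    using assms by auto
  then consider "Polynomial.lead_coeff p > 0" | "Polynomial.lead_coeff (- p) > 0"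
    by (metis lead_coeff_minus neg_0_less_iff_less neq_iff)
  then show ?thesis
  proof cases
    case 1
    then obtain M where "\<forall>x\<ge>M. poly p x > 0 \<and> poly (pderiv p) x > 0"
      using *[of p] assms by auto
    then show ?thesis
      by (intro exI[of _ M]) simp
  next
    case 2
    then obtain M where "\<forall>x\<ge>M. poly p x < 0 \<and> poly (pderiv p) x < 0"
      using *[of "- p"] assms by (auto simp: pderiv_minus)
    then show ?thesis
      by (intro exI[of _ M]) simp
  qed
qed

lemma sgn_poly_pderiv_at_bot:
  fixes p :: "'a::linordered_field poly"
  assumes "pderiv p \<noteq> 0"
  shows "\<exists>M. \<forall>x\<le>M. sgn (poly p x) = - sgn (poly (pderiv p) x)"
proof -
  define q where "q = pcompose p [:0, -1:]"
  have q': "pderiv q = - pcompose (pderiv p) [:0, -1:]"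
    by (simp add: q_def pderiv_pcompose pderiv_pCons)
  then have "pderiv q \<noteq> 0"
    using assms by (auto simp: pcompose_eq_0_iff)
  then obtain M where M: "\<And>x. x \<ge> M \<Longrightarrow> sgn (poly q x) = sgn (poly (pderiv q) x)"
    using sgn_poly_pderiv_at_top by blast
  have "sgn (poly p x) = - sgn (poly (pderiv p) x)" if "x \<le> - M" for x
  proof -
    have "poly q (- x) = poly p x" "poly (pderiv q) (- x) = - poly (pderiv p) x"
      by (simp add: q_def poly_pcompose) (simp add: q' poly_pcompose)
    then show ?thesis
      using M[of "- x"] that by (simp add: sgn_minus)
  qed
  then show ?thesis
    by blast
qed

text \<open>No point of \<open>C\<close> lies between \<open>y\<close> and \<open>z\<close>, and none equals exactly one of them.\<close>

definition same_gap :: "'a::linorder set \<Rightarrow> 'a \<Rightarrow> 'a \<Rightarrow> bool" where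
  "same_gap C y z \<longleftrightarrow> (\<forall>c\<in>C. (c < y \<longleftrightarrow> c < z) \<and> (y < c \<longleftrightarrow> z < c))"

lemma same_gap_sym: "same_gap C y z \<Longrightarrow> same_gap C z y"
  by (auto simp: same_gap_def)

lemma same_gap_image:
  "strict_mono f \<Longrightarrow> same_gap (f ` C) (f y) (f z) \<longleftrightarrow> same_gap C y z"
  by (simp add: same_gap_def strict_mono_less)

lemma same_gapI:
  assumes "x \<le> y" "\<And>c. c \<in> C \<Longrightarrow> x \<le> c \<Longrightarrow> c \<le> y \<Longrightarrow> False"
  shows "same_gap C x y"
  unfolding same_gap_def
proof
  fix c assume "c \<in> C"
  then have "c < x \<or> y < c"
    using assms(2)[of c] by (auto simp: not_less[symmetric])
  then show "(c < x \<longleftrightarrow> c < y) \<and> (x < c \<longleftrightarrow> y < c)"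
    using assms(1) by auto
qed

lemma same_gap_between: "same_gap C y z \<Longrightarrow> y < z \<Longrightarrow> y \<le> c \<Longrightarrow> c \<le> z \<Longrightarrow> c \<notin> C"
  unfolding same_gap_def by (metis leD le_less_trans less_le_trans order.order_iff_strict)

locale polynomial_ivt =
  fixes field_type :: "'a::linordered_field itself"
  assumes ivt: "\<And>p (a::'a) b. a < b \<Longrightarrow> poly p a < 0 \<Longrightarrow> 0 < poly p b \<Longrightarrow>
      \<exists>c. a < c \<and> c < b \<and> poly p c = 0"
begin

lemma ivt_sgn:
  fixes p :: "'a poly"
  assumes "a < b" "poly p a * poly p b < 0"
  shows "\<exists>c. a < c \<and> c < b \<and> poly p c = 0"
  using assms ivt[of a b p] ivt[of a b "- p"] by (auto simp: mult_less_0_iff)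

lemma sgn_eq_if_no_root:
  fixes p :: "'a poly"
  assumes "a \<le> b" "\<And>z. a \<le> z \<Longrightarrow> z \<le> b \<Longrightarrow> poly p z \<noteq> 0"
  shows "sgn (poly p a) = sgn (poly p b)"
proof (cases "a = b")
  case False
  then have "\<not> poly p a * poly p b < 0"
    using ivt_sgn[of a b p] assms by (auto dest: less_imp_le)
  moreover have "poly p a \<noteq> 0" "poly p b \<noteq> 0"
    using assms by auto
  ultimately show ?thesis
    by (auto simp: sgn_if mult_less_0_iff not_less)
qed simp

text \<open>Let \<open>d\<close> be the first root of \<open>p\<close> after \<open>a\<close> and split off the powers of \<open>Y - a\<close> and \<open>Y - d\<close> from \<open>p\<close>. The
  remaining factor \<open>g\<close> has constant sign between \<open>a\<close> and \<open>d\<close>. The derivative is the product of lower powers of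
  these linear factors with a polynomial \<open>h\<close> whose values at \<open>a\<close> and \<open>d\<close> are multiples of those of
  \<open>g\<close> by factors of opposite signs.\<close>

lemma rolle:
  fixes p :: "'a poly"
  assumes "a < b" "poly p a = 0" "poly p b = 0"
  shows "\<exists>c. a < c \<and> c < b \<and> poly (pderiv p) c = 0"
proof (cases "p = 0")
  case True
  then show ?thesis
    using dense[OF assms(1)] by auto
next
  case False
  define S where "S = {r. a < r \<and> r \<le> b \<and> poly p r = 0}"
  have "finite S"
    by (rule finite_subset[OF _ poly_roots_finite[OF False]]) (auto simp: S_def)
  have "b \<in> S"
    using assms by (simp add: S_def)
  define d where "d = Min S"
  have "d \<in> S" and d_min: "\<And>r. r \<in> S \<Longrightarrow> d \<le> r"
    using \<open>finite S\<close> \<open>b \<in> S\<close> by (auto simp: d_def intro: Min_in)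
  then have d: "a < d" "d \<le> b" "poly p d = 0"
    by (auto simp: S_def)
  obtain q where q: "p = [:- a, 1:] ^ Polynomial.order a p * q" "\<not> [:- a, 1:] dvd q"
    using order_decomp[OF False] by blast
  have "q \<noteq> 0"
    using q(2) by auto
  then obtain g where g: "q = [:- d, 1:] ^ Polynomial.order d q * g" "\<not> [:- d, 1:] dvd g"
    using order_decomp by blast
  have "Polynomial.order a p \<noteq> 0"
    using False assms(2) by (simp add: order_root)
  then obtain m where m: "Polynomial.order a p = Suc m"
    using not0_implies_Suc by blast
  have "poly q d = 0"
    using d by (subst (asm) q(1)) auto
  then have "Polynomial.order d q \<noteq> 0"
    using \<open>q \<noteq> 0\<close> by (simp add: order_root)
  then obtain n where n: "Polynomial.order d q = Suc n"
    using not0_implies_Suc by blast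
  have p: "p = [:- a, 1:] ^ Suc m * ([:- d, 1:] ^ Suc n * g)"
    using q(1) g(1) by (simp only: m n)
  have "poly g z \<noteq> 0" if "a \<le> z" "z \<le> d" for z
  proof
    assume "poly g z = 0"
    have "z = a \<or> z = d \<or> a < z \<and> z < d"
      using that by auto
    then consider "z = a" | "z = d" | "a < z" "z < d"
      by blast
    then show False
    proof cases
      case 1
      then have "poly q a = 0"
        using \<open>poly g z = 0\<close> by (subst g(1)) simp
      then show False
        using q(2) by (simp add: poly_eq_0_iff_dvd)
    next
      case 2
      then show False
        using \<open>poly g z = 0\<close> g(2) by (simp add: poly_eq_0_iff_dvd)
    next
      case 3
      then have "z \<in> S"
        using \<open>poly g z = 0\<close> d by (simp add: S_def p)
      then show False
        using d_min 3 by fastforce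
    qed
  qed
  then have g_sgn: "sgn (poly g a) = sgn (poly g d)" "poly g a \<noteq> 0"
    using sgn_eq_if_no_root[of a d g] d by auto
  define h where "h = Polynomial.smult (of_nat (Suc m)) ([:- d, 1:] * g) +
    Polynomial.smult (of_nat (Suc n)) ([:- a, 1:] * g) + [:- a, 1:] * [:- d, 1:] * pderiv g"
  have p': "poly (pderiv p) c = (c - a) ^ m * (c - d) ^ n * poly h c" for c
    unfolding p h_def
    by (simp add: pderiv_mult pderiv_power_Suc pderiv_pCons algebra_simps del: of_nat_Suc power_Suc)
       (simp add: algebra_simps)
  have "poly h a = of_nat (Suc m) * (a - d) * poly g a"
    and "poly h d = of_nat (Suc n) * (d - a) * poly g d"
    by (simp_all add: h_def algebra_simps)
  then have "sgn (poly h a) = - sgn (poly g a)" "sgn (poly h d) = sgn (poly g d)"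
    using d by (simp_all add: sgn_mult del: of_nat_Suc)
  then have "poly h a * poly h d < 0"
    using g_sgn by (auto simp: sgn_if mult_less_0_iff split: if_splits)
  then obtain c where "a < c" "c < d" "poly h c = 0"
    using ivt_sgn d by blast
  then show ?thesis
    using p' d by auto
qed

text \<open>The mean value theorem, obtained from Rolle's theorem by subtracting the chord.\<close>

lemma sgn_diff_eq_sgn_pderiv:
  fixes p :: "'a poly"
  assumes "a < b" "\<And>z. a < z \<Longrightarrow> z < b \<Longrightarrow> sgn (poly (pderiv p) z) = \<epsilon>"
  shows "sgn (poly p b - poly p a) = \<epsilon>"
proof -
  define k where "k = (poly p b - poly p a) / (b - a)"
  define q where "q = p - [:poly p a - a * k, k:]"
  have k: "(b - a) * k = poly p b - poly p a"
    using assms(1) by (simp add: k_def)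
  have "poly q a = 0"
    by (simp add: q_def)
  moreover have "poly q b = 0"
    using k by (simp add: q_def algebra_simps)
  ultimately obtain c where "a < c" "c < b" "poly (pderiv q) c = 0"
    using rolle assms(1) by blast
  then have "poly (pderiv p) c = k" "sgn (poly (pderiv p) c) = \<epsilon>"
    using assms(2) by (auto simp: q_def pderiv_diff pderiv_pCons)
  then show ?thesis
    using k assms(1) by (simp add: k_def sgn_divide)
qed

lemma same_gap_sgn_eq:
  fixes p :: "'a poly"
  assumes "same_gap C y z" "\<And>r. poly p r = 0 \<Longrightarrow> r \<in> C"
  shows "sgn (poly p y) = sgn (poly p z)"
proof (cases y z rule: linorder_cases)
  case less
  then show ?thesis
    using same_gap_between[OF assms(1)] assms(2) by (intro sgn_eq_if_no_root) auto
next
  case greater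
  then show ?thesis
    using same_gap_between[OF same_gap_sym[OF assms(1)]] assms(2)
    by (intro sgn_eq_if_no_root[symmetric]) auto
qed simp

text \<open>Let \<open>C\<close> contain the critical points of \<open>q\<close>, so that \<open>q\<close> is monotone on each gap of \<open>C\<close>. A gap contains a
  root of \<open>q\<close> iff the sign of \<open>q\<close> is opposite to that of its derivative at the left end and equal to it
  at the right end. Both conditions hold vacuously at an infinite end, where a nonconstant polynomial
  behaves in this way anyway.\<close>

definition left_end_opposite :: "'a poly \<Rightarrow> 'a set \<Rightarrow> 'a \<Rightarrow> bool" where
  "left_end_opposite q C y \<longleftrightarrow> (\<forall>c\<in>C. c < y \<and> (\<forall>d\<in>C. d < y \<longrightarrow> d \<le> c) \<longrightarrow>
     sgn (poly q c) = - sgn (poly (pderiv q) y))"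

definition right_end_agrees :: "'a poly \<Rightarrow> 'a set \<Rightarrow> 'a \<Rightarrow> bool" where
  "right_end_agrees q C y \<longleftrightarrow> (\<forall>c\<in>C. y < c \<and> (\<forall>d\<in>C. y < d \<longrightarrow> c \<le> d) \<longrightarrow>
     sgn (poly q c) = sgn (poly (pderiv q) y))"

context
  fixes q :: "'a poly" and C :: "'a set"
  assumes C: "finite C" "\<And>r. poly (pderiv q) r = 0 \<Longrightarrow> r \<in> C" and nonconst: "pderiv q \<noteq> 0"
begin

lemma left_end_opposite_point:
  assumes "y \<notin> C" "left_end_opposite q C y"
  shows "\<exists>x<y. sgn (poly q x) = - sgn (poly (pderiv q) y) \<and> (\<forall>c\<in>C. \<not> (x < c \<and> c \<le> y))"
proof (cases "{c \<in> C. c < y} = {}")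
  case True
  obtain M where M: "\<And>x. x \<le> M \<Longrightarrow> sgn (poly q x) = - sgn (poly (pderiv q) x)"
    using sgn_poly_pderiv_at_bot[OF nonconst] by blast
  define x where "x = min M (y - 1)"
  have "x < y" "x \<le> M"
    by (simp_all add: x_def min.strict_coboundedI2)
  have none: False if "c \<in> C" "c \<le> y" for c
    using True assms(1) that by (cases "c = y") auto
  then have "same_gap C x y"
    using \<open>x < y\<close> by (intro same_gapI) auto
  then have "sgn (poly (pderiv q) x) = sgn (poly (pderiv q) y)"
    using C(2) by (rule same_gap_sgn_eq)
  then show ?thesis
    using none \<open>x < y\<close> M[OF \<open>x \<le> M\<close>] by (intro exI[of _ x]) auto
next
  case False
  define c where "c = Max {c \<in> C. c < y}"
  have "c \<in> {c \<in> C. c < y}" and max: "\<And>d. d \<in> C \<Longrightarrow> d < y \<Longrightarrow> d \<le> c"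
    using Max_in[OF _ False] C(1) by (auto simp: c_def)
  then show ?thesis
    using assms by (intro exI[of _ c]) (force simp: left_end_opposite_def)
qed

lemma right_end_agrees_point:
  assumes "y \<notin> C" "right_end_agrees q C y"
  shows "\<exists>x>y. sgn (poly q x) = sgn (poly (pderiv q) y) \<and> (\<forall>c\<in>C. \<not> (y \<le> c \<and> c < x))"
proof (cases "{c \<in> C. y < c} = {}")
  case True
  obtain M where M: "\<And>x. x \<ge> M \<Longrightarrow> sgn (poly q x) = sgn (poly (pderiv q) x)"
    using sgn_poly_pderiv_at_top[OF nonconst] by blast
  define x where "x = max M (y + 1)"
  have "y < x" "M \<le> x"
    by (simp_all add: x_def less_max_iff_disj)
  have none: False if "c \<in> C" "y \<le> c" for c
    using True assms(1) that by (cases "c = y") auto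
  then have "same_gap C y x"
    using \<open>y < x\<close> by (intro same_gapI) auto
  then have "sgn (poly (pderiv q) y) = sgn (poly (pderiv q) x)"
    using C(2) by (rule same_gap_sgn_eq)
  then show ?thesis
    using none \<open>y < x\<close> M[OF \<open>M \<le> x\<close>] by (intro exI[of _ x]) auto
next
  case False
  define c where "c = Min {c \<in> C. y < c}"
  have "c \<in> {c \<in> C. y < c}" and min: "\<And>d. d \<in> C \<Longrightarrow> y < d \<Longrightarrow> c \<le> d"
    using Min_in[OF _ False] C(1) by (auto simp: c_def)
  then show ?thesis
    using assms by (intro exI[of _ c]) (force simp: right_end_agrees_def)
qed

lemma root_in_gap:
  assumes y: "y \<notin> C" and ends: "left_end_opposite q C y" "right_end_agrees q C y"
  shows "\<exists>z. same_gap C y z \<and> poly q z = 0"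
proof -
  obtain x1 where x1: "x1 < y" "sgn (poly q x1) = - sgn (poly (pderiv q) y)"
    "\<And>c. c \<in> C \<Longrightarrow> \<not> (x1 < c \<and> c \<le> y)"
    using left_end_opposite_point[OF y ends(1)] by blast
  obtain x2 where x2: "y < x2" "sgn (poly q x2) = sgn (poly (pderiv q) y)"
    "\<And>c. c \<in> C \<Longrightarrow> \<not> (y \<le> c \<and> c < x2)"
    using right_end_agrees_point[OF y ends(2)] by blast
  have "poly (pderiv q) y \<noteq> 0"
    using C(2) y by blast
  then have "poly q x1 * poly q x2 < 0"
    using x1(2) x2(2) by (auto simp: sgn_if mult_less_0_iff split: if_splits)
  then obtain z where z: "x1 < z" "z < x2" "poly q z = 0"
    using ivt_sgn x1(1) x2(1) by (metis less_trans)
  have "same_gap C y z"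
    unfolding same_gap_def
  proof
    fix c assume c: "c \<in> C"
    show "(c < y \<longleftrightarrow> c < z) \<and> (y < c \<longleftrightarrow> z < c)"
      using x1(3)[OF c] x2(3)[OF c] z x1(1) x2(1) by auto
  qed
  then show ?thesis
    using z by blast
qed

lemma sgn_if_left_end_not_opposite:
  assumes "y \<notin> C" "\<not> left_end_opposite q C y"
  shows "sgn (poly q y) = sgn (poly (pderiv q) y)"
proof -
  obtain c where c: "c < y" "\<And>d. d \<in> C \<Longrightarrow> d < y \<Longrightarrow> d \<le> c"
    "sgn (poly q c) \<noteq> - sgn (poly (pderiv q) y)"
    using assms(2) by (auto simp: left_end_opposite_def)
  have "sgn (poly q y - poly q c) = sgn (poly (pderiv q) y)"
  proof (rule sgn_diff_eq_sgn_pderiv)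
    fix z assume "c < z" "z < y"
    then have "same_gap C z y"
      using c(2) assms(1) by (intro same_gapI) (metis leD le_less_trans less_imp_le order.not_eq_order_implies_strict)+
    then show "sgn (poly (pderiv q) z) = sgn (poly (pderiv q) y)"
      using C(2) by (rule same_gap_sgn_eq)
  qed fact
  moreover have "poly (pderiv q) y \<noteq> 0"
    using C(2) assms(1) by blast
  ultimately show ?thesis
    using c(3) by (auto simp: sgn_if split: if_splits)
qed

lemma sgn_if_right_end_not_agrees:
  assumes "y \<notin> C" "\<not> right_end_agrees q C y"
  shows "sgn (poly q y) = - sgn (poly (pderiv q) y)"
proof -
  obtain c where c: "y < c" "\<And>d. d \<in> C \<Longrightarrow> y < d \<Longrightarrow> c \<le> d"
    "sgn (poly q c) \<noteq> sgn (poly (pderiv q) y)"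
    using assms(2) by (auto simp: right_end_agrees_def)
  have "sgn (poly q c - poly q y) = sgn (poly (pderiv q) y)"
  proof (rule sgn_diff_eq_sgn_pderiv)
    fix z assume "y < z" "z < c"
    then have "same_gap C y z"
      using c(2) assms(1) by (intro same_gapI) (metis leD le_less_trans less_imp_le order.not_eq_order_implies_strict)+
    then show "sgn (poly (pderiv q) z) = sgn (poly (pderiv q) y)"
      using C(2) by (intro same_gap_sgn_eq[OF same_gap_sym])
  qed fact
  moreover have "poly (pderiv q) y \<noteq> 0"
    using C(2) assms(1) by blast
  ultimately show ?thesis
    using c(3) by (auto simp: sgn_if split: if_splits)
qed

lemma sgn_in_gap_of_root:
  assumes gap: "same_gap C y z" and z: "poly q z = 0"
  shows "sgn (poly q y) = sgn (poly (pderiv q) y) * sgn (y - z)"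
proof (cases y z rule: linorder_cases)
  case less
  have "sgn (poly q z - poly q y) = sgn (poly (pderiv q) y)"
  proof (rule sgn_diff_eq_sgn_pderiv)
    fix w assume "y < w" "w < z"
    then have "same_gap C w y"
      using gap by (force simp: same_gap_def)
    then show "sgn (poly (pderiv q) w) = sgn (poly (pderiv q) y)"
      using C(2) by (rule same_gap_sgn_eq)
  qed fact
  then show ?thesis
    using less z by (auto simp: sgn_if split: if_splits)
next
  case greater
  have "sgn (poly q y - poly q z) = sgn (poly (pderiv q) y)"
  proof (rule sgn_diff_eq_sgn_pderiv)
    fix w assume "z < w" "w < y"
    then have "same_gap C w y"
      using gap by (force simp: same_gap_def)
    then show "sgn (poly (pderiv q) w) = sgn (poly (pderiv q) y)"
      using C(2) by (rule same_gap_sgn_eq)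
  qed fact
  then show ?thesis
    using greater z by simp
qed (use z in simp)

end

definition same_signs :: "('a \<Rightarrow> 'a) \<Rightarrow> 'a poly \<Rightarrow> 'a poly \<Rightarrow> bool" where
  "same_signs \<phi> p p' \<longleftrightarrow> (\<forall>y. sgn (poly p y) = sgn (poly p' (\<phi> y)))"

text \<open>Whether a gap contains a root is visible from signs at \<open>C\<close> and the sign of the derivative, so it can be
  carried over to another polynomial by an increasing bijection.\<close>

lemma ends_transport:
  assumes "strict_mono \<phi>" "\<And>c. c \<in> C \<Longrightarrow> sgn (poly q c) = sgn (poly q' (\<phi> c))"
    and "same_signs \<phi> (pderiv q) (pderiv q')"
  shows "left_end_opposite q' (\<phi> ` C) (\<phi> y) \<longleftrightarrow> left_end_opposite q C y"
    and "right_end_agrees q' (\<phi> ` C) (\<phi> y) \<longleftrightarrow> right_end_agrees q C y"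
  using assms(2,3) unfolding left_end_opposite_def right_end_agrees_def same_signs_def
  by (simp_all add: strict_mono_less[OF assms(1)] strict_mono_less_eq[OF assms(1)])

text \<open>Let \<open>C\<close> be the set of roots of the polynomials already matched, among them the derivative of \<open>q\<close>. By the
  hypothesis on these roots, a gap of \<open>C\<close> contains a root of \<open>q\<close> iff the corresponding gap
  contains a root of \<open>q'\<close>. The required bijection keeps the values of \<open>\<phi>\<close> on \<open>C\<close> and
  sends each further root of \<open>q\<close> to the corresponding root of \<open>q'\<close>.\<close>

lemma same_signs_extend:
  assumes fin: "finite \<F>" and \<phi>: "strict_mono \<phi>" "surj \<phi>"
    and match: "\<And>p p'. (p, p') \<in> \<F> \<Longrightarrow> same_signs \<phi> p p'"
    and deriv: "(pderiv q, pderiv q') \<in> \<F>" "pderiv q \<noteq> 0"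
    and at_roots: "\<And>p p' c. (p, p') \<in> \<F> \<Longrightarrow> p \<noteq> 0 \<Longrightarrow> poly p c = 0 \<Longrightarrow>
      sgn (poly q c) = sgn (poly q' (\<phi> c))"
  shows "\<exists>\<psi>. strict_mono \<psi> \<and> surj \<psi> \<and> (\<forall>(p, p')\<in>insert (q, q') \<F>. same_signs \<psi> p p')"
proof -
  define C where "C = (\<Union>p\<in>fst ` \<F> - {0}. {c. poly p c = 0})"
  have C: "finite C"
    unfolding C_def using fin by (intro finite_UN_I) (auto intro: poly_roots_finite)
  have C_root: "c \<in> C" if "(p, p') \<in> \<F>" "p \<noteq> 0" "poly p c = 0" for p p' c
    using that by (force simp: C_def)
  have zero: "p = 0 \<longleftrightarrow> p' = 0" if "(p, p') \<in> \<F>" for p p'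
  proof -
    have "(\<forall>y. poly p y = 0) \<longleftrightarrow> (\<forall>y. poly p' (\<phi> y) = 0)"
      using match[OF that] unfolding same_signs_def by (metis sgn_0_0)
    also have "\<dots> \<longleftrightarrow> (\<forall>y. poly p' y = 0)"
      using \<phi>(2) by (metis surjD)
    finally show ?thesis
      by (simp add: poly_all_0_iff_0)
  qed
  define C' where "C' = \<phi> ` C"
  have C'_root: "c \<in> C'" if "(p, p') \<in> \<F>" "p' \<noteq> 0" "poly p' c = 0" for p p' c
  proof -
    obtain x where x: "c = \<phi> x"
      using \<phi>(2) by (metis surjD)
    then have "poly p x = 0"
      using match[OF that(1)] that(3) unfolding same_signs_def by (metis sgn_0_0)
    then show ?thesis
      using C_root that zero x unfolding C'_def by blast
  qed
  have q_C: "sgn (poly q c) = sgn (poly q' (\<phi> c))" if "c \<in> C" for c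
    using that at_roots by (force simp: C_def)
  have nonconst': "pderiv q' \<noteq> 0"
    using zero deriv by blast
  note gap = C C_root[OF deriv] deriv(2)
  have "finite C'"
    using C by (simp add: C'_def)
  note gap' = \<open>finite C'\<close> C'_root[OF deriv(1) nonconst'] nonconst'
  have q'_root: "\<exists>z'. same_gap C' (\<phi> z) z' \<and> poly q' z' = 0" if "z \<notin> C" "poly q z = 0" for z
  proof -
    have nz: "poly (pderiv q) z \<noteq> 0"
      using C_root deriv that by blast
    have "left_end_opposite q C z"
      using sgn_if_left_end_not_opposite[OF gap that(1)] nz that(2) by (auto simp: sgn_0_0)
    moreover have "right_end_agrees q C z"
      using sgn_if_right_end_not_agrees[OF gap that(1)] nz that(2) by (auto simp: sgn_0_0)
    ultimately have "left_end_opposite q' C' (\<phi> z)" "right_end_agrees q' C' (\<phi> z)"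
      using ends_transport[of \<phi> C q q', OF \<phi>(1) q_C match[OF deriv(1)]] unfolding C'_def by simp_all
    moreover have "\<phi> z \<notin> C'"
      using that(1) \<phi>(1) by (auto simp: C'_def strict_mono_eq)
    ultimately show ?thesis
      using root_in_gap[OF gap'] by blast
  qed
  define f where "f = (\<lambda>z. if z \<in> C then \<phi> z else SOME z'. same_gap C' (\<phi> z) z' \<and> poly q' z' = 0)"
  have f_root: "same_gap C' (\<phi> z) (f z)" "poly q' (f z) = 0" if "z \<notin> C" "poly q z = 0" for z
    using someI_ex[OF q'_root[OF that]] that by (auto simp: f_def)
  have f_less: "(\<phi> c < f z \<longleftrightarrow> c < z) \<and> (f z < \<phi> c \<longleftrightarrow> z < c)"
    if "c \<in> C" "z \<notin> C" "poly q z = 0" for c z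
    using f_root[OF that(2,3)] that(1) by (auto simp: same_gap_def C'_def strict_mono_less[OF \<phi>(1)])
  define S where "S = C \<union> {z. poly q z = 0}"
  have "q \<noteq> 0"
    using deriv(2) by auto
  then have "finite S"
    using C by (simp add: S_def poly_roots_finite)
  moreover have "strict_mono_on S f"
  proof (rule strict_mono_onI)
    fix x y assume xy: "x \<in> S" "y \<in> S" "x < y"
    show "f x < f y"
    proof (cases "x \<in> C \<or> y \<in> C")
      case True
      then show ?thesis
        using xy f_less[of x y] f_less[of y x] strict_mono_less[OF \<phi>(1)]
        by (auto simp: S_def f_def)
    next
      case False
      then have roots: "poly q x = 0" "poly q y = 0"
        using xy by (auto simp: S_def)
      then obtain c where c: "x < c" "c < y" "poly (pderiv q) c = 0"
        using rolle xy(3) by blast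
      then have "c \<in> C"
        using C_root deriv by blast
      then have "f x < \<phi> c" "\<phi> c < f y"
        using f_less False roots c by blast+
      then show ?thesis
        by simp
    qed
  qed
  ultimately obtain \<psi> where \<psi>: "strict_mono \<psi>" "surj \<psi>" "\<And>x. x \<in> S \<Longrightarrow> \<psi> x = f x"
    by (rule strict_mono_interpolation) (rule that)
  have \<psi>_C: "\<psi> c = \<phi> c" if "c \<in> C" for c
    using \<psi>(3)[of c] that by (simp add: S_def f_def)
  then have \<psi>_C': "C' = \<psi> ` C"
    unfolding C'_def by (intro image_cong) auto
  have \<psi>_match: "same_signs \<psi> p p'" if "(p, p') \<in> \<F>" for p p'
    unfolding same_signs_def
  proof
    fix y
    have "same_gap C' (\<phi> y) (\<psi> y)"
      unfolding same_gap_def C'_def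
      using \<psi>_C strict_mono_less[OF \<phi>(1)] strict_mono_less[OF \<psi>(1)] by (metis imageE)
    then have "sgn (poly p' (\<phi> y)) = sgn (poly p' (\<psi> y))"
      using same_gap_sgn_eq C'_root[OF that] by (cases "p' = 0") auto
    then show "sgn (poly p y) = sgn (poly p' (\<psi> y))"
      using match[OF that] by (simp add: same_signs_def)
  qed
  have q_C\<psi>: "sgn (poly q c) = sgn (poly q' (\<psi> c))" if "c \<in> C" for c
    using q_C \<psi>_C that by simp
  have "same_signs \<psi> q q'"
    unfolding same_signs_def
  proof
    fix y
    have deriv_y: "sgn (poly (pderiv q) y) = sgn (poly (pderiv q') (\<psi> y))"
      using \<psi>_match[OF deriv(1)] by (simp add: same_signs_def)
    note transport = ends_transport[of \<psi> C q q', OF \<psi>(1) q_C\<psi> \<psi>_match[OF deriv(1)], folded \<psi>_C']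
    show "sgn (poly q y) = sgn (poly q' (\<psi> y))"
    proof (cases "y \<in> C")
      case True
      then show ?thesis
        by (rule q_C\<psi>)
    next
      case False
      then have False': "\<psi> y \<notin> C'"
        using \<psi>(1) by (auto simp: \<psi>_C' strict_mono_eq)
      consider "\<not> left_end_opposite q C y" | "\<not> right_end_agrees q C y"
        | "left_end_opposite q C y" "right_end_agrees q C y"
        by blast
      then show ?thesis
      proof cases
        case 1
        then show ?thesis
          using sgn_if_left_end_not_opposite[OF gap False]
            sgn_if_left_end_not_opposite[OF gap' False'] transport deriv_y by simp
      next
        case 2
        then show ?thesis
          using sgn_if_right_end_not_agrees[OF gap False]
            sgn_if_right_end_not_agrees[OF gap' False'] transport deriv_y by simp
      next
        case 3
        then obtain z where z: "same_gap C y z" "poly q z = 0"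
          using root_in_gap[OF gap False] by blast
        have "z \<notin> C"
          using z(1) False unfolding same_gap_def by (metis less_irrefl linorder_neqE)
        have "\<psi> z = f z"
          using z by (intro \<psi>(3)) (simp add: S_def)
        then have z': "poly q' (\<psi> z) = 0"
          using f_root \<open>z \<notin> C\<close> z by simp
        have gap_\<psi>: "same_gap C' (\<psi> y) (\<psi> z)"
          using z(1) \<psi>(1) by (simp add: \<psi>_C' same_gap_image)
        have "sgn (poly q' (\<psi> y)) = sgn (poly (pderiv q') (\<psi> y)) * sgn (\<psi> y - \<psi> z)"
          by (rule sgn_in_gap_of_root[OF gap' gap_\<psi> z'])
        moreover have "sgn (\<psi> y - \<psi> z) = sgn (y - z)"
          by (auto simp: sgn_if strict_mono_less[OF \<psi>(1)] strict_mono_eq[OF \<psi>(1)])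
        ultimately show ?thesis
          using sgn_in_gap_of_root[OF gap z] deriv_y by simp
      qed
    qed
  qed
  then show ?thesis
    using \<psi> \<psi>_match by blast
qed

end

section \<open>Sign diagrams depend on finitely many signs\<close>

locale sign_elimination = polynomial_ivt field_type + coefficient_ring R
  for field_type :: "'a::linordered_field itself" and R :: "('e \<Rightarrow> 'a) set"
begin

text \<open>A sign diagram is encoded without listing the roots: two diagrams agree iff some increasing bijection
  of the field carries the signs of one family to those of the other.\<close>

definition signs_determined :: "('e \<Rightarrow> 'a poly) set \<Rightarrow> bool" where
  "signs_determined F \<longleftrightarrow> (\<exists>G\<subseteq>R. finite G \<and> (\<forall>e e'. (\<forall>g\<in>G. sgn (g e) = sgn (g e')) \<longrightarrow>
     (\<exists>\<phi>. strict_mono \<phi> \<and> surj \<phi> \<and> (\<forall>p\<in>F. same_signs \<phi> (p e) (p e')))))"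

lemma signs_determinedE:
  assumes "signs_determined F"
  obtains G where "G \<subseteq> R" "finite G" "\<And>e e'. \<forall>g\<in>G. sgn (g e) = sgn (g e') \<Longrightarrow>
     \<exists>\<phi>. strict_mono \<phi> \<and> surj \<phi> \<and> (\<forall>p\<in>F. same_signs \<phi> (p e) (p e'))"
proof -
  from assms obtain G where "G \<subseteq> R \<and> finite G \<and> (\<forall>e e'. (\<forall>g\<in>G. sgn (g e) = sgn (g e')) \<longrightarrow>
     (\<exists>\<phi>. strict_mono \<phi> \<and> surj \<phi> \<and> (\<forall>p\<in>F. same_signs \<phi> (p e) (p e'))))"
    unfolding signs_determined_def ..
  note G = conjunct1[OF this] conjunct1[OF conjunct2[OF this]] conjunct2[OF conjunct2[OF this]]
  show thesis
    by (rule that[OF G(1,2) G(3)[THEN spec, THEN spec, THEN mp]])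
qed

text \<open>If the coefficient of degree \<open>d\<close> of \<open>q\<close> vanishes, \<open>q\<close> can be replaced by its truncation. Otherwise match
  \<open>F\<close>, the derivative of \<open>q\<close> and the remainders of \<open>q\<close> modulo the truncations of these polynomials. At a root
  of a polynomial \<open>p\<close> of actual degree \<open>k\<close>, the remainder modulo the truncation of \<open>p\<close> to degree \<open>k\<close>
  determines the sign of \<open>q\<close>, so \<open>same_signs_extend\<close> applies.\<close>

lemma signs_determined_insert:
  assumes F: "finite F" "\<forall>p\<in>F. family (Suc d) p" and q: "family (Suc d) q"
    and IH: "\<And>A. finite A \<Longrightarrow> \<forall>p\<in>A. family d p \<Longrightarrow> signs_determined (A \<union> F)"
  shows "signs_determined (insert q F)"
proof -
  define q0 where "q0 = (\<lambda>e. poly_cutoff d (q e))"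
  have "family d q0"
    unfolding q0_def using q by (rule family_cutoff)
  then have "signs_determined ({q0} \<union> F)"
    by (intro IH) auto
  then obtain G1 where G1: "G1 \<subseteq> R" "finite G1"
    and low: "\<And>e e'. \<forall>g\<in>G1. sgn (g e) = sgn (g e') \<Longrightarrow>
     \<exists>\<phi>. strict_mono \<phi> \<and> surj \<phi> \<and> (\<forall>p\<in>{q0} \<union> F. same_signs \<phi> (p e) (p e'))"
    by (rule signs_determinedE) (rule that)
  define q' where "q' = (\<lambda>e. pderiv (q e))"
  have q': "family d q'"
    unfolding q'_def using q by (rule family_pderiv)
  define P where "P = insert q' F"
  have P: "finite P" "\<forall>p\<in>P. family (Suc d) p"
    using F q' by (auto simp: P_def intro: family_mono)
  have "\<forall>x\<in>P \<times> {..d}. \<exists>r. family (snd x) r \<and> (\<exists>N. \<forall>e c. poly (poly_cutoff (Suc (snd x)) (fst x e)) c = 0 \<longrightarrow>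
      Polynomial.coeff (fst x e) (snd x) ^ N * poly (q e) c = poly (r e) c)"
  proof
    fix x assume "x \<in> P \<times> {..d}"
    then have "family (Suc d) (fst x)"
      using P(2) by auto
    then have "family (Suc (snd x)) (\<lambda>e. poly_cutoff (Suc (snd x)) (fst x e))"
      by (rule family_cutoff)
    from reduction_at_roots[OF q this]
    show "\<exists>r. family (snd x) r \<and> (\<exists>N. \<forall>e c. poly (poly_cutoff (Suc (snd x)) (fst x e)) c = 0 \<longrightarrow>
      Polynomial.coeff (fst x e) (snd x) ^ N * poly (q e) c = poly (r e) c)"
      by (simp add: coeff_poly_cutoff) blast
  qed
  from bchoice[OF this] obtain r where r: "\<forall>x\<in>P \<times> {..d}. family (snd x) (r x) \<and>
      (\<exists>N. \<forall>e c. poly (poly_cutoff (Suc (snd x)) (fst x e)) c = 0 \<longrightarrow>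
      Polynomial.coeff (fst x e) (snd x) ^ N * poly (q e) c = poly (r x e) c)" ..
  define A where "A = insert q' (r ` (P \<times> {..d}))"
  have "signs_determined (A \<union> F)"
  proof (rule IH)
    show "finite A"
      using P(1) by (simp add: A_def)
    have "family d (r x)" if "x \<in> P \<times> {..d}" for x
      using that bspec[OF r that] by (auto intro: family_mono)
    then show "\<forall>p\<in>A. family d p"
      using q' by (auto simp: A_def)
  qed
  then obtain G2 where G2: "G2 \<subseteq> R" "finite G2"
    and high: "\<And>e e'. \<forall>g\<in>G2. sgn (g e) = sgn (g e') \<Longrightarrow>
     \<exists>\<phi>. strict_mono \<phi> \<and> surj \<phi> \<and> (\<forall>p\<in>A \<union> F. same_signs \<phi> (p e) (p e'))"
    by (rule signs_determinedE) (rule that)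
  \<comment> \<open>The signs of the coefficients ensure that the degrees at \<open>e\<close> and \<open>e'\<close> agree.\<close>
  define G3 where "G3 = (\<lambda>(p, k) e. Polynomial.coeff (p e) k) ` (insert q P \<times> {..d})"
  have "finite G3"
    using P(1) by (simp add: G3_def)
  moreover have "G3 \<subseteq> R"
    using P(2) q by (auto simp: G3_def intro: family_coeff)
  moreover have "\<exists>\<phi>. strict_mono \<phi> \<and> surj \<phi> \<and> (\<forall>p\<in>insert q F. same_signs \<phi> (p e) (p e'))"
    if agree: "\<forall>g\<in>G1 \<union> G2 \<union> G3. sgn (g e) = sgn (g e')" for e e'
  proof -
    have coeff_sgn: "sgn (Polynomial.coeff (p e) k) = sgn (Polynomial.coeff (p e') k)"
      if "p \<in> insert q P" "k \<le> d" for p k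
    proof -
      have "(\<lambda>e. Polynomial.coeff (p e) k) \<in> G3"
        unfolding G3_def using that by (intro image_eqI[of _ _ "(p, k)"]) auto
      then show ?thesis
        using bspec[OF agree, of "\<lambda>e. Polynomial.coeff (p e) k"] by simp
    qed
    show ?thesis
    proof (cases "Polynomial.coeff (q e) d = 0")
      case True
      then have "Polynomial.coeff (q e') d = 0"
        using coeff_sgn[of q d] by (simp add: sgn_0_0)
      moreover have "Polynomial.coeff (q e) i = 0" if "d < i" for e i
        using q that by (simp add: family_def)
      ultimately have "q e = q0 e" "q e' = q0 e'"
        using True by (auto simp: q0_def poly_eq_iff coeff_poly_cutoff not_less le_eq_less_or_eq)
      moreover have "\<forall>g\<in>G1. sgn (g e) = sgn (g e')"
        using agree by blast
      ultimately show ?thesis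
        using low[of e e'] by auto
    next
      case False
      have "\<forall>g\<in>G2. sgn (g e) = sgn (g e')"
        using agree by blast
      from high[OF this] obtain \<phi>
        where \<phi>: "strict_mono \<phi>" "surj \<phi>" "\<forall>p\<in>A \<union> F. same_signs \<phi> (p e) (p e')"
        by blast
      show ?thesis
      proof (cases "d = 0")
        case True
        have const: "q e = [:Polynomial.coeff (q e) 0:]" for e
          using q True by (auto simp: family_def poly_eq_iff coeff_pCons split: nat.split)
        have "poly (q e) y = Polynomial.coeff (q e) 0" for e y
          using arg_cong[OF const[of e], of "\<lambda>p. poly p y"] by simp
        then have "same_signs \<phi> (q e) (q e')"
          using coeff_sgn[of q 0] by (simp add: same_signs_def)
        then show ?thesis
          using \<phi> by blast
      next
        case False
        let ?F = "(\<lambda>p. (p e, p e')) ` P"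
        have at_roots: "sgn (poly (q e) c) = sgn (poly (q e') (\<phi> c))"
          if p: "p \<in> P" "p e \<noteq> 0" "poly (p e) c = 0" for p c
        proof -
          define k where "k = Polynomial.degree (p e)"
          have "family (Suc d) p"
            using P(2) p(1) by blast
          then have k: "k \<le> d"
            using family_degree[of "Suc d" p e] p(2) by (simp add: k_def)
          have cut: "poly_cutoff (Suc k) (p e) = p e"
            by (auto simp: poly_eq_iff coeff_poly_cutoff k_def coeff_eq_0)
          have "Polynomial.coeff (p e') i = 0" if "i > k" for i
          proof (cases "i \<le> d")
            case True
            then show ?thesis
              using coeff_sgn[of p i] p(1) that by (simp add: k_def coeff_eq_0 sgn_0_0)
          next
            case False
            then show ?thesis
              using \<open>family (Suc d) p\<close> by (simp add: family_def)
          qed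
          then have cut': "poly_cutoff (Suc k) (p e') = p e'"
            by (auto simp: poly_eq_iff coeff_poly_cutoff)
          have "(p, k) \<in> P \<times> {..d}"
            using p(1) k by simp
          from bspec[OF r this] obtain N where N: "\<And>e c. poly (poly_cutoff (Suc k) (p e)) c = 0 \<Longrightarrow>
              Polynomial.coeff (p e) k ^ N * poly (q e) c = poly (r (p, k) e) c"
            by auto
          have "same_signs \<phi> (p e) (p e')"
            using \<phi>(3) p(1) by (auto simp: P_def A_def)
          then have root': "poly (p e') (\<phi> c) = 0"
            using p(3) unfolding same_signs_def by (metis sgn_0_0)
          have "r (p, k) \<in> A"
            unfolding A_def using \<open>(p, k) \<in> P \<times> {..d}\<close> by blast
          then have "same_signs \<phi> (r (p, k) e) (r (p, k) e')"
            using \<phi>(3) by blast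
          then have "sgn (Polynomial.coeff (p e) k ^ N * poly (q e) c) =
              sgn (Polynomial.coeff (p e') k ^ N * poly (q e') (\<phi> c))"
            using N[of e c] N[of e' "\<phi> c"] cut cut' p(3) root' by (simp add: same_signs_def)
          moreover have "sgn (Polynomial.coeff (p e) k) \<noteq> 0"
            using p(2) by (simp add: k_def sgn_0_0)
          ultimately show ?thesis
            using coeff_sgn[of p k] p(1) k by (simp add: sgn_mult)
        qed
        have "\<exists>\<psi>. strict_mono \<psi> \<and> surj \<psi> \<and> (\<forall>(p, p')\<in>insert (q e, q e') ?F. same_signs \<psi> p p')"
        proof (rule same_signs_extend[OF _ \<phi>(1,2)])
          show "finite ?F"
            using P(1) by simp
          show "(pderiv (q e), pderiv (q e')) \<in> ?F"
            by (auto simp: P_def q'_def)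
          have "Polynomial.degree (q e) \<noteq> 0"
            using \<open>Polynomial.coeff (q e) d \<noteq> 0\<close> \<open>d \<noteq> 0\<close> le_degree[of "q e" d] by auto
          then show "pderiv (q e) \<noteq> 0"
            by (simp add: pderiv_eq_0_iff)
        next
          fix p p' assume "(p, p') \<in> ?F"
          then show "same_signs \<phi> p p'"
            using \<phi>(3) by (auto simp: P_def A_def)
        next
          fix p p' c assume "(p, p') \<in> ?F" "p \<noteq> 0" "poly p c = 0"
          then show "sgn (poly (q e) c) = sgn (poly (q e') (\<phi> c))"
            using at_roots by auto
        qed
        then show ?thesis
          by (auto simp: P_def)
      qed
    qed
  qed
  ultimately show ?thesis
    unfolding signs_determined_def using G1 G2
    by (intro exI[of _ "G1 \<union> G2 \<union> G3"]) simp
qed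

text \<open>Polynomials of the top degree are added one at a time; the auxiliary ones created by each step have
  smaller degree, which is why the inner induction lets the set \<open>A\<close> vary.\<close>

lemma signs_determined: "finite F \<Longrightarrow> \<forall>p\<in>F. family d p \<Longrightarrow> signs_determined F"
proof (induction d arbitrary: F)
  case 0
  then have zero: "p e = 0" if "p \<in> F" for p e
    using that by (auto simp: family_def poly_eq_iff)
  have "\<forall>p\<in>F. same_signs (\<lambda>x. x) (p e) (p e')" for e e'
    by (intro ballI) (simp only: zero same_signs_def simp_thms)
  then have "strict_mono (\<lambda>x. x) \<and> surj (\<lambda>x. x) \<and> (\<forall>p\<in>F. same_signs (\<lambda>x. x) (p e) (p e'))" for e e'
    by (simp add: strict_mono_def)
  then show ?case
    unfolding signs_determined_def by (intro exI[of _ "{}"] conjI allI impI) auto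
next
  case (Suc d)
  have "signs_determined (A \<union> B)"
    if "finite B" "\<forall>p\<in>B. family (Suc d) p" "finite A" "\<forall>p\<in>A. family d p" for A B
    using that
  proof (induction B arbitrary: A rule: finite_induct)
    case empty
    then show ?case
      using Suc.IH[of A] by simp
  next
    case (insert q B)
    have "signs_determined (insert q (A \<union> B))"
    proof (rule signs_determined_insert)
      show "\<forall>p\<in>A \<union> B. family (Suc d) p"
        using insert.prems by (auto intro: family_mono)
      fix A' assume "finite A'" "\<forall>p\<in>A'. family d p"
      then have "signs_determined ((A' \<union> A) \<union> B)"
        using insert.prems by (intro insert.IH) auto
      then show "signs_determined (A' \<union> (A \<union> B))"
        by (simp add: Un_assoc)
    qed (use insert in auto)
    then show ?case
      by simp
  qed
  from this[of F "{}"] show ?case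
    using Suc.prems by simp
qed

theorem matching_sgn: "matching (\<lambda>x y. sgn x = sgn y)"
  unfolding matching_def
proof (intro allI impI)
  fix F assume F: "finite F" "\<forall>p\<in>F. \<exists>m. family m p"
  then obtain m where "\<forall>p\<in>F. family m p"
    by (rule finite_family_bound)
  with F(1) have "signs_determined F"
    by (rule signs_determined)
  then obtain G where G: "G \<subseteq> R" "finite G" "\<And>e e'. \<forall>g\<in>G. sgn (g e) = sgn (g e') \<Longrightarrow>
     \<exists>\<phi>. strict_mono \<phi> \<and> surj \<phi> \<and> (\<forall>p\<in>F. same_signs \<phi> (p e) (p e'))"
    by (rule signs_determinedE) (rule that)
  have "\<forall>y. \<exists>y'. \<forall>p\<in>F. sgn (poly (p e) y) = sgn (poly (p e') y')"
    if "\<forall>g\<in>G. sgn (g e) = sgn (g e')" for e e'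
    using G(3)[OF that] unfolding same_signs_def by metis
  then show "\<exists>G\<subseteq>R. finite G \<and> (\<forall>e e'. (\<forall>g\<in>G. sgn (g e) = sgn (g e')) \<longrightarrow>
      (\<forall>y. \<exists>y'. \<forall>p\<in>F. sgn (poly (p e) y) = sgn (poly (p e') y')))"
    using G(1,2) by (intro exI[of _ G]) simp
qed

end

section \<open>The intermediate value property from the Artin--Schreier axioms\<close>

text \<open>The logarithmic derivative of \<open>\<Prod>(1 - z\<^sub>i T)\<close> is \<open>- \<Sum> z\<^sub>i / (1 - z\<^sub>i T)\<close>, the negative of the generating
  function of the power sums.\<close>

lemma newton_identity:
  fixes z :: "'i \<Rightarrow> 'b::field_char_0"
  assumes "finite I"
  defines "P \<equiv> (\<lambda>I. Abs_fps (\<lambda>m. \<Sum>i\<in>I. z i ^ Suc m))"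
  shows "fps_deriv (\<Prod>i\<in>I. 1 - fps_const (z i) * fps_X) =
    - (P I * (\<Prod>i\<in>I. 1 - fps_const (z i) * fps_X))"
  using assms(1)
proof (induction I rule: finite_induct)
  case empty
  have "P {} = 0"
    by (simp add: P_def fps_eq_iff)
  then show ?case
    by simp
next
  case (insert j I)
  let ?F = "\<Prod>i\<in>I. 1 - fps_const (z i) * fps_X"
  define Q where "Q = Abs_fps (\<lambda>m. z j ^ Suc m)"
  have Q: "Q * (1 - fps_const (z j) * fps_X) = fps_const (z j)"
  proof (rule fps_ext)
    fix m
    have "fps_nth (Q * (1 - fps_const (z j) * fps_X)) m =
        fps_nth Q m - z j * fps_nth (Q * fps_X) m"
      by (simp add: right_diff_distrib mult.left_commute[of Q])
    then show "fps_nth (Q * (1 - fps_const (z j) * fps_X)) m = fps_nth (fps_const (z j)) m"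
      by (cases m) (simp_all add: Q_def)
  qed
  have PQ: "P (insert j I) = Q + P I"
    using insert.hyps by (simp add: P_def Q_def fps_eq_iff)
  have ring_identity: "- (a * b) * c - b * (d * c) = - ((a + d) * (b * c))" for a b c d :: "'b fps"
    by (simp add: algebra_simps)
  have "fps_deriv ((1 - fps_const (z j) * fps_X) * ?F) =
      - fps_const (z j) * ?F - (1 - fps_const (z j) * fps_X) * (P I * ?F)"
    using insert.IH by simp
  also have "\<dots> = - (Q * (1 - fps_const (z j) * fps_X)) * ?F -
      (1 - fps_const (z j) * fps_X) * (P I * ?F)"
    by (simp only: Q)
  also have "\<dots> = - ((Q + P I) * ((1 - fps_const (z j) * fps_X) * ?F))"
    by (rule ring_identity)
  finally show ?case
    using insert.hyps by (simp add: PQ)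
qed

lemma prod_one_minus_nth_0:
  fixes z :: "'i \<Rightarrow> 'b::field_char_0"
  shows "fps_nth (\<Prod>i\<in>I. 1 - fps_const (z i) * fps_X) 0 = 1"
  by (induction I rule: infinite_finite_induct) auto

locale char_0_subfield =
  fixes L :: "'b::field_char_0 set"
  assumes zero_mem: "0 \<in> L" and one_mem: "1 \<in> L"
    and add_mem: "x \<in> L \<Longrightarrow> y \<in> L \<Longrightarrow> x + y \<in> L"
    and minus_mem: "x \<in> L \<Longrightarrow> - x \<in> L"
    and mult_mem: "x \<in> L \<Longrightarrow> y \<in> L \<Longrightarrow> x * y \<in> L"
    and inverse_mem: "x \<in> L \<Longrightarrow> inverse x \<in> L"
begin

lemma diff_mem: "x \<in> L \<Longrightarrow> y \<in> L \<Longrightarrow> x - y \<in> L"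
  using add_mem[of x "- y"] minus_mem[of y] by simp

lemma of_nat_mem: "of_nat n \<in> L"
  by (induction n) (auto intro: zero_mem one_mem add_mem)

lemma sum_mem: "(\<And>i. i \<in> I \<Longrightarrow> f i \<in> L) \<Longrightarrow> sum f I \<in> L"
  by (induction I rule: infinite_finite_induct) (auto intro: zero_mem add_mem)

lemma of_nat_mult_memD:
  assumes "of_nat (Suc n) * x \<in> L"
  shows "x \<in> L"
proof -
  have "x = inverse (of_nat (Suc n)) * (of_nat (Suc n) * x)"
    by (simp del: of_nat_Suc)
  then show ?thesis
    using assms mult_mem inverse_mem of_nat_mem by metis
qed

lemma power_sums_in_subfield:
  assumes I: "finite I"
    and coeffs: "\<And>k. Polynomial.coeff (\<Prod>i\<in>I. [:- z i, 1:]) k \<in> L"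
  shows "(\<Sum>i\<in>I. z i ^ m) \<in> L"
proof (cases m)
  case 0
  then show ?thesis
    by (simp add: of_nat_mem)
next
  case (Suc m')
  let ?p = "\<Prod>i\<in>I. [:- z i, 1:]"
  define F where "F = (\<Prod>i\<in>I. 1 - fps_const (z i) * fps_X)"
  define P where "P = Abs_fps (\<lambda>m. \<Sum>i\<in>I. z i ^ Suc m)"
  have "reflect_poly [:- w, 1:] = [:1, - w:]" for w :: 'b
    by (simp add: reflect_poly_pCons' monom_altdef)
  then have "F = fps_of_poly (reflect_poly ?p)"
    by (simp add: F_def reflect_poly_prod fps_of_poly_prod fps_of_poly_linear' flip: fps_const_neg)
  then have F: "fps_nth F k \<in> L" for k
    using coeffs by (simp add: coeff_reflect_poly zero_mem)
  have F0: "fps_nth F 0 = 1"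
    by (simp add: F_def prod_one_minus_nth_0)
  have newton: "fps_deriv F = - (P * F)"
    unfolding F_def P_def by (rule newton_identity[OF I])
  have "fps_nth P k \<in> L" for k
  proof (induction k rule: less_induct)
    case (less k)
    have "fps_nth (P * F) k = (\<Sum>i<k. fps_nth P i * fps_nth F (k - i)) + fps_nth P k"
      by (simp add: fps_mult_nth F0 atLeast0AtMost lessThan_Suc_atMost[symmetric])
    then have "fps_nth P k = - fps_nth (fps_deriv F) k - (\<Sum>i<k. fps_nth P i * fps_nth F (k - i))"
      by (simp add: newton)
    also have "\<dots> \<in> L"
      using less F by (auto simp del: of_nat_Suc intro!: diff_mem minus_mem sum_mem mult_mem
          of_nat_mem simp flip: of_nat_Suc)
    finally show ?case .
  qed
  from this[of m'] show ?thesis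
    by (simp add: P_def Suc)
qed

text \<open>In characteristic \<open>0\<close> Newton's identity can be read in both directions, so a monic polynomial has
  coefficients in a subfield iff all power sums of its roots lie there. This replaces the theorem on
  symmetric polynomials in Laplace's argument.\<close>

lemma coeffs_in_subfield:
  assumes I: "finite I" and power_sums: "\<And>m. (\<Sum>i\<in>I. z i ^ m) \<in> L"
  shows "Polynomial.coeff (\<Prod>i\<in>I. [:- z i, 1:]) k \<in> L"
proof -
  let ?p = "\<Prod>i\<in>I. [:- z i, 1:]"
  define F where "F = (\<Prod>i\<in>I. 1 - fps_const (z i) * fps_X)"
  define P where "P = Abs_fps (\<lambda>m. \<Sum>i\<in>I. z i ^ Suc m)"
  have "reflect_poly [:- w, 1:] = [:1, - w:]" for w :: 'b
    by (simp add: reflect_poly_pCons' monom_altdef)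
  then have F_reflect: "F = fps_of_poly (reflect_poly ?p)"
    by (simp add: F_def reflect_poly_prod fps_of_poly_prod fps_of_poly_linear' flip: fps_const_neg)
  have newton: "fps_deriv F = - (P * F)"
    unfolding F_def P_def by (rule newton_identity[OF I])
  have P: "fps_nth P i \<in> L" for i
    using power_sums[of "Suc i"] by (simp add: P_def)
  have "fps_nth F j \<in> L" for j
  proof (induction j rule: less_induct)
    case (less j)
    show ?case
    proof (cases j)
      case 0
      then show ?thesis
        by (simp add: F_def prod_one_minus_nth_0 one_mem)
    next
      case (Suc j')
      have "of_nat (Suc j') * fps_nth F (Suc j') = - (\<Sum>i=0..j'. fps_nth P i * fps_nth F (j' - i))"
        using arg_cong[OF newton, of "\<lambda>f. fps_nth f j'"] by (simp add: fps_mult_nth)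
      also have "\<dots> \<in> L"
        using P less Suc by (intro minus_mem sum_mem mult_mem) auto
      finally show ?thesis
        unfolding Suc by (rule of_nat_mult_memD)
    qed
  qed
  then have F: "Polynomial.coeff (reflect_poly ?p) j \<in> L" for j
    by (simp add: F_reflect)
  show ?thesis
  proof (cases "k \<le> Polynomial.degree ?p")
    case True
    then have "Polynomial.coeff ?p k = Polynomial.coeff (reflect_poly ?p) (Polynomial.degree ?p - k)"
      by (simp add: coeff_reflect_poly)
    then show ?thesis
      using F by simp
  next
    case False
    then show ?thesis
      by (simp add: coeff_eq_0 zero_mem)
  qed
qed

lemma coeff_mult_in_subfield:
  "(\<And>k. Polynomial.coeff p k \<in> L) \<Longrightarrow> (\<And>k. Polynomial.coeff q k \<in> L) \<Longrightarrow> Polynomial.coeff (p * q) k \<in> L"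
  unfolding coeff_mult by (intro sum_mem mult_mem)

lemma coeff_power_in_subfield:
  "(\<And>k. Polynomial.coeff p k \<in> L) \<Longrightarrow> Polynomial.coeff (p ^ n) k \<in> L"
  by (induction n arbitrary: k) (auto simp: coeff_pCons zero_mem one_mem split: nat.split intro: coeff_mult_in_subfield)

lemma sum_poly_in_subfield:
  assumes "\<And>m. (\<Sum>i\<in>I. z i ^ m) \<in> L" "\<And>k. Polynomial.coeff q k \<in> L"
  shows "(\<Sum>i\<in>I. poly q (z i)) \<in> L"
proof -
  have "(\<Sum>i\<in>I. poly q (z i)) = (\<Sum>i\<in>I. \<Sum>k\<le>Polynomial.degree q. Polynomial.coeff q k * z i ^ k)"
    by (simp add: poly_altdef)
  also have "\<dots> = (\<Sum>k\<le>Polynomial.degree q. Polynomial.coeff q k * (\<Sum>i\<in>I. z i ^ k))"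
    by (subst sum.swap) (simp add: sum_distrib_left)
  also have "\<dots> \<in> L"
    by (rule sum_mem) (intro mult_mem assms)
  finally show ?thesis .
qed

text \<open>Summed over all pairs \<open>(i, j)\<close>, the power \<open>w i j ^ m\<close> is a polynomial in the power sums of \<open>z\<close>. Removing the
  diagonal and using symmetry leaves twice the sum over \<open>i < j\<close>.\<close>

lemma pair_power_sums_in_subfield:
  fixes z :: "nat \<Rightarrow> 'b" and t n :: nat
  assumes power_sums: "\<And>m. (\<Sum>i<n. z i ^ m) \<in> L"
  defines "w \<equiv> (\<lambda>i j. z i + z j + of_nat t * z i * z j)"
  shows "(\<Sum>(i, j)\<in>{(i, j). i < j \<and> j < n}. w i j ^ m) \<in> L"
proof -
  let ?J = "{(i, j). i < j \<and> j < n}"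
  define q where "q = (\<lambda>l. [:0, 1:] ^ (m - l) * [:1, of_nat t:] ^ l :: 'b poly)"
  have X: "Polynomial.coeff [:0, 1:] k \<in> L" and T: "Polynomial.coeff [:1, of_nat t:] k \<in> L"
    and D: "Polynomial.coeff [:0, 2, of_nat t:] k \<in> L" for k
    using zero_mem one_mem of_nat_mem[of t] of_nat_mem[of 2]
    by (auto simp: coeff_pCons split: nat.split)
  have "w i j ^ m = (\<Sum>l\<le>m. of_nat (m choose l) * poly (q l) (z i) * z j ^ l)" for i j
  proof -
    have "w i j = z j * (1 + of_nat t * z i) + z i"
      by (simp add: w_def algebra_simps)
    then show ?thesis
      by (simp add: binomial_ring q_def power_mult_distrib mult_ac)
  qed
  then have "(\<Sum>i<n. \<Sum>j<n. w i j ^ m) =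
      (\<Sum>i<n. \<Sum>j<n. \<Sum>l\<le>m. of_nat (m choose l) * poly (q l) (z i) * z j ^ l)"
    by simp
  also have "\<dots> = (\<Sum>i<n. \<Sum>l\<le>m. \<Sum>j<n. of_nat (m choose l) * poly (q l) (z i) * z j ^ l)"
    by (intro sum.cong refl sum.swap)
  also have "\<dots> = (\<Sum>l\<le>m. \<Sum>i<n. \<Sum>j<n. of_nat (m choose l) * poly (q l) (z i) * z j ^ l)"
    by (rule sum.swap)
  also have "\<dots> = (\<Sum>l\<le>m. of_nat (m choose l) * ((\<Sum>i<n. poly (q l) (z i)) * (\<Sum>j<n. z j ^ l)))"
    by (simp only: sum_product) (simp add: sum_distrib_left mult.assoc)
  also have "\<dots> \<in> L"
    unfolding q_def
    by (rule sum_mem) (intro mult_mem of_nat_mem power_sums sum_poly_in_subfield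
        coeff_mult_in_subfield coeff_power_in_subfield X T)
  finally have full: "(\<Sum>i<n. \<Sum>j<n. w i j ^ m) \<in> L" .
  have "(\<Sum>i<n. w i i ^ m) = (\<Sum>i<n. poly ([:0, 2, of_nat t:] ^ m) (z i))"
    by (simp add: w_def algebra_simps)
  also have "\<dots> \<in> L"
    using power_sums D by (intro sum_poly_in_subfield coeff_power_in_subfield)
  finally have diag: "(\<Sum>i<n. w i i ^ m) \<in> L" .
  let ?f = "\<lambda>(i, j). w i j ^ m"
  let ?J' = "{(i, j). j < i \<and> i < n}" and ?D = "{(i, j). i = j \<and> i < n}"
  have fin: "finite ?J" "finite ?J'" "finite ?D"
    by (rule finite_subset[of _ "{..<n} \<times> {..<n}"]; force)+
  have "(\<Sum>i<n. \<Sum>j<n. w i j ^ m) = sum ?f ({..<n} \<times> {..<n})"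
    by (simp add: sum.cartesian_product)
  also have "{..<n} \<times> {..<n} = (?J \<union> ?J') \<union> ?D"
    by auto
  also have "sum ?f \<dots> = sum ?f (?J \<union> ?J') + sum ?f ?D"
    using fin by (intro sum.union_disjoint) auto
  also have "sum ?f (?J \<union> ?J') = sum ?f ?J + sum ?f ?J'"
    using fin by (intro sum.union_disjoint) auto
  also have "sum ?f ?J' = sum ?f ?J"
    by (rule sum.reindex_bij_witness[of _ "\<lambda>(i, j). (j, i)" "\<lambda>(i, j). (j, i)"])
       (auto simp: w_def algebra_simps)
  also have "sum ?f ?D = (\<Sum>i<n. w i i ^ m)"
    by (rule sum.reindex_bij_witness[of _ "\<lambda>i. (i, i)" fst]) auto
  finally have "of_nat (Suc 1) * sum ?f ?J = (\<Sum>i<n. \<Sum>j<n. w i j ^ m) - (\<Sum>i<n. w i i ^ m)"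
    by simp
  also have "\<dots> \<in> L"
    using full diag by (rule diff_mem)
  finally show ?thesis
    by (rule of_nat_mult_memD)
qed

end


lemma char_0_subfield_range_to_ac: "char_0_subfield (range (to_ac :: 'a::field_char_0 \<Rightarrow> 'a alg_closure))"
proof
  show "0 \<in> range (to_ac :: 'a \<Rightarrow> _)" "1 \<in> range (to_ac :: 'a \<Rightarrow> _)"
    by (metis rangeI to_ac_0, metis rangeI to_ac_1)
qed (auto simp flip: to_ac_add to_ac_minus to_ac_mult to_ac_inverse)

lemma map_poly_to_ac_mult: "map_poly to_ac (p * q) = map_poly to_ac p * map_poly to_ac q"
  by (intro poly_eqI) (simp add: coeff_map_poly coeff_mult to_ac_sum)

lemma map_poly_to_ac_add: "map_poly to_ac (p + q) = map_poly to_ac p + map_poly to_ac q"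
  by (intro poly_eqI) (simp add: coeff_map_poly)

lemma poly_map_poly_to_ac: "poly (map_poly to_ac p) (to_ac x) = to_ac (poly p x)"
  by (induction p) (simp_all add: map_poly_pCons)

lemma map_poly_to_ac_preimage:
  assumes "\<And>k. Polynomial.coeff p k \<in> range to_ac"
  shows "\<exists>q. map_poly to_ac q = p"
proof -
  have "map_poly to_ac (map_poly of_ac p) = p"
    using assms by (intro poly_eqI) (simp add: coeff_map_poly to_ac_of_ac)
  then show ?thesis ..
qed

locale artin_schreier =
  fixes field_type :: "'a::linordered_field itself"
  assumes square_root: "\<And>x::'a. 0 \<le> x \<Longrightarrow> \<exists>y. x = y * y"
    and odd_root: "\<And>p::'a poly. odd (Polynomial.degree p) \<Longrightarrow> \<exists>x. poly p x = 0"
begin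

definition imag_unit :: "'a alg_closure" where
  "imag_unit = (SOME i. i ^ 2 = - 1)"

lemma imag_unit_square: "imag_unit * imag_unit = - 1"
proof -
  have "\<exists>i::'a alg_closure. i ^ 2 = - 1"
    by (rule nth_root_exists) simp
  from someI_ex[OF this] show ?thesis
    by (simp add: imag_unit_def power2_eq_square)
qed

text \<open>The subfield \<open>K(i)\<close> of the algebraic closure of \<open>K\<close>.\<close>

definition gaussian :: "'a alg_closure set" where
  "gaussian = {to_ac a + to_ac b * imag_unit |a b. True}"

lemma gaussianI: "to_ac a + to_ac b * imag_unit \<in> gaussian"
  by (auto simp: gaussian_def)

lemma to_ac_gaussian: "to_ac a \<in> gaussian"
  using gaussianI[of a 0] by simp

lemma gaussian_add: "x \<in> gaussian \<Longrightarrow> y \<in> gaussian \<Longrightarrow> x + y \<in> gaussian"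
proof -
  assume "x \<in> gaussian" "y \<in> gaussian"
  then obtain a b c d where "x = to_ac a + to_ac b * imag_unit" "y = to_ac c + to_ac d * imag_unit"
    by (auto simp: gaussian_def)
  then have "x + y = to_ac (a + c) + to_ac (b + d) * imag_unit"
    by (simp add: algebra_simps)
  then show ?thesis
    using gaussianI by metis
qed

lemma gaussian_mult: "x \<in> gaussian \<Longrightarrow> y \<in> gaussian \<Longrightarrow> x * y \<in> gaussian"
proof -
  assume "x \<in> gaussian" "y \<in> gaussian"
  then obtain a b c d where xy: "x = to_ac a + to_ac b * imag_unit" "y = to_ac c + to_ac d * imag_unit"
    by (auto simp: gaussian_def)
  have "x * y = to_ac a * to_ac c + to_ac b * to_ac d * (imag_unit * imag_unit) +
      (to_ac a * to_ac d + to_ac b * to_ac c) * imag_unit"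
    unfolding xy by (simp add: algebra_simps)
  then have "x * y = to_ac (a * c - b * d) + to_ac (a * d + b * c) * imag_unit"
    by (simp add: imag_unit_square)
  then show ?thesis
    using gaussianI by metis
qed

lemma gaussian_diff: "x \<in> gaussian \<Longrightarrow> y \<in> gaussian \<Longrightarrow> x - y \<in> gaussian"
  using gaussian_add[of x "to_ac (- 1) * y"] gaussian_mult[OF to_ac_gaussian[of "- 1"], of y] by simp

text \<open>For \<open>b \<noteq> 0\<close> the usual formula: with \<open>r = sqrt (a\<^sup>2 + b\<^sup>2)\<close>, the real part of the root is
  \<open>sqrt ((r + a) / 2)\<close>.\<close>

lemma gaussian_square_root:
  assumes "x \<in> gaussian"
  shows "\<exists>y\<in>gaussian. x = y * y"
proof -
  obtain a b where x: "x = to_ac a + to_ac b * imag_unit"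
    using assms by (auto simp: gaussian_def)
  have sq: "(to_ac c + to_ac d * imag_unit) * (to_ac c + to_ac d * imag_unit) =
      to_ac (c * c - d * d) + to_ac (2 * c * d) * imag_unit" for c d
  proof -
    have "(to_ac c + to_ac d * imag_unit) * (to_ac c + to_ac d * imag_unit) =
        to_ac c * to_ac c + to_ac d * to_ac d * (imag_unit * imag_unit) + 2 * to_ac c * to_ac d * imag_unit"
      by (simp add: algebra_simps)
    then show ?thesis
      by (simp add: imag_unit_square)
  qed
  have "\<exists>c d. a = c * c - d * d \<and> b = 2 * c * d"
  proof (cases "b = 0")
    case True
    show ?thesis
    proof (cases "a \<ge> 0")
      case True
      then obtain c where "a = c * c"
        using square_root by blast
      then show ?thesis
        using \<open>b = 0\<close> by (intro exI[of _ c] exI[of _ 0]) simp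
    next
      case False
      then obtain d where "- a = d * d"
        using square_root[of "- a"] by auto
      then show ?thesis
        using \<open>b = 0\<close> by (intro exI[of _ 0] exI[of _ d]) simp
    qed
  next
    case False
    obtain r0 where r0: "a * a + b * b = r0 * r0"
      using square_root[of "a * a + b * b"] by auto
    define r where "r = \<bar>r0\<bar>"
    have r: "a * a + b * b = r * r" "r \<ge> 0"
      using r0 by (simp_all add: r_def)
    have "\<bar>a\<bar> < r"
    proof (rule ccontr)
      assume "\<not> \<bar>a\<bar> < r"
      then have "r * r \<le> \<bar>a\<bar> * \<bar>a\<bar>"
        using r(2) by (intro mult_mono) auto
      then have "b * b \<le> 0"
        using r(1) by simp
      then show False
        using False by (metis mult_eq_0_iff not_square_less_zero order.order_iff_strict)
    qed
    then have pos: "(r + a) / 2 > 0"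
      by (simp add: abs_less_iff)
    then obtain c where c: "(r + a) / 2 = c * c"
      using square_root[of "(r + a) / 2"] by auto
    then have "c \<noteq> 0"
      using pos by auto
    have "b * b = (r - a) * (r + a)"
      using r(1) by (simp add: algebra_simps)
    also have "\<dots> = (r - a) * (2 * (c * c))"
      using c by (simp add: field_simps)
    finally have "b / (2 * c) * (b / (2 * c)) = (r - a) / 2"
      using \<open>c \<noteq> 0\<close> by (simp add: field_simps)
    then have "a = c * c - b / (2 * c) * (b / (2 * c))"
      using c by (simp add: field_simps)
    moreover have "b = 2 * c * (b / (2 * c))"
      using \<open>c \<noteq> 0\<close> by simp
    ultimately show ?thesis
      by blast
  qed
  then obtain c d where "a = c * c - d * d" "b = 2 * c * d"
    by blast
  then show ?thesis
    using sq[of c d] gaussianI[of c d] by (intro bexI[of _ "to_ac c + to_ac d * imag_unit"]) (simp_all add: x)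
qed

lemma gaussian_quadratic:
  assumes "z + w \<in> gaussian" "z * w \<in> gaussian"
  shows "z \<in> gaussian"
proof -
  have "(z + w) * (z + w) - to_ac 4 * (z * w) \<in> gaussian"
    using gaussian_diff[OF gaussian_mult[OF assms(1,1)] gaussian_mult[OF to_ac_gaussian assms(2)]] .
  moreover have "(z + w) * (z + w) - to_ac 4 * (z * w) = (z - w) * (z - w)"
    by (simp add: algebra_simps)
  ultimately obtain s where s: "s \<in> gaussian" "(z - w) * (z - w) = s * s"
    using gaussian_square_root by metis
  then have "(z - w - s) * (z - w + s) = 0"
    by (simp add: algebra_simps)
  then have "z - w = s \<or> z - w = to_ac (- 1) * s"
    by (auto simp: eq_neg_iff_add_eq_0)
  then have "z - w \<in> gaussian"
    using s(1) gaussian_mult to_ac_gaussian by metis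
  then have "to_ac (1 / 2) * ((z + w) + (z - w)) \<in> gaussian"
    using gaussian_mult[OF to_ac_gaussian gaussian_add[OF assms(1)]] by blast
  moreover have "to_ac (1 / 2) * ((z + w) + (z - w)) = z"
    by simp
  ultimately show ?thesis
    by simp
qed

lemma card_pairs: "card {(i, j). i < j \<and> j < n} = n * (n - 1) div 2"
proof -
  have "{(i, j). i < j \<and> j < n} = (SIGMA j:{..<n}. {..<j}) \<inverse>"
    by auto
  then show ?thesis
    by (simp add: Sum_Ico_nat lessThan_atLeast0)
qed

text \<open>Laplace's argument, by induction on the power of \<open>2\<close> in the degree \<open>n\<close>. For every \<open>t\<close> the polynomial with
  roots \<open>z\<^sub>i + z\<^sub>j + t z\<^sub>i z\<^sub>j\<close>, \<open>i < j\<close>, has coefficients in \<open>K\<close>, and its degree \<open>n (n - 1) / 2\<close> contains one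
  factor \<open>2\<close> less. Hence one of these roots lies in \<open>K(i)\<close>. As there are only finitely many pairs, two
  values of \<open>t\<close> yield the same pair, so that \<open>z\<^sub>i + z\<^sub>j\<close> and \<open>z\<^sub>i z\<^sub>j\<close> lie in \<open>K(i)\<close>, and then so does
  \<open>z\<^sub>i\<close>.\<close>

lemma gaussian_root:
  assumes "Polynomial.degree p = 2 ^ k * m" "odd m"
  shows "\<exists>z\<in>gaussian. poly (map_poly to_ac (p :: 'a poly)) z = 0"
  using assms
proof (induction k arbitrary: p m)
  case 0
  then obtain x where "poly p x = 0"
    using odd_root by auto
  then have "poly (map_poly to_ac p) (to_ac x) = 0"
    by (simp add: poly_map_poly_to_ac)
  then show ?case
    using to_ac_gaussian by blast
next
  case (Suc k)
  interpret char_0_subfield "range (to_ac :: 'a \<Rightarrow> _)"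
    by (rule char_0_subfield_range_to_ac)
  define n where "n = Polynomial.degree p"
  have "n \<noteq> 0"
    using Suc.prems by (auto simp: n_def odd_pos)
  define P where "P = map_poly to_ac p"
  have "P \<noteq> 0" "Polynomial.degree P = n"
    using \<open>n \<noteq> 0\<close> by (auto simp: P_def n_def degree_map_poly map_poly_eq_0_iff)
  then obtain A where A: "size A = n" "P = Polynomial.smult (Polynomial.lead_coeff P) (\<Prod>x\<in>#A. [:- x, 1:])"
    using alg_closed_imp_factorization by metis
  obtain xs where xs: "A = mset xs"
    by (metis ex_mset)
  define z where "z = (\<lambda>i. xs ! i)"
  have "(\<Prod>x\<in>#A. [:- x, 1:]) = (\<Prod>i<n. [:- z i, 1:])"
    using A(1) by (simp add: xs z_def prod_mset_prod_list prod.list_conv_set_nth lessThan_atLeast0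
        flip: mset_map)
  then have P: "P = Polynomial.smult (Polynomial.lead_coeff P) (\<Prod>i<n. [:- z i, 1:])"
    using A(2) by simp
  have root: "poly P (z i) = 0" if "i < n" for i
    using that by (subst P) (auto simp: poly_prod intro!: prod_zero)
  have "Polynomial.coeff (\<Prod>i<n. [:- z i, 1:]) l \<in> range to_ac" for l
  proof -
    have "Polynomial.coeff (\<Prod>i<n. [:- z i, 1:]) l = Polynomial.coeff P l * inverse (Polynomial.lead_coeff P)"
      using arg_cong[OF P, of "\<lambda>q. Polynomial.coeff q l"] \<open>P \<noteq> 0\<close> by (simp add: field_simps)
    also have "\<dots> \<in> range to_ac"
      by (intro mult_mem inverse_mem) (simp_all add: P_def coeff_map_poly)
    finally show ?thesis .
  qed
  then have power_sums: "(\<Sum>i<n. z i ^ l) \<in> range to_ac" for l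
    by (intro power_sums_in_subfield) auto
  let ?J = "{(i, j). i < j \<and> j < n}"
  have "finite ?J"
    by (rule finite_subset[of _ "{..<n} \<times> {..<n}"]) auto
  have "\<exists>(i, j)\<in>?J. z i + z j + of_nat t * z i * z j \<in> gaussian" for t :: nat
  proof -
    define w where "w = (\<lambda>(i, j). z i + z j + of_nat t * z i * z j)"
    have "(\<Sum>x\<in>?J. w x ^ l) \<in> range to_ac" for l
      using pair_power_sums_in_subfield[OF power_sums, of t l] by (simp add: w_def case_prod_unfold)
    then have "Polynomial.coeff (\<Prod>x\<in>?J. [:- w x, 1:]) l \<in> range to_ac" for l
      by (rule coeffs_in_subfield[OF \<open>finite ?J\<close>])
    then obtain q where q: "map_poly to_ac q = (\<Prod>x\<in>?J. [:- w x, 1:])"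
      using map_poly_to_ac_preimage by blast
    have "Polynomial.degree q = Polynomial.degree (map_poly to_ac q)"
      by (simp add: degree_map_poly)
    also have "\<dots> = card ?J"
      unfolding q by (subst degree_prod_sum_eq) auto
    also have "\<dots> = 2 ^ k * (m * (n - 1))"
      using Suc.prems(1) by (simp add: card_pairs n_def)
    finally have "Polynomial.degree q = 2 ^ k * (m * (n - 1))" .
    moreover have "odd (m * (n - 1))"
      using Suc.prems \<open>n \<noteq> 0\<close> by (simp add: n_def)
    ultimately obtain y where "y \<in> gaussian" "poly (map_poly to_ac q) y = 0"
      using Suc.IH by blast
    then obtain x where "x \<in> ?J" "y = w x"
      using \<open>finite ?J\<close> by (auto simp: q poly_prod)
    then show ?thesis
      using \<open>y \<in> gaussian\<close> by (auto simp: w_def)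
  qed
  then have "\<forall>t::nat. \<exists>x. x \<in> ?J \<and> z (fst x) + z (snd x) + of_nat t * z (fst x) * z (snd x) \<in> gaussian"
    by fastforce
  from choice[OF this] obtain x where "\<forall>t. x t \<in> ?J \<and>
      z (fst (x t)) + z (snd (x t)) + of_nat t * z (fst (x t)) * z (snd (x t)) \<in> gaussian" ..
  then have x: "\<And>t::nat. x t \<in> ?J"
    "\<And>t. z (fst (x t)) + z (snd (x t)) + of_nat t * z (fst (x t)) * z (snd (x t)) \<in> gaussian"
    by simp_all
  have "\<not> inj x"
  proof
    assume "inj x"
    have "range x \<subseteq> ?J"
      using x(1) by (rule image_subsetI)
    then have "finite (range x)"
      using \<open>finite ?J\<close> by (rule finite_subset)
    then show False
      using range_inj_infinite[OF \<open>inj x\<close>] by simp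
  qed
  then obtain t u where tu: "t \<noteq> u" "x t = x u"
    by (auto simp: inj_def)
  obtain i j where ij: "x t = (i, j)"
    by fastforce
  then have "i < n"
    using x(1)[of t] by auto
  have t: "z i + z j + of_nat t * z i * z j \<in> gaussian"
    and u: "z i + z j + of_nat u * z i * z j \<in> gaussian"
    using x(2)[of t] x(2)[of u] unfolding tu(2)[symmetric] ij by simp_all
  have "to_ac (1 / (of_nat t - of_nat u)) *
      ((z i + z j + of_nat t * z i * z j) - (z i + z j + of_nat u * z i * z j)) \<in> gaussian"
    by (rule gaussian_mult[OF to_ac_gaussian gaussian_diff[OF t u]])
  also have "(z i + z j + of_nat t * z i * z j) - (z i + z j + of_nat u * z i * z j) =
      (of_nat t - of_nat u) * (z i * z j)"
    by (simp add: algebra_simps)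
  also have "to_ac (1 / (of_nat t - of_nat u)) * ((of_nat t - of_nat u) * (z i * z j)) = z i * z j"
    using tu(1) by simp
  finally have prod: "z i * z j \<in> gaussian" .
  have "(z i + z j + of_nat t * z i * z j) - to_ac (of_nat t) * (z i * z j) \<in> gaussian"
    by (rule gaussian_diff[OF t gaussian_mult[OF to_ac_gaussian prod]])
  then have "z i + z j \<in> gaussian"
    by (simp add: mult.assoc)
  then have "z i \<in> gaussian"
    using prod by (rule gaussian_quadratic)
  then show ?case
    using root[OF \<open>i < n\<close>] by (auto simp: P_def)
qed

lemma gaussian_eq_0_iff: "to_ac a + to_ac b * imag_unit = 0 \<longleftrightarrow> a = 0 \<and> b = 0"
proof
  assume "to_ac a + to_ac b * imag_unit = 0"
  then have "(to_ac a + to_ac b * imag_unit) * (to_ac a - to_ac b * imag_unit) = 0"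
    by simp
  then have "to_ac a * to_ac a - to_ac b * to_ac b * (imag_unit * imag_unit) = 0"
    by (simp add: algebra_simps)
  then have "to_ac (a * a + b * b) = 0"
    by (simp add: imag_unit_square)
  then show "a = 0 \<and> b = 0"
    by (simp only: to_ac_eq_0_iff sum_squares_eq_zero_iff)
qed simp

text \<open>A root \<open>u + w i\<close> with \<open>w \<noteq> 0\<close> is also a root of \<open>(Y - u)\<^sup>2 + w\<^sup>2\<close>, which has to divide \<open>p\<close> because the
  remainder is linear with coefficients in \<open>K\<close>.\<close>

lemma linear_or_positive_quadratic_factor:
  fixes p :: "'a poly"
  assumes "Polynomial.degree p > 0"
  shows "(\<exists>u. poly p u = 0) \<or> (\<exists>q. q dvd p \<and> Polynomial.degree q = 2 \<and> (\<forall>x. poly q x > 0))"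
proof -
  obtain k m where "Polynomial.degree p = 2 ^ k * m" "odd m"
    using assms by (metis exists_least_iff multiplicity_decompose' not_less_zero odd_one)
  then obtain z where "z \<in> gaussian" and root: "poly (map_poly to_ac p) z = 0"
    using gaussian_root by blast
  then obtain u w where z: "z = to_ac u + to_ac w * imag_unit"
    by (auto simp: gaussian_def)
  show ?thesis
  proof (cases "w = 0")
    case True
    then have "to_ac (poly p u) = 0"
      using root by (simp add: z poly_map_poly_to_ac)
    then show ?thesis
      by auto
  next
    case False
    define q where "q = [:u * u + w * w, - 2 * u, 1:]"
    have q_val: "poly q x = (x - u) * (x - u) + w * w" for x
      by (simp add: q_def algebra_simps)
    have q_root: "poly (map_poly to_ac q) z = 0"
    proof -
      have "poly (map_poly to_ac q) z = to_ac w * to_ac w * (imag_unit * imag_unit) + to_ac w * to_ac w"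
        by (simp add: q_def z map_poly_pCons algebra_simps)
      then show ?thesis
        by (simp add: imag_unit_square)
    qed
    define r where "r = p mod q"
    have "r = 0 \<or> Polynomial.degree r < 2"
      using degree_mod_less[of q p] by (auto simp: q_def r_def)
    then have r: "r = [:Polynomial.coeff r 0, Polynomial.coeff r 1:]"
      by (auto simp: poly_eq_iff coeff_pCons coeff_eq_0 split: nat.split)
    have "p = q * (p div q) + r"
      by (simp add: r_def)
    then have "poly (map_poly to_ac r) z = 0"
      using root q_root by (metis add_0 map_poly_to_ac_add map_poly_to_ac_mult mult_zero_left poly_add poly_mult)
    then have "to_ac (Polynomial.coeff r 0) + z * to_ac (Polynomial.coeff r 1) = 0"
      by (subst (asm) r) (simp add: map_poly_pCons)
    then have "to_ac (Polynomial.coeff r 0 + u * Polynomial.coeff r 1) +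
        to_ac (w * Polynomial.coeff r 1) * imag_unit = 0"
      by (simp add: z algebra_simps)
    then have "Polynomial.coeff r 1 = 0" "Polynomial.coeff r 0 = 0"
      using False unfolding gaussian_eq_0_iff by auto
    then have "r = 0"
      using r by simp
    then have "q dvd p"
      by (simp add: r_def mod_eq_0_iff_dvd)
    moreover have "poly q x > 0" for x
    proof -
      have "w * w > 0"
        using False by (simp add: zero_less_mult_iff linorder_neq_iff disj_commute)
      then show ?thesis
        by (simp add: q_val add_nonneg_pos)
    qed
    ultimately show ?thesis
      by (intro disjI2 exI[of _ q]) (simp add: q_def)
  qed
qed

text \<open>Splitting off a factor that has the same sign at both ends keeps the change of sign and lowers the
  degree.\<close>

theorem ivt_mult:
  fixes p :: "'a poly"
  assumes "a < b" "poly p a * poly p b < 0"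
  shows "\<exists>c. a < c \<and> c < b \<and> poly p c = 0"
  using assms(2)
proof (induction "Polynomial.degree p" arbitrary: p rule: less_induct)
  case less
  have step: "\<exists>c. a < c \<and> c < b \<and> poly p c = 0"
    if "p = q * g" "Polynomial.degree q > 0" "poly q a * poly q b > 0" for q g
  proof -
    have "g \<noteq> 0" "q \<noteq> 0"
      using that less.prems by auto
    then have "Polynomial.degree g < Polynomial.degree p"
      using that by (simp add: degree_mult_eq)
    moreover have "(poly q a * poly q b) * (poly g a * poly g b) < 0"
      using less.prems that by (simp add: mult_ac)
    then have "poly g a * poly g b < 0"
      using that(3) mult_less_0_iff[of "poly q a * poly q b" "poly g a * poly g b"] by auto
    ultimately show ?thesis
      using less.hyps that(1) by fastforce
  qed
  have "Polynomial.degree p > 0"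
  proof (rule ccontr)
    assume "\<not> ?thesis"
    then obtain c where "p = [:c:]"
      by (auto elim: degree_eq_zeroE)
    then show False
      using less.prems by (simp add: mult_less_0_iff)
  qed
  from linear_or_positive_quadratic_factor[OF this] show ?case
  proof (elim disjE exE conjE)
    fix u assume u: "poly p u = 0"
    then have "u \<noteq> a" "u \<noteq> b"
      using less.prems by auto
    obtain g where g: "p = [:- u, 1:] * g"
      using u by (auto simp: poly_eq_0_iff_dvd dvd_def)
    show ?case
    proof (cases "a < u \<and> u < b")
      case False
      then have "poly [:- u, 1:] a * poly [:- u, 1:] b > 0"
        using \<open>u \<noteq> a\<close> \<open>u \<noteq> b\<close> assms(1) by (auto simp: zero_less_mult_iff not_less)
      then show ?thesis
        using step[OF g] by simp
    qed (use u in blast)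
  next
    fix q assume "q dvd p" and q: "Polynomial.degree q = 2" "\<forall>x. poly q x > 0"
    then obtain g where "p = q * g"
      by (auto simp: dvd_def)
    then show ?case
      using step[of q g] q by simp
  qed
qed

end

section \<open>From matching to Borel sets\<close>

definition term_functions :: "((nat \<Rightarrow> 'a::linordered_field) \<Rightarrow> 'a) set" where
  "term_functions = range (\<lambda>t e. term_val e t)"

interpretation term_functions: coefficient_ring term_functions
proof
  show "(\<lambda>e. 0) \<in> term_functions"
    unfolding term_functions_def by (rule image_eqI[of _ _ Zero]) auto
  show "(\<lambda>e. 1) \<in> term_functions"
    unfolding term_functions_def by (rule image_eqI[of _ _ One]) auto
next
  fix f g :: "(nat \<Rightarrow> 'a) \<Rightarrow> 'a"
  assume "f \<in> term_functions" "g \<in> term_functions"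
  then obtain s t where fg: "f = (\<lambda>e. term_val e s)" "g = (\<lambda>e. term_val e t)"
    by (auto simp: term_functions_def)
  show "(\<lambda>e. f e + g e) \<in> term_functions"
    unfolding term_functions_def fg by (rule image_eqI[of _ _ "Plus s t"]) auto
  show "(\<lambda>e. f e - g e) \<in> term_functions"
    unfolding term_functions_def fg by (rule image_eqI[of _ _ "Minus s t"]) auto
  show "(\<lambda>e. f e * g e) \<in> term_functions"
    unfolding term_functions_def fg by (rule image_eqI[of _ _ "Times s t"]) auto
qed

lemma term_val_as_family:
  "\<exists>p. (\<exists>m. term_functions.family m p) \<and>
     (\<forall>(e :: nat \<Rightarrow> 'a::linordered_field) a. term_val (e(i := a)) t = poly (p e) a)"
proof (induction t)
  case (Var j)
  show ?case
  proof (cases "i = j")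
    case True
    have "(\<lambda>e::nat \<Rightarrow> 'a. Polynomial.coeff [:0, 1:] k) \<in> term_functions" for k
      using term_functions.of_nat_closed[of "if k = 1 then 1 else 0"]
      by (cases "k = 1") (auto simp: coeff_pCons split: nat.split)
    then have "term_functions.family 2 (\<lambda>e::nat \<Rightarrow> 'a. [:0, 1:])"
      by (simp add: term_functions.family_def coeff_eq_0)
    then show ?thesis
      using True by (intro exI[of _ "\<lambda>e. [:0, 1:]"]) auto
  next
    case False
    have "(\<lambda>e::nat \<Rightarrow> 'a. e j) \<in> term_functions"
      unfolding term_functions_def by (rule image_eqI[of _ _ "Var j"]) auto
    then have "term_functions.family 1 (\<lambda>e::nat \<Rightarrow> 'a. [:e j:])"
      by (rule term_functions.family_const)
    then show ?thesis
      using False by (intro exI[of _ "\<lambda>e. [:e j:]"]) auto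
  qed
next
  case Zero
  show ?case
    using term_functions.family_zero by (intro exI[of _ "\<lambda>e. 0"]) auto
next
  case One
  show ?case
    using term_functions.family_const[OF term_functions.one_closed]
    by (intro exI[of _ "\<lambda>e. [:1:]"]) auto
next
  case (Plus s t)
  then obtain p q m n where "term_functions.family m p" "term_functions.family n q"
    "\<forall>(e :: nat \<Rightarrow> 'a) a. term_val (e(i := a)) s = poly (p e) a"
    "\<forall>(e :: nat \<Rightarrow> 'a) a. term_val (e(i := a)) t = poly (q e) a"
    by blast
  then show ?case
    using term_functions.family_add[of m p n q] by (intro exI[of _ "\<lambda>e. p e + q e"]) (auto simp del: fun_upd_apply)
next
  case (Minus s t)
  then obtain p q m n where "term_functions.family m p" "term_functions.family n q"
    "\<forall>(e :: nat \<Rightarrow> 'a) a. term_val (e(i := a)) s = poly (p e) a"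
    "\<forall>(e :: nat \<Rightarrow> 'a) a. term_val (e(i := a)) t = poly (q e) a"
    by blast
  then show ?case
    using term_functions.family_diff[of m p n q] by (intro exI[of _ "\<lambda>e. p e - q e"]) (auto simp del: fun_upd_apply)
next
  case (Times s t)
  then obtain p q m n where "term_functions.family m p" "term_functions.family n q"
    "\<forall>(e :: nat \<Rightarrow> 'a) a. term_val (e(i := a)) s = poly (p e) a"
    "\<forall>(e :: nat \<Rightarrow> 'a) a. term_val (e(i := a)) t = poly (q e) a"
    by blast
  then show ?case
    using term_functions.family_mult[of m p n q] by (intro exI[of _ "\<lambda>e. p e * q e"]) (auto simp del: fun_upd_apply)
qed

text \<open>Induction on the formula. An existential quantifier over the variable \<open>i\<close> is handled by reading the
  relevant terms as polynomials in that variable and applying the matching property.\<close>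

lemma sat_determined:
  fixes sim :: "'a::linordered_field \<Rightarrow> 'a \<Rightarrow> bool"
  assumes matching: "term_functions.matching sim"
    and sym: "\<And>x y. sim x y \<Longrightarrow> sim y x"
    and sgn: "\<And>x y. sim x y \<Longrightarrow> sgn x = sgn y"
  shows "\<exists>T. finite T \<and> (\<forall>e e'. (\<forall>t\<in>T. sim (term_val e t) (term_val e' t)) \<longrightarrow> sat e p = sat e' p)"
proof (induction p)
  case (Equal s t)
  have "s1 - t1 = 0 \<longleftrightarrow> s2 - t2 = 0" if "sim (s1 - t1) (s2 - t2)" for s1 t1 s2 t2
    using sgn[OF that] by (metis sgn_0_0)
  then show ?case
    by (intro exI[of _ "{Minus s t}"]) auto
next
  case (Less s t)
  have "s1 < t1 \<longleftrightarrow> s2 < t2" if "sim (t1 - s1) (t2 - s2)" for s1 t1 s2 t2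
    using sgn[OF that] by (metis diff_gt_0_iff_gt sgn_greater)
  then show ?case
    by (intro exI[of _ "{Minus t s}"]) auto
next
  case (Not p)
  then show ?case
    by simp
next
  case (And p q)
  then obtain T W where TW: "finite T" "finite W"
    "\<And>e e'. (\<forall>t\<in>T. sim (term_val e t) (term_val e' t)) \<Longrightarrow> sat e p = sat e' p"
    "\<And>e e'. (\<forall>t\<in>W. sim (term_val e t) (term_val e' t)) \<Longrightarrow> sat e q = sat e' q"
    by metis
  have "sat e (And p q) = sat e' (And p q)"
    if "\<forall>t\<in>T \<union> W. sim (term_val e t) (term_val e' t)" for e e'
    using TW(3)[of e e'] TW(4)[of e e'] that by simp
  then show ?case
    using TW(1,2) by (intro exI[of _ "T \<union> W"]) blast
next
  case (Exists i p)
  then obtain T where T: "finite T"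
    "\<And>e e'. (\<forall>t\<in>T. sim (term_val e t) (term_val e' t)) \<Longrightarrow> sat e p = sat e' p"
    by metis
  obtain P where P: "\<And>t. \<exists>m. term_functions.family m (P t)"
    "\<And>t (e :: nat \<Rightarrow> 'a) a. term_val (e(i := a)) t = poly (P t e) a"
    using term_val_as_family[of i] by metis
  have "finite (P ` T)" "\<forall>p\<in>P ` T. \<exists>m. term_functions.family m p"
    using T(1) P(1) by auto
  then obtain G where G: "G \<subseteq> term_functions" "finite G"
    and match: "\<And>e e' y. \<forall>g\<in>G. sim (g e) (g e') \<Longrightarrow>
      \<exists>y'. \<forall>p\<in>P ` T. sim (poly (p e) y) (poly (p e') y')"
    using matching unfolding term_functions.matching_def by metis
  obtain W where W: "finite W" "G = (\<lambda>t e. term_val e t) ` W"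
    using finite_subset_image[OF G(2), of "\<lambda>t e. term_val e t" UNIV] G(1)
    by (auto simp: term_functions_def)
  have imp: "\<exists>a. sat (e'(i := a)) p"
    if agree: "\<forall>t\<in>W. sim (term_val e t) (term_val e' t)" and a: "sat (e(i := a)) p" for e e' a
  proof -
    have "\<forall>g\<in>G. sim (g e) (g e')"
      using agree W(2) by auto
    from match[OF this, of a] obtain a' where "\<forall>p\<in>P ` T. sim (poly (p e) a) (poly (p e') a')" ..
    then have "\<forall>t\<in>T. sim (term_val (e(i := a)) t) (term_val (e'(i := a')) t)"
      by (simp add: P(2))
    then show ?thesis
      using T(2) a by blast
  qed
  have "sat e (Exists i p) = sat e' (Exists i p)"
    if agree: "\<forall>t\<in>W. sim (term_val e t) (term_val e' t)" for e e'
  proof -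
    have "\<forall>t\<in>W. sim (term_val e' t) (term_val e t)"
      using agree sym by blast
    then show ?thesis
      using imp[of e e'] imp[of e' e] agree by auto
  qed
  then show ?case
    using W(1) by blast
qed

text \<open>The order topology of an ordered field need not come from a metric, but the usual description of
  continuity with positive tolerances from the field remains valid.\<close>

lemma continuous_map_linorder_field_iff:
  fixes f :: "'b \<Rightarrow> 'a::{linordered_field, linorder_topology}"
  shows "continuous_map S euclidean f \<longleftrightarrow>
    (\<forall>x\<in>topspace S. \<forall>d>0. \<exists>W. openin S W \<and> x \<in> W \<and> (\<forall>y\<in>W. \<bar>f y - f x\<bar> < d))"
proof
  assume cont: "continuous_map S euclidean f"
  show "\<forall>x\<in>topspace S. \<forall>d>0. \<exists>W. openin S W \<and> x \<in> W \<and> (\<forall>y\<in>W. \<bar>f y - f x\<bar> < d)"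
  proof (intro ballI allI impI)
    fix x d assume x: "x \<in> topspace S" and "(d::'a) > 0"
    let ?W = "{y \<in> topspace S. f y \<in> {f x - d<..<f x + d}}"
    have "openin S ?W"
      using cont by (intro openin_continuous_map_preimage[where Y = euclidean]) auto
    then show "\<exists>W. openin S W \<and> x \<in> W \<and> (\<forall>y\<in>W. \<bar>f y - f x\<bar> < d)"
      using x \<open>d > 0\<close> by (intro exI[of _ ?W]) (auto simp: abs_less_iff algebra_simps)
  qed
next
  assume *: "\<forall>x\<in>topspace S. \<forall>d>0. \<exists>W. openin S W \<and> x \<in> W \<and> (\<forall>y\<in>W. \<bar>f y - f x\<bar> < d)"
  show "continuous_map S euclidean f"
    unfolding continuous_map_def
  proof (intro conjI allI impI)
    fix V :: "'a set" assume "openin euclidean V"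
    then have V: "open V"
      by simp
    show "openin S {x \<in> topspace S. f x \<in> V}"
    proof (subst openin_subopen, intro ballI)
      fix x assume "x \<in> {x \<in> topspace S. f x \<in> V}"
      then have x: "x \<in> topspace S" "f x \<in> V"
        by auto
      obtain b where b: "b > f x" "{f x..<b} \<subseteq> V"
        using open_right[OF V x(2), of "f x + 1"] by auto
      obtain a where a: "a < f x" "{a<..f x} \<subseteq> V"
        using open_left[OF V x(2), of "f x - 1"] by auto
      obtain W where W: "openin S W" "x \<in> W" "\<forall>y\<in>W. \<bar>f y - f x\<bar> < min (b - f x) (f x - a)"
        using * x(1) a(1) b(1) by (metis diff_gt_0_iff_gt min_less_iff_conj)
      have "f y \<in> V" if "y \<in> W" for y
      proof -
        have "a < f y" "f y < b"
          using W(3) that by (auto simp: abs_less_iff)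
        then show ?thesis
          using a(2) b(2) by (cases "f x \<le> f y") auto
      qed
      then have "W \<subseteq> {x \<in> topspace S. f x \<in> V}"
        using openin_subset[OF W(1)] by auto
      then show "\<exists>T. openin S T \<and> x \<in> T \<and> T \<subseteq> {x \<in> topspace S. f x \<in> V}"
        using W by blast
    qed
  qed auto
qed

lemma continuous_map_linorder_field_add:
  fixes f g :: "'b \<Rightarrow> 'a::{linordered_field, linorder_topology}"
  assumes "continuous_map S euclidean f" "continuous_map S euclidean g"
  shows "continuous_map S euclidean (\<lambda>x. f x + g x)"
  unfolding continuous_map_linorder_field_iff
proof (intro ballI allI impI)
  fix x d assume x: "x \<in> topspace S" and "(d::'a) > 0"
  then have "d / 2 > 0"
    by simp
  then obtain W V where W: "openin S W" "x \<in> W" "\<forall>y\<in>W. \<bar>f y - f x\<bar> < d / 2"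
    and V: "openin S V" "x \<in> V" "\<forall>y\<in>V. \<bar>g y - g x\<bar> < d / 2"
    using assms x unfolding continuous_map_linorder_field_iff by metis
  have "\<bar>(f y + g y) - (f x + g x)\<bar> < d" if "y \<in> W \<inter> V" for y
  proof -
    have "\<bar>f y - f x\<bar> < d / 2" "\<bar>g y - g x\<bar> < d / 2"
      using W V that by auto
    then have "\<bar>f y - f x\<bar> + \<bar>g y - g x\<bar> < d"
      using add_strict_mono by fastforce
    moreover have "(f y + g y) - (f x + g x) = (f y - f x) + (g y - g x)"
      by simp
    ultimately show ?thesis
      using abs_triangle_ineq[of "f y - f x" "g y - g x"] by simp
  qed
  then show "\<exists>W. openin S W \<and> x \<in> W \<and> (\<forall>y\<in>W. \<bar>(f y + g y) - (f x + g x)\<bar> < d)"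
    using W V by (intro exI[of _ "W \<inter> V"]) (auto intro: openin_Int)
qed

lemma continuous_map_linorder_field_mult:
  fixes f g :: "'b \<Rightarrow> 'a::{linordered_field, linorder_topology}"
  assumes "continuous_map S euclidean f" "continuous_map S euclidean g"
  shows "continuous_map S euclidean (\<lambda>x. f x * g x)"
  unfolding continuous_map_linorder_field_iff
proof (intro ballI allI impI)
  fix x d assume x: "x \<in> topspace S" and "(d::'a) > 0"
  define B where "B = \<bar>f x\<bar> + 1 + \<bar>g x\<bar>"
  define \<delta> where "\<delta> = min 1 (d / B)"
  have "B > 0"
    by (simp add: B_def add_nonneg_pos add_pos_nonneg)
  then have "\<delta> > 0"
    using \<open>d > 0\<close> by (simp add: \<delta>_def)
  then obtain W V where W: "openin S W" "x \<in> W" "\<forall>y\<in>W. \<bar>f y - f x\<bar> < \<delta>"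
    and V: "openin S V" "x \<in> V" "\<forall>y\<in>V. \<bar>g y - g x\<bar> < \<delta>"
    using assms x unfolding continuous_map_linorder_field_iff by metis
  have "\<bar>f y * g y - f x * g x\<bar> < d" if "y \<in> W \<inter> V" for y
  proof -
    have fy: "\<bar>f y - f x\<bar> < \<delta>" and gy: "\<bar>g y - g x\<bar> < \<delta>"
      using W V that by auto
    have "\<delta> \<le> 1"
      by (simp add: \<delta>_def)
    then have "\<bar>f y\<bar> < \<bar>f x\<bar> + 1"
      using fy abs_triangle_ineq2[of "f y" "f x"] by linarith
    have "f y * g y - f x * g x = f y * (g y - g x) + g x * (f y - f x)"
      by (simp add: algebra_simps)
    then have "\<bar>f y * g y - f x * g x\<bar> \<le> \<bar>f y\<bar> * \<bar>g y - g x\<bar> + \<bar>g x\<bar> * \<bar>f y - f x\<bar>"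
      by (metis abs_mult abs_triangle_ineq)
    also have "\<dots> < (\<bar>f x\<bar> + 1) * \<delta> + \<bar>g x\<bar> * \<delta>"
      using fy gy \<open>\<bar>f y\<bar> < \<bar>f x\<bar> + 1\<close>
      by (intro add_less_le_mono mult_strict_mono mult_left_mono) auto
    also have "\<dots> = B * \<delta>"
      by (simp add: B_def algebra_simps)
    also have "\<dots> \<le> B * (d / B)"
      using \<open>B > 0\<close> by (intro mult_left_mono) (auto simp: \<delta>_def)
    also have "\<dots> = d"
      using \<open>B > 0\<close> by simp
    finally show ?thesis .
  qed
  then show "\<exists>W. openin S W \<and> x \<in> W \<and> (\<forall>y\<in>W. \<bar>f y * g y - f x * g x\<bar> < d)"
    using W V by (intro exI[of _ "W \<inter> V"]) (auto intro: openin_Int)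
qed

lemma topspace_affine_topology: "topspace (affine_topology n) = affine_space n"
  by (simp add: affine_topology_def affine_space_def)

lemma continuous_map_term_val:
  fixes b :: "nat \<Rightarrow> 'a::{linordered_field, linorder_topology}"
  shows "continuous_map (affine_topology n) euclidean (\<lambda>x. term_val (\<lambda>i. if i < n then x i else b i) t)"
proof (induction t)
  case (Var i)
  show ?case
  proof (cases "i < n")
    case True
    then show ?thesis
      unfolding affine_topology_def
      using continuous_map_product_projection[of i "{..<n}" "\<lambda>_. euclidean"] by simp
  qed simp
next
  case (Minus s t)
  have "continuous_map (affine_topology n) euclidean
      (\<lambda>x. term_val (\<lambda>i. if i < n then x i else b i) s + (- 1) * term_val (\<lambda>i. if i < n then x i else b i) t)"
    using Minus by (intro continuous_map_linorder_field_add continuous_map_linorder_field_mult) auto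
  then show ?case
    by simp
qed (auto intro: continuous_map_linorder_field_add continuous_map_linorder_field_mult)

text \<open>Let \<open>T\<close> be the set of terms that decide the formula. Split the space into the finitely many sets \<open>Z J\<close> on
  which exactly the terms in \<open>J\<close> vanish. On \<open>Z J\<close> membership depends on the classes of the other terms only,
  so the part of \<open>A\<close> in \<open>Z J\<close> is the trace of the open set \<open>W J\<close> of points with the classes of some point
  of that part. The union defining \<open>W J\<close> may be large, but unions of open sets are harmless.\<close>

theorem definable_imp_borel:
  fixes sim :: "'a::{linordered_field, linorder_topology} \<Rightarrow> 'a \<Rightarrow> bool"
    and A :: "(nat \<Rightarrow> 'a) set"
  assumes matching: "term_functions.matching sim"
    and refl: "\<And>x. sim x x"
    and sym: "\<And>x y. sim x y \<Longrightarrow> sim y x"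
    and sgn: "\<And>x y. sim x y \<Longrightarrow> sgn x = sgn y"
    and open_class: "\<And>x. x \<noteq> 0 \<Longrightarrow> open {y. sim x y}"
    and definable: "or_definable n A"
  shows "borel_set n A"
proof -
  obtain p b where A: "A = {x \<in> affine_space n. sat (\<lambda>i. if i < n then x i else b i) p}"
    using definable by (auto simp: or_definable_def)
  define g where "g = (\<lambda>t x. term_val (\<lambda>i. if i < n then x i else b i) t)"
  obtain T where T: "finite T"
    "\<And>e e'. \<forall>t\<in>T. sim (term_val e t) (term_val e' t) \<Longrightarrow> sat e p = sat e' p"
    using sat_determined[OF matching sym sgn] by blast
  let ?K = "affine_space n :: (nat \<Rightarrow> 'a) set"
  let ?B = "sigma_sets ?K {W. openin (affine_topology n) W}"
  interpret sigma_algebra ?K ?B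
    by (rule sigma_algebra_sigma_sets) (use openin_subset topspace_affine_topology in blast)
  have preimage: "{x \<in> ?K. g t x \<in> V} \<in> ?B" "openin (affine_topology n) {x \<in> ?K. g t x \<in> V}"
    if "open V" for t V
  proof -
    show "openin (affine_topology n) {x \<in> ?K. g t x \<in> V}"
      using openin_continuous_map_preimage[OF continuous_map_term_val, of V n b t] that
      by (simp add: g_def topspace_affine_topology)
    then show "{x \<in> ?K. g t x \<in> V} \<in> ?B"
      by (intro sigma_sets.Basic) simp
  qed
  have nonzero: "{x \<in> ?K. g t x \<noteq> 0} \<in> ?B" for t
    using preimage(1)[of "- {0}" t] by (simp add: open_Compl)
  have zero: "{x \<in> ?K. g t x = 0} \<in> ?B" for t
  proof -
    have "{x \<in> ?K. g t x = 0} = ?K - {x \<in> ?K. g t x \<noteq> 0}"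
      by auto
    then show ?thesis
      using nonzero[of t] compl_sets by simp
  qed
  define Z where "Z = (\<lambda>J. {x \<in> ?K. \<forall>t\<in>T. g t x = 0 \<longleftrightarrow> t \<in> J})"
  have Z: "Z J \<in> ?B" for J
    unfolding Z_def
  proof (rule sets_Collect_finite_All[OF _ T(1)])
    show "{x \<in> ?K. g t x = 0 \<longleftrightarrow> t \<in> J} \<in> ?B" for t
      using zero[of t] nonzero[of t] by (cases "t \<in> J") auto
  qed
  define W where "W = (\<lambda>J. \<Union>x0\<in>A \<inter> Z J. {x \<in> ?K. \<forall>t\<in>T - J. sim (g t x0) (g t x)})"
  have space_open: "openin (affine_topology n) ?K"
    using openin_topspace[of "affine_topology n :: (nat \<Rightarrow> 'a) topology"]
    by (simp only: topspace_affine_topology)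
  have "openin (affine_topology n) {x \<in> ?K. \<forall>t\<in>T - J. sim (g t x0) (g t x)}" if "x0 \<in> Z J" for x0 J
  proof -
    have open_t: "openin (affine_topology n) {x \<in> ?K. sim (g t x0) (g t x)}" if "t \<in> T - J" for t
      using that \<open>x0 \<in> Z J\<close> preimage(2)[of "{y. sim (g t x0) y}" t] open_class by (auto simp: Z_def)
    have "openin (affine_topology n) (?K \<inter> (\<Inter>t\<in>T - J. {x \<in> ?K. sim (g t x0) (g t x)}))"
    proof (cases "T - J = {}")
      case True
      then show ?thesis
        using space_open by (simp only: image_empty Inter_empty Int_UNIV_right)
    next
      case False
      then show ?thesis
        using T(1) open_t by (intro openin_Int space_open openin_Inter) auto
    qed
    moreover have "?K \<inter> (\<Inter>t\<in>T - J. {x \<in> ?K. sim (g t x0) (g t x)}) =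
        {x \<in> ?K. \<forall>t\<in>T - J. sim (g t x0) (g t x)}"
      by auto
    ultimately show ?thesis
      by simp
  qed
  then have "openin (affine_topology n) (W J)" for J
    unfolding W_def by (intro openin_Union) auto
  then have W: "W J \<in> ?B" for J
    by (intro sigma_sets.Basic) simp
  have "A = (\<Union>J\<in>Pow T. Z J \<inter> W J)"
  proof (intro equalityI subsetI)
    fix x assume x: "x \<in> A"
    define J where "J = {t \<in> T. g t x = 0}"
    have "x \<in> Z J"
      using x by (auto simp: J_def Z_def A)
    moreover have "x \<in> W J"
      unfolding W_def using x \<open>x \<in> Z J\<close> refl by (auto simp: A)
    ultimately show "x \<in> (\<Union>J\<in>Pow T. Z J \<inter> W J)"
      by (auto simp: J_def)
  next
    fix x assume "x \<in> (\<Union>J\<in>Pow T. Z J \<inter> W J)"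
    then obtain J x0 where J: "x \<in> Z J" "x0 \<in> A" "x0 \<in> Z J" "\<forall>t\<in>T - J. sim (g t x0) (g t x)"
      by (auto simp: W_def)
    have "sim (g t x0) (g t x)" if "t \<in> T" for t
    proof (cases "t \<in> J")
      case True
      then have "g t x0 = 0" "g t x = 0"
        using J(1,3) that by (auto simp: Z_def)
      then show ?thesis
        using refl by simp
    qed (use J(4) that in blast)
    then have "sat (\<lambda>i. if i < n then x0 i else b i) p = sat (\<lambda>i. if i < n then x i else b i) p"
      by (intro T(2)) (simp add: g_def)
    then show "x \<in> A"
      using J(1,2) by (simp add: A Z_def)
  qed
  also have "\<dots> \<in> ?B"
    using T(1) Z W by (intro finite_UN) auto
  finally show ?thesis
    by (simp add: borel_set_def)
qed

section \<open>Definable sets over almost real closed fields\<close>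

theorem corollary4p2:
  fixes A :: "(nat \<Rightarrow> 'a::{linordered_field, linorder_topology}) set"
    and n :: nat
  assumes "almost_real_closed TYPE('a) TYPE('g::linordered_ab_group_add)"
    and "or_definable n A"
  shows "borel_set n A"
proof -
  obtain v :: "'a \<Rightarrow> 'g" where v: "valuation v" "henselian v" "real_closed_field (residue_field v)"
    using assms(1) by (auto simp: almost_real_closed_def)
  interpret valued_field v
    using v(1) by unfold_locales
  show ?thesis
  proof (cases "\<M> = {0}")
    case True
    interpret artin_schreier "TYPE('a)"
    proof
      show "\<exists>y. x = y * y" if "0 \<le> x" for x :: 'a
      proof -
        obtain y where "x = y * y \<or> x = - (y * y)"
          using trivial_square[OF True v(3)] by blast
        then show ?thesis
          using that by (metis antisym mult_zero_left neg_le_0_iff_le zero_le_square)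
      qed
      show "\<exists>x. poly p x = 0" if "odd (Polynomial.degree p)" for p :: "'a poly"
        using trivial_odd_root[OF True v(3) that] .
    qed
    interpret sign_elimination "TYPE('a)" term_functions
      by unfold_locales (rule ivt_mult, simp_all add: mult_less_0_iff)
    show ?thesis
    proof (rule definable_imp_borel[OF matching_sgn])
      fix x :: 'a assume "x \<noteq> 0"
      then have "{y. sgn x = sgn y} = {0<..} \<or> {y. sgn x = sgn y} = {..<0}"
        by (auto simp: sgn_if)
      then show "open {y. sgn x = sgn y}"
        by (elim disjE) (simp_all only: open_greaterThan open_lessThan)
    qed (simp_all add: assms(2))
  next
    case False
    then obtain c where c: "c \<in> \<M>" "c \<noteq> 0"
      using zero_in_ideal by blast
    interpret henselian_ordered_field v
    proof unfold_locales
      show "henselian v"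
        by (rule v(2))
      show "of_nat m \<notin> \<M>" if "m > 0" for m
        using v(3) that by (rule real_closed_imp_residue_char_0)
    qed
    interpret leading_term_elimination v term_functions ..
    show ?thesis
      using matching_same_leading_term same_leading_term_refl same_leading_term_sym
        same_leading_term_sgn open_same_leading_term[OF c] assms(2)
      by (rule definable_imp_borel)
  qed
qed

end
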